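(* Let $N\ge1$ be an integer, $p>1$, $\delta=\frac{p}{2-p}$ (for $p\neq 2$), $\eta=\frac{N-p}{p-1}$, $p_1=\frac{2N}{N+1}$, and $q^\ast=\frac{N(p-1)+p}{N-p}$ if $p<N$, $q^\ast=\infty$ if $N\le p$. Assume that either $p>2$, or $p<2$ and $\alpha<\delta$; and that $0<\alpha<N$ and $1<q<q^\ast$. For $a\in\mathbb{R}$ let $w(\cdot,a)$ be the solution of $$(|w'|^{p-2}w')'+\frac{N-1}{r}|w'|^{p-2}w'+rw'+\alpha w+|w|^{q-1}w=0\ \text{ in }(0,\infty),\qquad w(0)=a,\quad w'(0)=0.$$ Then there exists $a>0$ such that $w=w(\cdot,a)$ is nonnegative and $\lim_{r\to\infty}r^\alpha w(r)=0$. If $p>2$, it has a compact support. If $p<2$, it is positive and satisfies: - if $p_1<p<2$: $\lim_{r\to\infty}r^\delta w(r)=\ell$, with $\ell=\Big(\delta^{p-1}\frac{\delta-N}{\delta-\alpha}\Big)^{1/(2-p)}$; - if $p<p_1$: $\lim_{r\to\infty}r^\eta w(r)=c$ for some $c>0$; - if $p=p_1$: $\lim_{r\to\infty}r^N(\ln r)^{(N+1)/2}w(r)=\varrho$, with $\varrho=\frac1N\Big(\frac{N(N-1)}{2(N-\alpha)}\Big)^{(N+1)/2}$.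
   Context: For every $a\in\mathbb{R}$ the initial value problem has a unique solution $w(\cdot,a)\in C^1([0,\infty))$ with $|w'|^{p-2}w'\in C^1([0,\infty))$. *)

theory Defs
  imports "HOL-Analysis.Analysis"
begin

definition delta :: "real \<Rightarrow> real" where
  "delta p = p / (2 - p)"

definition eta :: "nat \<Rightarrow> real \<Rightarrow> real" where
  "eta N p = (real N - p) / (p - 1)"

definition p1 :: "nat \<Rightarrow> real" where
  "p1 N = 2 * real N / (real N + 1)"

definition qstar :: "nat \<Rightarrow> real \<Rightarrow> ereal" where
  "qstar N p =
    (if p < real N then ereal ((real N * (p - 1) + p) / (real N - p)) else \<infinity>)"

text \<open>
  The signed power \<open>\<bar>x\<bar>\<^sup>m\<^sup>-\<^sup>1 x\<close>. It is \<open>0\<close> at \<open>x = 0\<close> for every exponent, so for \<open>m > 0\<close>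
  it is the continuous extension, also when \<open>m - 1 < 0\<close>.
\<close>

definition spow :: "real \<Rightarrow> real \<Rightarrow> real" where
  "spow m x = \<bar>x\<bar> powr (m - 1) * x"

text \<open>
  Only the values on \<open>[0, \<infinity>)\<close> matter. Derivatives are taken within \<open>{0..}\<close>, so they are one-sided
  at \<open>0\<close> and the usual ones at \<open>r > 0\<close>. Here \<open>w'\<close> is the derivative of \<open>w\<close>, and \<open>F'\<close> that of
  \<open>\<bar>w'\<bar>\<^sup>p\<^sup>-\<^sup>2 w'\<close>.
\<close>

definition solves_ivp ::
  "nat \<Rightarrow> real \<Rightarrow> real \<Rightarrow> real \<Rightarrow> real \<Rightarrow> (real \<Rightarrow> real) \<Rightarrow> bool" where
  "solves_ivp N p \<alpha> q a w \<longleftrightarrow>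
    (\<exists>w' F'.
      (\<forall>r\<ge>0. (w has_real_derivative w' r) (at r within {0..})) \<and>
      continuous_on {0..} w' \<and>
      (\<forall>r\<ge>0. ((\<lambda>s. spow (p - 1) (w' s)) has_real_derivative F' r) (at r within {0..})) \<and>
      continuous_on {0..} F' \<and>
      (\<forall>r>0. F' r + (real N - 1) / r * spow (p - 1) (w' r)
              + r * w' r + \<alpha> * w r + spow q (w r) = 0) \<and>
      w 0 = a \<and> w' 0 = 0)"

end

theory Submission
  imports Defs
begin

text \<open>
  Shooting in \<open>a\<close>. Write \<open>n = N - 1\<close>, \<open>m = p - 1\<close> and \<open>F = \<bar>w'\<bar>\<^sup>p\<^sup>-\<^sup>2 w'\<close>. The function
  \<open>J = r\<^sup>n (r w + F)\<close> satisfies \<open>J' = r\<^sup>n ((N - \<alpha>) w - \<bar>w\<bar>\<^sup>q\<^sup>-\<^sup>1 w)\<close>. If \<open>J\<close> is positive at a radius up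
  to which \<open>w\<close> is positive and where \<open>w\<^sup>q\<^sup>-\<^sup>1 < N - \<alpha>\<close>, then \<open>J\<close> increases as long as \<open>w > 0\<close>, which
  prevents \<open>w\<close> from vanishing. This is an open condition on \<open>a\<close> and it holds for small \<open>a\<close>. Taking
  a negative value is another open condition; it holds for large \<open>a\<close>, since the rescaled equation
  is a small perturbation of the Lane--Emden equation, for which the Pohozaev identity excludes
  nonnegative solutions when \<open>q < q\<^sup>*\<close>. By connectedness some \<open>a > 0\<close> satisfies neither. For this \<open>a\<close>,
  \<open>w\<close> is nonnegative and tends to \<open>0\<close>, and \<open>J \<le> 0\<close> where \<open>w\<close> is positive and small, that is
  \<open>\<bar>w'\<bar>\<^sup>p\<^sup>-\<^sup>1 \<ge> r w\<close>. If \<open>p > 2\<close>, this forces extinction at a finite radius. If \<open>p < 2\<close>, it forces the decay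
  \<open>w = O(r\<^sup>-\<^sup>\<delta>)\<close>, and the precise behaviour is read off the planar system satisfied by \<open>r\<^sup>\<delta> w\<close> and
  \<open>- r\<^sup>\<delta>\<^sup>-\<^sup>N J\<close> in the variable \<open>ln r\<close>.
\<close>

section \<open>Calculus on half-lines\<close>

text \<open>The drift and zeroth-order terms are almost a divergence:
  \<open>r^n (r w' + \<alpha> w)\<close> equals \<open>(r^(n+1) w)' - (N - \<alpha>) r^n w\<close>.
  So \<open>J'\<close> does not involve \<open>F\<close>, and comparisons of signs or of solutions
  go through \<open>J\<close>. The shooting needs continuity in \<open>a\<close>, but only one
  solution for each \<open>a\<close> is given; the equation is singular at 0, and
  \<open>F \<mapsto> w'\<close> is not Lipschitz at \<open>F = 0\<close> when \<open>p > 2\<close>.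
  Continuity is therefore derived from \<open>J\<close> and from bounds by a dissipated energy. In
  the planar system \<open>k'\<close> has the linear part \<open>(\<delta> - N) k\<close>, and
  comparing \<open>p\<close> with \<open>p1\<close> is comparing \<open>\<delta>\<close> with
  \<open>N\<close>. If \<open>\<delta> > N\<close>, the bounded trajectory settles at the positive
  equilibrium. If \<open>\<delta> < N\<close>, \<open>k\<close> decays like
  \<open>r^(\<delta>-N)\<close> and \<open>U\<close> like \<open>k^(1/(p-1))\<close>, which yields
  the exponent \<open>\<eta>\<close>. At \<open>\<delta> = N\<close> the linear term disappears, and
  \<open>k\<close> decays only like a power of \<open>t = ln r\<close>, the origin of the
  logarithm.\<close>

lemma diff_le_of_deriv_le:
  fixes f g :: "real \<Rightarrow> real"
  assumes "a \<le> b" "continuous_on {a..b} f" "continuous_on {a..b} g"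
    and "\<And>x. a < x \<Longrightarrow> x < b \<Longrightarrow> (f has_real_derivative f' x) (at x)"
    and "\<And>x. a < x \<Longrightarrow> x < b \<Longrightarrow> (g has_real_derivative g' x) (at x)"
    and "\<And>x. a < x \<Longrightarrow> x < b \<Longrightarrow> f' x \<le> g' x"
  shows "f b - f a \<le> g b - g a"
proof -
  have "(g a - f a) \<le> (g b - f b)"
  proof (rule DERIV_nonneg_imp_increasing_open[OF assms(1)])
    fix x assume x: "a < x" "x < b"
    show "\<exists>y. ((\<lambda>x. g x - f x) has_real_derivative y) (at x) \<and> 0 \<le> y"
      using DERIV_diff[OF assms(5)[OF x] assms(4)[OF x]] assms(6)[OF x] by force
  qed (use assms in \<open>auto intro: continuous_intros\<close>)
  then show ?thesis by simp
qed

lemma le_of_deriv_nonneg: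
  fixes f :: "real \<Rightarrow> real"
  assumes "a \<le> b" "continuous_on {a..b} f"
    and "\<And>x. a < x \<Longrightarrow> x < b \<Longrightarrow> (f has_real_derivative f' x) (at x)"
    and "\<And>x. a < x \<Longrightarrow> x < b \<Longrightarrow> 0 \<le> f' x"
  shows "f a \<le> f b"
  by (rule DERIV_nonneg_imp_increasing_open[OF assms(1)]) (use assms in blast)+

section \<open>Signed powers\<close>

lemma spow_nonneg_eq: "0 \<le> x \<Longrightarrow> spow m x = x powr m"
  by (cases "x = 0") (auto simp: spow_def powr_diff)

lemma spow_minus [simp]: "spow m (- x) = - spow m x"
  by (simp add: spow_def)

lemma spow_0 [simp]: "spow m 0 = 0"
  by (simp add: spow_def)

lemma spow_neg_eq: "x \<le> 0 \<Longrightarrow> spow m x = - ((- x) powr m)"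
  using spow_nonneg_eq[of "- x" m] by (simp add: spow_minus)

lemma abs_spow: "\<bar>spow m x\<bar> = \<bar>x\<bar> powr m"
  using spow_nonneg_eq[of "\<bar>x\<bar>" m] by (simp add: spow_def abs_mult)

lemma spow_pos_iff [simp]: "0 < spow m x \<longleftrightarrow> 0 < x"
  by (auto simp: spow_def zero_less_mult_iff)

lemma spow_neg_iff [simp]: "spow m x < 0 \<longleftrightarrow> x < 0"
  by (auto simp: spow_def mult_less_0_iff)

lemma spow_nonneg_iff [simp]: "0 \<le> spow m x \<longleftrightarrow> 0 \<le> x"
  using spow_neg_iff[of m x] by linarith

lemma spow_nonpos_iff [simp]: "spow m x \<le> 0 \<longleftrightarrow> x \<le> 0"
  using spow_pos_iff[of m x] by linarith

lemma spow_spow_inverse: "m \<noteq> 0 \<Longrightarrow> spow (1 / m) (spow m x) = x"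
proof (cases "0 \<le> x")
  case True
  then show "m \<noteq> 0 \<Longrightarrow> ?thesis" by (simp add: spow_nonneg_eq powr_powr)
next
  case False
  then have "spow (1 / m) (spow m (- x)) = - x" if "m \<noteq> 0"
    using that by (simp only: spow_nonneg_eq[of "-x"] spow_nonneg_eq[of "(-x) powr m"] powr_ge_zero) (simp add: powr_powr)
  then show "m \<noteq> 0 \<Longrightarrow> ?thesis" by simp
qed

lemma spow_strict_mono:
  assumes "0 < m" "x < y" shows "spow m x < spow m y"
proof -
  consider "0 \<le> x" | "x < 0" "0 \<le> y" | "y < 0" by linarith
  then show ?thesis
  proof cases
    case 1 then show ?thesis using assms by (simp add: spow_nonneg_eq powr_less_mono2)
  next
    case 2 then show ?thesis by (meson spow_neg_iff spow_nonneg_iff less_le_trans)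
  next
    case 3
    then have "spow m (-y) < spow m (-x)"
      using assms by (simp only: spow_nonneg_eq) (simp add: spow_nonneg_eq powr_less_mono2 del: spow_minus)
    then show ?thesis by simp
  qed
qed

lemma spow_mult: "0 \<le> c \<Longrightarrow> spow m (c * x) = c powr m * spow m x"
  by (cases "c = 0") (auto simp: spow_def abs_mult powr_mult powr_diff)

lemma spow_mult_self: "spow c x * x = \<bar>x\<bar> powr (c + 1)"
  by (cases "x = 0") (auto simp: spow_def powr_diff powr_add field_simps abs_if)

lemma DERIV_spow:
  assumes "1 < q"
  shows "(spow q has_real_derivative q * \<bar>x\<bar> powr (q - 1)) (at x)"
proof -
  consider "x > 0" | "x = 0" | "x < 0" by linarith
  then show ?thesis
  proof cases
    case 1
    have "((\<lambda>x. x powr q) has_real_derivative q * x powr (q - 1)) (at x)"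
      using 1 by (rule has_real_derivative_powr)
    then have "(spow q has_real_derivative q * x powr (q - 1)) (at x)"
      by (rule has_field_derivative_transform_within_open[where S = "{0<..}"])
        (use 1 in \<open>auto simp: spow_nonneg_eq\<close>)
    then show ?thesis using 1 by simp
  next
    case 2
    have "((\<lambda>h. \<bar>h\<bar> powr (q - 1)) \<longlongrightarrow> \<bar>0\<bar> powr (q - 1)) (at (0::real))"
      using assms by (intro tendsto_intros) auto
    then have "((\<lambda>h. \<bar>h\<bar> powr (q - 1)) \<longlongrightarrow> 0) (at (0::real))"
      by simp
    then have "((\<lambda>h. (spow q (0 + h) - spow q 0) / h) \<longlongrightarrow> 0) (at 0)"
      by (rule Lim_transform_within[where d = 1]) (auto simp: spow_def)
    then show ?thesis using 2 by (simp add: DERIV_def)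
  next
    case 3
    have "((\<lambda>x. - ((- x) powr q)) has_real_derivative q * (- x) powr (q - 1)) (at x)"
      using 3 by (auto intro!: derivative_eq_intros)
    then have "(spow q has_real_derivative q * (- x) powr (q - 1)) (at x)"
      by (rule has_field_derivative_transform_within_open[where S = "{..<0}"])
        (use 3 in \<open>auto simp: spow_neg_eq\<close>)
    then show ?thesis using 3 by simp
  qed
qed

lemma DERIV_abs_powr:
  assumes "0 < c"
  shows "((\<lambda>x. \<bar>x\<bar> powr (c + 1)) has_real_derivative (c + 1) * spow c x) (at x)"
proof -
  consider "x > 0" | "x = 0" | "x < 0" by linarith
  then show ?thesis
  proof cases
    case 1
    have "((\<lambda>x. x powr (c + 1)) has_real_derivative (c + 1) * x powr (c + 1 - 1)) (at x)"
      using 1 by (rule has_real_derivative_powr)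
    then have "((\<lambda>x. \<bar>x\<bar> powr (c + 1)) has_real_derivative (c + 1) * x powr (c + 1 - 1)) (at x)"
      by (rule has_field_derivative_transform_within_open[where S = "{0<..}"]) (use 1 in auto)
    then show ?thesis using 1 by (simp add: spow_nonneg_eq)
  next
    case 2
    \<comment> \<open>At 0 the difference quotient of \<open>\<bar>x\<bar> powr (c + 1)\<close> is
      \<open>spow c h\<close> itself.\<close>
    have "((\<lambda>h. spow c h) \<longlongrightarrow> 0) (at 0)"
    proof (rule Lim_null_comparison)
      show "\<forall>\<^sub>F h in at 0. norm (spow c h) \<le> \<bar>h\<bar> powr c"
        by (simp add: abs_spow)
      have "((\<lambda>h. \<bar>h\<bar> powr c) \<longlongrightarrow> \<bar>0\<bar> powr c) (at (0::real))"
        using assms by (intro tendsto_intros) auto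
      then show "((\<lambda>h. \<bar>h\<bar> powr c) \<longlongrightarrow> 0) (at (0::real))" by simp
    qed
    then have "((\<lambda>h. (\<bar>0 + h\<bar> powr (c + 1) - \<bar>0\<bar> powr (c + 1)) / h) \<longlongrightarrow> 0) (at 0)"
      by (rule Lim_transform_within[where d = 1]) (auto simp: spow_mult_self[symmetric])
    then show ?thesis using 2 by (simp add: DERIV_def)
  next
    case 3
    have "((\<lambda>x. (- x) powr (c + 1)) has_real_derivative - ((c + 1) * (- x) powr c)) (at x)"
      using 3 by (auto intro!: derivative_eq_intros)
    then have "((\<lambda>x. \<bar>x\<bar> powr (c + 1)) has_real_derivative - ((c + 1) * (- x) powr c)) (at x)"
      by (rule has_field_derivative_transform_within_open[where S = "{..<0}"]) (use 3 in auto)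
    then show ?thesis using 3 by (simp add: spow_neg_eq)
  qed
qed

lemma continuous_on_spow:
  assumes "0 < m" shows "continuous_on UNIV (spow m)"
proof -
  have "isCont (spow m) x" for x
  proof (cases "x = 0")
    case True
    have "((\<lambda>h. spow m h) \<longlongrightarrow> 0) (at 0)"
    proof (rule Lim_null_comparison)
      show "\<forall>\<^sub>F h in at 0. norm (spow m h) \<le> \<bar>h\<bar> powr m"
        by (simp add: abs_spow)
      have "((\<lambda>h. \<bar>h\<bar> powr m) \<longlongrightarrow> \<bar>0\<bar> powr m) (at (0::real))"
        using assms by (intro tendsto_intros) auto
      then show "((\<lambda>h. \<bar>h\<bar> powr m) \<longlongrightarrow> 0) (at (0::real))" by simp
    qed
    then show ?thesis using True by (simp add: isCont_def)
  next
    case False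
    then show ?thesis unfolding spow_def by (intro continuous_intros) auto
  qed
  then show ?thesis by (simp add: continuous_at_imp_continuous_on)
qed

lemma continuous_on_spow_comp:
  "0 < m \<Longrightarrow> continuous_on S f \<Longrightarrow> continuous_on S (\<lambda>x. spow m (f x))"
  using continuous_on_compose2[OF continuous_on_spow, of m S f] by auto

section \<open>Barriers, escape and limits on half-lines\<close>

lemma last_point:
  fixes Z :: "real \<Rightarrow> real"
  assumes "t1 \<le> t2" "continuous_on {t1..t2} Z" "e \<le> Z t1"
  obtains x where "t1 \<le> x" "x \<le> t2" "e \<le> Z x" "\<And>y. x < y \<Longrightarrow> y \<le> t2 \<Longrightarrow> Z y < e"
proof -
  let ?A = "{x \<in> {t1..t2}. e \<le> Z x}"
  have "closed ?A"
    by (intro continuous_closed_preimage_constant continuous_on_closed_Collect_le assms continuous_intros | simp)+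
  then have "compact ?A"
    by (metis (no_types, lifting) bounded_closed_interval bounded_subset compact_eq_bounded_closed mem_Collect_eq subsetI)
  moreover have "?A \<noteq> {}" using assms by auto
  ultimately obtain x where "x \<in> ?A" "\<forall>y\<in>?A. y \<le> x"
    using compact_attains_sup by blast
  then show ?thesis
    by (intro that[of x]) (auto simp: not_le[symmetric], meson linorder_linear order_trans)
qed

text \<open>After the last time at or below \<open>B\<close> the function is above \<open>B\<close>,
  hence nonincreasing, so it cannot have risen above \<open>B\<close> at \<open>t2\<close>.\<close>

lemma barrier_above:
  fixes Z :: "real \<Rightarrow> real"
  assumes D: "\<And>t. t1 \<le> t \<Longrightarrow> (Z has_real_derivative Z' t) (at t)"
    and start: "Z t1 \<le> B" and neg: "\<And>t. t1 \<le> t \<Longrightarrow> B < Z t \<Longrightarrow> Z' t \<le> 0"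
    and "t1 \<le> t2"
  shows "Z t2 \<le> B"
proof (rule ccontr)
  assume c: "\<not> Z t2 \<le> B"
  have cont: "continuous_on {t1..t2} Z"
    by (rule DERIV_continuous_on[of _ _ Z']) (use D in \<open>auto intro: has_field_derivative_at_within\<close>)
  obtain x where x: "t1 \<le> x" "x \<le> t2" "- B \<le> - Z x" "\<And>y. x < y \<Longrightarrow> y \<le> t2 \<Longrightarrow> - Z y < - B"
    using last_point[of t1 t2 "\<lambda>t. - Z t" "- B"] cont start \<open>t1 \<le> t2\<close>
    by (metis continuous_on_minus neg_le_iff_le)
  have "Z t2 - Z x \<le> 0 - 0"
    by (rule diff_le_of_deriv_le[where f' = Z' and g' = "\<lambda>_. 0" and g = "\<lambda>_. 0"])
      (use x D neg in \<open>auto intro: continuous_on_subset[OF cont]\<close>)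
  then show False using c x(3) by simp
qed

text \<open>The growth condition is only required on \<open>e \<le> Z\<close>, and it perpetuates
  itself: at a last point with \<open>e \<le> Z\<close> the derivative is positive, so
  \<open>Z\<close> still exceeds \<open>e\<close> just afterwards.\<close>

lemma escape:
  fixes Z :: "real \<Rightarrow> real"
  assumes D: "\<And>t. t1 \<le> t \<Longrightarrow> (Z has_real_derivative Z' t) (at t)"
    and start: "e \<le> Z t1" and c: "0 < c" and pos: "\<And>t. t1 \<le> t \<Longrightarrow> e \<le> Z t \<Longrightarrow> c \<le> Z' t"
    and "t1 \<le> t2"
  shows "e \<le> Z t2" and "Z t1 + c * (t2 - t1) \<le> Z t2"
proof -
  have cont: "continuous_on {t1..t} Z" for t
    by (rule DERIV_continuous_on[of _ _ Z']) (use D in \<open>auto intro: has_field_derivative_at_within\<close>)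
  have stay: "e \<le> Z t" if t: "t1 \<le> t" for t
  proof (rule ccontr)
    assume "\<not> e \<le> Z t"
    obtain x where x: "t1 \<le> x" "x \<le> t" "e \<le> Z x" "\<And>y. x < y \<Longrightarrow> y \<le> t \<Longrightarrow> Z y < e"
      using last_point[of t1 t Z e] cont start t by metis
    have "x < t" using x(2,3) \<open>\<not> e \<le> Z t\<close> by (cases "x = t") auto
    have "0 < Z' x" using pos[of x] x c by linarith
    then obtain d where "d > 0" "\<forall>h>0. h < d \<longrightarrow> Z x < Z (x + h)"
      using DERIV_pos_inc_right[OF D[OF x(1)]] by blast
    moreover define h where "h = min (d / 2) (t - x)"
    ultimately have "Z x < Z (x + h)" "0 < h" "x + h \<le> t" using \<open>x < t\<close> by auto
    then show False using x(3) x(4)[of "x + h"] by simp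
  qed
  show "e \<le> Z t2" using stay assms(5) .
  have "c * t2 - c * t1 \<le> Z t2 - Z t1"
    by (rule diff_le_of_deriv_le[where g' = Z' and f' = "\<lambda>_. c"])
      (use D pos stay cont assms(5) in \<open>auto intro!: continuous_intros derivative_eq_intros\<close>)
  then show "Z t1 + c * (t2 - t1) \<le> Z t2" by (simp add: algebra_simps)
qed

text \<open>The recurring contradiction of the asymptotic arguments: a quantity bounded above, yet
  pushed upwards at a fixed rate wherever it is at least its threshold. Decreasing quantities enter
  with the opposite sign.\<close>

lemma escape_unbounded:
  fixes Z :: "real \<Rightarrow> real"
  assumes D: "\<And>t. t1 \<le> t \<Longrightarrow> (Z has_real_derivative Z' t) (at t)"
    and start: "e \<le> Z t1" and c: "0 < c" and pos: "\<And>t. t1 \<le> t \<Longrightarrow> e \<le> Z t \<Longrightarrow> c \<le> Z' t"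
    and bound: "\<And>t. t1 \<le> t \<Longrightarrow> Z t < B"
  shows False
proof -
  define t2 where "t2 = t1 + (B - Z t1) / c"
  have "t1 \<le> t2" using bound[of t1] c by (simp add: t2_def)
  then have "B \<le> Z t2" using escape(2)[OF D start c pos \<open>t1 \<le> t2\<close>] c by (simp add: t2_def)
  then show False using bound[of t2] \<open>t1 \<le> t2\<close> by simp
qed

text \<open>Instability in forward time does the work: at a late time, \<open>y \<le> V\<close>
  makes the derivative at least a positive constant, and \<open>V\<close> would escape to
  infinity.\<close>

lemma bounded_solution_upper:
  fixes V :: "real \<Rightarrow> real"
  assumes D: "\<And>t. t0 \<le> t \<Longrightarrow> (V has_real_derivative \<eta> * V t - f t) (at t)"
    and \<eta>: "0 < \<eta>" and bound: "\<And>t. t0 \<le> t \<Longrightarrow> V t \<le> B" and f: "(f \<longlongrightarrow> L) at_top" and y: "L / \<eta> < y"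
  shows "\<forall>\<^sub>F t in at_top. V t < y"
proof -
  \<comment> \<open>Half of the gap: \<open>\<eta> * y = L + 2 * e\<close>, one \<open>e\<close> for
    the deviation of \<open>f\<close> from \<open>L\<close> and one for the growth rate.\<close>
  define e where "e = (\<eta> * y - L) / 2"
  have e: "0 < e" using y \<eta> by (simp add: e_def field_simps)
  have "\<forall>\<^sub>F t in at_top. f t < L + e"
    using f e by (intro order_tendstoD) auto
  then obtain T where T: "\<And>t. T \<le> t \<Longrightarrow> f t < L + e" by (auto simp: eventually_at_top_linorder)
  have "V t < y" if t: "max t0 T \<le> t" for t
  proof (rule ccontr)
    assume "\<not> V t < y"
    then have start: "y \<le> V t" by simp
    show False
    proof (rule escape_unbounded[where Z = V and ?t1.0 = t and e = y and c = e and B = "B + 1", OF D start e])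
      fix s assume s: "t \<le> s"
      show "t0 \<le> s" using s t by simp
      show "V s < B + 1" using bound[of s] s t by simp
      assume "y \<le> V s"
      then have "\<eta> * y \<le> \<eta> * V s" using \<eta> by simp
      moreover have "\<eta> * y = L + 2 * e" by (simp add: e_def field_simps)
      ultimately show "e \<le> \<eta> * V s - f s" using T[of s] s t by simp
    qed
  qed
  then show ?thesis unfolding eventually_at_top_linorder by blast
qed

lemma bounded_solution_limit:
  fixes V :: "real \<Rightarrow> real"
  assumes D: "\<And>t. t0 \<le> t \<Longrightarrow> (V has_real_derivative \<eta> * V t - f t) (at t)"
    and \<eta>: "0 < \<eta>" and bound: "\<And>t. t0 \<le> t \<Longrightarrow> \<bar>V t\<bar> \<le> B" and f: "(f \<longlongrightarrow> L) at_top"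
  shows "(V \<longlongrightarrow> L / \<eta>) at_top"
proof (rule order_tendstoI)
  fix y assume "L / \<eta> < y"
  then show "\<forall>\<^sub>F t in at_top. V t < y"
    using bound by (intro bounded_solution_upper[where B = B, OF D \<eta> _ f]) (auto simp: abs_le_iff)
next
  fix y assume "y < L / \<eta>"
  moreover have "((\<lambda>t. - V t) has_real_derivative \<eta> * - V t - - f t) (at t)" if "t0 \<le> t" for t
    using DERIV_minus[OF D[OF that]] by simp
  ultimately have "\<forall>\<^sub>F t in at_top. - V t < - y"
    using bound by (intro bounded_solution_upper[where B = B and ?t0.0 = t0, OF _ \<eta> _ tendsto_minus[OF f]]) (auto simp: abs_le_iff)
  then show "\<forall>\<^sub>F t in at_top. y < V t" by simp
qed

text \<open>The signs of the derivative at the two ends exclude the endpoints as maximum points.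
  This supplies the critical points in the oscillating case of the planar system.\<close>

lemma interior_max:
  fixes f :: "real \<Rightarrow> real"
  assumes D: "\<And>x. a \<le> x \<Longrightarrow> x \<le> b \<Longrightarrow> (f has_real_derivative f' x) (at x)"
    and ab: "a \<le> b" "0 < f' a" "f' b < 0"
  obtains x where "a < x" "x < b" "f' x = 0" "\<And>y. a \<le> y \<Longrightarrow> y \<le> b \<Longrightarrow> f y \<le> f x"
proof -
  have "a < b" using ab by (cases "a = b") auto
  have "continuous_on {a..b} f"
    by (rule DERIV_continuous_on[OF has_field_derivative_at_within[OF D]]) auto
  then have "\<exists>x\<in>{a..b}. \<forall>y\<in>{a..b}. f y \<le> f x"
    using ab(1) by (intro continuous_attains_sup) auto
  then obtain x where x: "a \<le> x" "x \<le> b" "\<And>y. a \<le> y \<Longrightarrow> y \<le> b \<Longrightarrow> f y \<le> f x" by auto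
  have "x \<noteq> a"
  proof
    assume "x = a"
    then obtain h where h: "0 < h" "\<And>y. 0 < y \<Longrightarrow> y < h \<Longrightarrow> f x < f (x + y)"
      using DERIV_pos_inc_right[OF D[OF x(1,2)]] ab(2) by blast
    define y where "y = min (h / 2) (b - a)"
    have "0 < y" "y < h" "a + y \<le> b" using h(1) \<open>a < b\<close> by (auto simp: y_def)
    then show False using h(2)[of y] x(3)[of "a + y"] \<open>x = a\<close> by simp
  qed
  moreover have "x \<noteq> b"
  proof
    assume "x = b"
    then obtain h where h: "0 < h" "\<And>y. 0 < y \<Longrightarrow> y < h \<Longrightarrow> f x < f (x - y)"
      using DERIV_neg_dec_left[OF D[OF x(1,2)]] ab(3) by blast
    define y where "y = min (h / 2) (b - a)"
    have "0 < y" "y < h" "a \<le> b - y" using h(1) \<open>a < b\<close> by (auto simp: y_def)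
    then show False using h(2)[of y] x(3)[of "b - y"] \<open>x = b\<close> by simp
  qed
  ultimately have xx: "a < x" "x < b" using x by auto
  have "f' x = 0"
    by (rule DERIV_local_max[OF D[OF x(1,2)], of "min (x - a) (b - x)"]) (use xx x(3) in auto)
  then show ?thesis using that xx x(3) by blast
qed

lemma antimono_limit:
  fixes f :: "real \<Rightarrow> real"
  assumes anti: "\<And>x y. t0 \<le> x \<Longrightarrow> x \<le> y \<Longrightarrow> f y \<le> f x" and bound: "\<And>x. t0 \<le> x \<Longrightarrow> B \<le> f x"
  obtains l where "B \<le> l" "(f \<longlongrightarrow> l) at_top" "\<And>x. t0 \<le> x \<Longrightarrow> l \<le> f x"
proof -
  define l where "l = Inf (f ` {t0..})"
  have bdd: "bdd_below (f ` {t0..})" using bound by (auto intro!: bdd_belowI[of _ B])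
  have low: "l \<le> f x" if "t0 \<le> x" for x
    unfolding l_def using that by (intro cInf_lower bdd) auto
  have "B \<le> l" unfolding l_def using bound by (intro cInf_greatest) auto
  moreover have "(f \<longlongrightarrow> l) at_top"
  proof (rule tendstoI)
    fix e :: real assume "0 < e"
    then have "\<exists>y\<in>f ` {t0..}. y < l + e"
      unfolding l_def using bdd by (intro cInf_lessD) auto
    then obtain T where T: "t0 \<le> T" "f T < l + e" by auto
    have "dist (f x) l < e" if "T \<le> x" for x
      using anti[OF T(1) that] T low[of x] that by (auto simp: dist_real_def)
    then show "\<forall>\<^sub>F x in at_top. dist (f x) l < e" by (auto simp: eventually_at_top_linorder)
  qed
  ultimately show ?thesis using that low by blast
qed

lemma first_zero:
  fixes f :: "real \<Rightarrow> real"
  assumes "x \<le> y" "continuous_on {x..y} f" "0 < f x" "f y \<le> 0"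
  obtains R where "x < R" "R \<le> y" "f R = 0" "\<And>t. x \<le> t \<Longrightarrow> t < R \<Longrightarrow> 0 < f t"
proof -
  let ?A = "{t \<in> {x..y}. f t \<le> 0}"
  have "closed ?A"
    by (intro continuous_on_closed_Collect_le assms continuous_intros | simp)+
  then have "compact ?A"
    by (metis (no_types, lifting) bounded_closed_interval bounded_subset compact_eq_bounded_closed mem_Collect_eq subsetI)
  moreover have "?A \<noteq> {}" using assms by auto
  ultimately obtain R where R: "R \<in> ?A" "\<forall>t\<in>?A. R \<le> t"
    using compact_attains_inf by blast
  have "continuous_on {x..R} f" using R by (intro continuous_on_subset[OF assms(2)]) auto
  then obtain z where z: "x \<le> z" "z \<le> R" "f z = 0"
    using IVT2'[of f R 0 x] R assms(3) by auto
  then have "z = R" using R by force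
  then have "f R = 0" using z by simp
  moreover have "x < R" using R(1) \<open>f R = 0\<close> assms(3) by (cases "x = R") auto
  moreover have "0 < f t" if "x \<le> t" "t < R" for t
  proof (rule ccontr)
    assume "\<not> 0 < f t"
    then have "t \<in> ?A" using that R(1) by auto
    then show False using R(2) that(2) by force
  qed
  ultimately show ?thesis using that[of R] R(1) by simp
qed

section \<open>Radial solutions\<close>

text \<open>
  The dimension is \<open>n + 1\<close>. The equation of the theorem has \<open>\<epsilon> = 1\<close>; the rescaling that
  normalises \<open>w 0\<close> to \<open>1\<close> turns this into \<open>\<epsilon> = a\<^sup>1\<^sup>-\<^sup>q\<close>.
\<close>

locale radial_sol =
  fixes n :: nat and m \<alpha> q \<epsilon> a :: real and w F :: "real \<Rightarrow> real"
  assumes m_pos: "0 < m" and alpha_pos: "0 < \<alpha>" and alpha_less: "\<alpha> < real n + 1"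
    and q_gt: "1 < q" and eps_pos: "0 < \<epsilon>" and a_pos: "0 < a"
    and cont_w: "continuous_on {0..} w" and cont_F: "continuous_on {0..} F"
    and w_0: "w 0 = a" and F_0: "F 0 = 0"
    and w_deriv: "\<And>r. 0 < r \<Longrightarrow> (w has_real_derivative spow (1 / m) (F r)) (at r)"
    and F_deriv: "\<And>r. 0 < r \<Longrightarrow> (F has_real_derivative
      - (real n / r) * F r - \<epsilon> * (r * spow (1 / m) (F r) + \<alpha> * w r) - spow q (w r)) (at r)"
begin

section \<open>Signs, monotonicity and energy\<close>

definition c :: real where "c = 1 / m"

lemma c_pos: "0 < c" using m_pos by (simp add: c_def)

lemma w_deriv_c: "0 < r \<Longrightarrow> (w has_real_derivative spow c (F r)) (at r)"
  using w_deriv by (simp add: c_def)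

lemma F_deriv_c: "0 < r \<Longrightarrow> (F has_real_derivative
      - (real n / r) * F r - \<epsilon> * (r * spow c (F r) + \<alpha> * w r) - spow q (w r)) (at r)"
  using F_deriv by (simp add: c_def)

lemma continuous_on_w: "0 \<le> x \<Longrightarrow> continuous_on {x..y} w"
  by (rule continuous_on_subset[OF cont_w]) auto

lemma continuous_on_F: "0 \<le> x \<Longrightarrow> continuous_on {x..y} F"
  by (rule continuous_on_subset[OF cont_F]) auto

text \<open>A positive maximum of \<open>F\<close> on \<open>[0, r]\<close> would lie at some
  \<open>x > 0\<close>, where the equation gives \<open>F' < 0\<close>: all its terms have the same
  sign once \<open>0 \<le> w x\<close>. Then \<open>F\<close> would be larger just to the
  left.\<close>

lemma F_nonpos:
  assumes "0 \<le> r" and nonneg: "\<And>s. 0 < s \<Longrightarrow> s \<le> r \<Longrightarrow> 0 \<le> w s"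
  shows "F r \<le> 0"
proof -
  have "\<exists>x\<in>{0..r}. \<forall>y\<in>{0..r}. F y \<le> F x"
    by (rule continuous_attains_sup) (use assms in \<open>auto intro: continuous_on_F\<close>)
  then obtain x where x: "0 \<le> x" "x \<le> r" "\<And>y. 0 \<le> y \<Longrightarrow> y \<le> r \<Longrightarrow> F y \<le> F x" by auto
  have "F x \<le> 0"
  proof (rule ccontr)
    assume pos: "\<not> F x \<le> 0"
    then have x0: "0 < x" using x(1) F_0 by (cases "x = 0") auto
    have "0 < \<epsilon> * (x * spow c (F x) + \<alpha> * w x)"
      using pos x0 x(2) nonneg[of x] alpha_pos eps_pos by (auto intro!: mult_pos_pos add_pos_nonneg)
    moreover have "0 \<le> real n / x * F x" using pos x0 by auto
    moreover have "0 \<le> spow q (w x)" using nonneg[of x] x0 x(2) by simp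
    ultimately have "- (real n / x) * F x - \<epsilon> * (x * spow c (F x) + \<alpha> * w x) - spow q (w x) < 0"
      by linarith
    from DERIV_neg_dec_left[OF F_deriv_c[OF x0] this]
    obtain d where "0 < d" "\<forall>h>0. h < d \<longrightarrow> F x < F (x - h)" by blast
    moreover define h where "h = min (d / 2) x"
    ultimately have "F x < F (x - h)" "0 \<le> x - h" "x - h \<le> r" using x0 x(2) by auto
    then show False using x(3)[of "x - h"] by simp
  qed
  then show ?thesis using x(3)[of r] assms(1) by simp
qed

lemma w_antimono:
  assumes "0 \<le> r" "r \<le> s" and nonneg: "\<And>x. 0 < x \<Longrightarrow> x < s \<Longrightarrow> 0 \<le> w x"
  shows "w s \<le> w r"
proof -
  have "w s - w r \<le> (\<lambda>_. 0) s - (\<lambda>_. 0) r"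
    by (rule diff_le_of_deriv_le[where f' = "\<lambda>x. spow c (F x)" and g' = "\<lambda>_. 0"])
      (use assms w_deriv_c F_nonpos in \<open>auto intro: continuous_on_w\<close>)
  then show ?thesis by simp
qed

text \<open>Mechanical energy: with \<open>m = p - 1\<close> the first term is
  \<open>(p - 1) / p * |w'|^p\<close>, and the other two form the potential of
  \<open>\<epsilon> \<alpha> w + |w|^(q-1) w\<close>. The friction \<open>n / r\<close> and the
  drift \<open>\<epsilon> r w'\<close> both dissipate it.\<close>

definition energy :: "real \<Rightarrow> real" where
  "energy r = 1 / (c + 1) * \<bar>F r\<bar> powr (c + 1) + \<epsilon> * \<alpha> / 2 * (w r)\<^sup>2 + 1 / (q + 1) * \<bar>w r\<bar> powr (q + 1)"

lemma energy_deriv: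
  assumes "0 < r"
  shows "(energy has_real_derivative
    - (real n / r * (spow c (F r) * F r)) - \<epsilon> * r * (spow c (F r))\<^sup>2) (at r)"
proof -
  have 1: "((\<lambda>r. \<bar>F r\<bar> powr (c + 1)) has_real_derivative (c + 1) * spow c (F r) *
     (- (real n / r) * F r - \<epsilon> * (r * spow c (F r) + \<alpha> * w r) - spow q (w r))) (at r)"
    by (rule DERIV_chain2[OF DERIV_abs_powr[OF c_pos] F_deriv_c[OF assms]])
  have 2: "((\<lambda>r. \<bar>w r\<bar> powr (q + 1)) has_real_derivative (q + 1) * spow q (w r) * spow c (F r)) (at r)"
    by (rule DERIV_chain2[OF DERIV_abs_powr w_deriv_c[OF assms]]) (use q_gt in auto)
  have c1: "1 / (c + 1) * (c + 1) = 1" "1 / (q + 1) * (q + 1) = 1" using c_pos q_gt by auto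
  have "(energy has_real_derivative (1 / (c + 1) * ((c + 1) * spow c (F r) *
     (- (real n / r) * F r - \<epsilon> * (r * spow c (F r) + \<alpha> * w r) - spow q (w r)))
     + \<epsilon> * \<alpha> / 2 * (2 * (spow c (F r) * w r))
     + 1 / (q + 1) * ((q + 1) * spow q (w r) * spow c (F r)))) (at r)"
    unfolding energy_def
    by (intro DERIV_add DERIV_cmult 1 2 DERIV_cong[OF DERIV_power[OF w_deriv_c[OF assms], of 2]]) simp
  moreover have "1 / (c + 1) * ((c + 1) * spow c (F r) * X) = spow c (F r) * X"
     "1 / (q + 1) * ((q + 1) * spow q (w r) * X) = spow q (w r) * X" for X
    using c1 by (simp_all only: mult.assoc[symmetric] mult_1)
  ultimately show ?thesis by (elim DERIV_cong) (simp only:, simp add: algebra_simps power2_eq_square)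
qed

lemma energy_antimono:
  assumes "0 \<le> r" "r \<le> s" shows "energy s \<le> energy r"
proof -
  have cont: "continuous_on {r..s} energy"
    unfolding energy_def spow_mult_self[symmetric] using assms c_pos q_gt
    by (intro continuous_intros continuous_on_spow_comp continuous_on_w continuous_on_F) auto
  have "energy s - energy r \<le> (\<lambda>_. 0) s - (\<lambda>_. 0) r"
  proof (rule diff_le_of_deriv_le[where g' = "\<lambda>_. 0", OF assms(2) cont])
    fix x assume "r < x"
    then have x: "0 < x" using assms by simp
    show "(energy has_real_derivative
      - (real n / x * (spow c (F x) * F x)) - \<epsilon> * x * (spow c (F x))\<^sup>2) (at x)"
      by (rule energy_deriv[OF x])
    show "- (real n / x * (spow c (F x) * F x)) - \<epsilon> * x * (spow c (F x))\<^sup>2 \<le> 0"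
    proof -
      have "0 \<le> real n / x * (spow c (F x) * F x)" "0 \<le> \<epsilon> * x * (spow c (F x))\<^sup>2"
        using x eps_pos by (auto simp: spow_mult_self)
      then show ?thesis by linarith
    qed
  qed auto
  then show ?thesis by simp
qed

lemma energy_nonneg_parts:
  "0 \<le> 1 / (c + 1) * \<bar>F r\<bar> powr (c + 1)" "0 \<le> \<epsilon> * \<alpha> / 2 * (w r)\<^sup>2" "0 \<le> 1 / (q + 1) * \<bar>w r\<bar> powr (q + 1)"
  using c_pos q_gt eps_pos alpha_pos by auto

lemma energy_0: "energy 0 = \<epsilon> * \<alpha> / 2 * a\<^sup>2 + 1 / (q + 1) * a powr (q + 1)"
  using c_pos a_pos by (simp add: energy_def F_0 w_0)

lemma zero_after:
  assumes "0 \<le> r" "r \<le> s" "w r = 0" "F r = 0" shows "w s = 0"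
proof -
  have "energy r = 0" using assms c_pos q_gt by (simp add: energy_def)
  then have "energy s \<le> 0" using energy_antimono[OF assms(1,2)] by simp
  then have "\<epsilon> * \<alpha> / 2 * (w s)\<^sup>2 \<le> 0" using energy_nonneg_parts[of s] by (simp add: energy_def)
  then show ?thesis using eps_pos alpha_pos by (simp add: mult_le_0_iff)
qed

section \<open>The function \<open>J\<close>: positivity and decay to 0\<close>

definition J :: "real \<Rightarrow> real" where
  "J r = r ^ n * (\<epsilon> * r * w r + F r)"

text \<open>The source term of \<open>J\<close>. For positive arguments its sign changes at
  \<open>x^(q-1) = \<epsilon> (n + 1 - \<alpha>)\<close>, which is the smallness threshold used
  below.\<close>

definition H :: "real \<Rightarrow> real" where
  "H x = \<epsilon> * (real n + 1 - \<alpha>) * x - spow q x"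

lemma J_deriv:
  assumes "0 < r"
  shows "(J has_real_derivative r ^ n * H (w r)) (at r)"
proof -
  have p: "((\<lambda>r. r ^ n) has_real_derivative real n / r * r ^ n) (at r)"
    using assms by (auto intro!: derivative_eq_intros) (cases n; simp)
  show ?thesis unfolding J_def H_def
    by (rule derivative_eq_intros p w_deriv_c F_deriv_c assms refl)+
      (use assms in \<open>simp add: algebra_simps\<close>)
qed

lemma continuous_on_J: "0 \<le> x \<Longrightarrow> continuous_on {x..y} J"
  unfolding J_def by (intro continuous_intros continuous_on_w continuous_on_F)

lemma J_0: "J 0 = 0" by (simp add: J_def F_0)

lemma F_eq_J: "0 < r \<Longrightarrow> F r = J r / r ^ n - \<epsilon> * r * w r"
  by (simp add: J_def field_simps)

lemma H_nonneg:
  assumes "0 \<le> x" "x powr (q - 1) \<le> \<epsilon> * (real n + 1 - \<alpha>)" shows "0 \<le> H x"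
proof -
  have "H x = x * (\<epsilon> * (real n + 1 - \<alpha>) - x powr (q - 1))"
    using assms(1) by (simp add: H_def spow_def algebra_simps)
  then show ?thesis using assms by simp
qed

lemma H_pos:
  assumes "0 < x" "x powr (q - 1) < \<epsilon> * (real n + 1 - \<alpha>)" shows "0 < H x"
proof -
  have "H x = x * (\<epsilon> * (real n + 1 - \<alpha>) - x powr (q - 1))"
    using assms(1) by (simp add: H_def spow_def algebra_simps)
  then show ?thesis using assms by simp
qed

text \<open>At a first zero \<open>R\<close> the term with \<open>w\<close> drops out, so
  \<open>J R = R^n F R \<le> 0\<close> by \<open>F_nonpos\<close>. But \<open>J\<close> cannot have
  decreased from \<open>J r1 > 0\<close>, because \<open>w\<close> is nonincreasing and stays under
  the threshold of \<open>H\<close>.\<close>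

lemma positive_forever:
  assumes "0 < r1" and pos: "\<And>r. 0 \<le> r \<Longrightarrow> r \<le> r1 \<Longrightarrow> 0 < w r" and "0 < J r1"
    and small: "w r1 powr (q - 1) < \<epsilon> * (real n + 1 - \<alpha>)" and "0 \<le> s"
  shows "0 < w s"
proof (rule ccontr)
  assume neg: "\<not> 0 < w s"
  then have "r1 \<le> s" using pos[of s] assms(5) by force
  have "0 < w r1" using pos assms(1) by simp
  obtain R where R: "r1 < R" "R \<le> s" "w R = 0" "\<And>t. r1 \<le> t \<Longrightarrow> t < R \<Longrightarrow> 0 < w t"
    using first_zero[OF \<open>r1 \<le> s\<close> continuous_on_w \<open>0 < w r1\<close>] neg assms(1) by (metis less_imp_le not_less)
  have pos2: "0 < w t" if "0 \<le> t" "t < R" for t using that pos R(4) by (cases "t \<le> r1") auto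
  have "J r1 \<le> J R"
  proof (rule le_of_deriv_nonneg[where f = J and f' = "\<lambda>r. r ^ n * H (w r)"])
    fix x assume x: "r1 < x" "x < R"
    show "(J has_real_derivative x ^ n * H (w x)) (at x)" using x assms(1) by (intro J_deriv) auto
    have "w x \<le> w r1" by (rule w_antimono) (use x assms(1) pos2 in \<open>auto intro: less_imp_le\<close>)
    then have "w x powr (q - 1) \<le> w r1 powr (q - 1)"
      using pos2[of x] x assms(1) q_gt by (intro powr_mono2) auto
    then have "0 \<le> H (w x)" using pos2[of x] x assms(1) small by (intro H_nonneg) auto
    then show "0 \<le> x ^ n * H (w x)" using x assms(1) by simp
  qed (use R(1) assms(1) in \<open>auto intro: continuous_on_J\<close>)
  then have "0 < J R" using assms(3) by simp
  moreover have "F R \<le> 0"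
  proof (rule F_nonpos)
    show "0 \<le> w t" if "0 < t" "t \<le> R" for t
      using that pos2[of t] R(3) by (cases "t = R") auto
  qed (use R(1) assms(1) in auto)
  ultimately show False using R(1,3) assms(1) by (simp add: J_def zero_less_mult_iff)
qed

text \<open>Let \<open>l\<close> be the limit of the decreasing \<open>w\<close>. If
  \<open>l > 0\<close>, subtracting \<open>\<epsilon> l r^(n+1)\<close> from \<open>J\<close> leaves
  a function whose derivative is at most \<open>- \<kappa> r^n\<close> at large radii. It dominates
  \<open>r^n F\<close>, so \<open>F\<close> falls at least linearly to minus infinity and
  \<open>w\<close> would turn negative.\<close>

lemma tendsto_0:
  assumes nonneg: "\<And>r. 0 \<le> r \<Longrightarrow> 0 \<le> w r"
  shows "(w \<longlongrightarrow> 0) at_top"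
proof -
  obtain l where l: "0 \<le> l" "(w \<longlongrightarrow> l) at_top" "\<And>x. 0 \<le> x \<Longrightarrow> l \<le> w x"
    using antimono_limit[of 0 w 0] w_antimono nonneg by (metis less_imp_le)
  have "l = 0"
  proof (rule ccontr)
    assume "l \<noteq> 0"
    then have lpos: "0 < l" using l(1) by simp
    \<comment> \<open>At \<open>w = l\<close> the linear part of
      \<open>H w - \<epsilon> (n + 1) l\<close> is \<open>- \<epsilon> \<alpha> l\<close>; half of
      it survives the error made by \<open>w\<close> being only close to \<open>l\<close>.\<close>
    define \<kappa> where "\<kappa> = \<epsilon> * \<alpha> * l / 2"
    have \<kappa>: "0 < \<kappa>" using lpos eps_pos alpha_pos by (simp add: \<kappa>_def)
    have "((\<lambda>r. \<epsilon> * (real n + 1 - \<alpha>) * w r - \<epsilon> * (real n + 1) * l) \<longlongrightarrow>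
        \<epsilon> * (real n + 1 - \<alpha>) * l - \<epsilon> * (real n + 1) * l) at_top"
      by (intro tendsto_intros l(2))
    moreover have "\<epsilon> * (real n + 1 - \<alpha>) * l - \<epsilon> * (real n + 1) * l < - \<kappa>"
      using \<kappa> by (simp add: \<kappa>_def algebra_simps)
    ultimately have "\<forall>\<^sub>F r in at_top. \<epsilon> * (real n + 1 - \<alpha>) * w r - \<epsilon> * (real n + 1) * l < - \<kappa>"
      by (rule order_tendstoD)
    then obtain T0 where T0: "\<And>r. T0 \<le> r \<Longrightarrow> \<epsilon> * (real n + 1 - \<alpha>) * w r - \<epsilon> * (real n + 1) * l < - \<kappa>"
      by (auto simp: eventually_at_top_linorder)
    define T where "T = max T0 1"
    define Z where "Z r = J r - \<epsilon> * l * r ^ (n + 1)" for r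
    define C where "C = \<bar>Z T\<bar> + \<kappa> / (n + 1) * T ^ (n + 1)"
    have Fle: "F r \<le> C - \<kappa> / (n + 1) * r" if r: "T \<le> r" for r
    proof -
      have r1: "1 \<le> r" using r by (simp add: T_def)
      have "Z r - Z T \<le> (\<lambda>r. - (\<kappa> / (n + 1) * r ^ (n + 1))) r - (\<lambda>r. - (\<kappa> / (n + 1) * r ^ (n + 1))) T"
      proof (rule diff_le_of_deriv_le[where f = Z and g = "\<lambda>r. - (\<kappa> / (n + 1) * r ^ (n + 1))"
            and f' = "\<lambda>r. r ^ n * H (w r) - \<epsilon> * l * ((n + 1) * r ^ n)"
            and g' = "\<lambda>r. - (\<kappa> / (n + 1) * ((n + 1) * r ^ n))"])
        show "continuous_on {T..r} Z"
          unfolding Z_def by (intro continuous_intros continuous_on_J) (simp add: T_def)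
        fix x assume x: "T < x"
        then have x0: "0 < x" "T0 \<le> x" by (auto simp: T_def)
        show "(Z has_real_derivative x ^ n * H (w x) - \<epsilon> * l * ((n + 1) * x ^ n)) (at x)"
          unfolding Z_def using x0 by (auto intro!: derivative_eq_intros J_deriv simp del: power_Suc)
        show "((\<lambda>r. - (\<kappa> / (n + 1) * r ^ (n + 1))) has_real_derivative - (\<kappa> / (n + 1) * ((n + 1) * x ^ n))) (at x)"
          by (rule derivative_eq_intros refl)+ simp
        have kn: "\<kappa> / (n + 1) * ((n + 1) * x ^ n) = \<kappa> * x ^ n" by simp
        have "H (w x) - \<epsilon> * l * (n + 1) \<le> - \<kappa>"
          using T0[OF x0(2)] nonneg[of x] x0 spow_nonneg_iff[of q "w x"] by (simp add: H_def algebra_simps del: spow_nonneg_iff)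
        then have "x ^ n * (H (w x) - \<epsilon> * l * (n + 1)) \<le> x ^ n * (- \<kappa>)"
          using x0 by (intro mult_left_mono) auto
        then show "x ^ n * H (w x) - \<epsilon> * l * ((n + 1) * x ^ n) \<le> - (\<kappa> / (n + 1) * ((n + 1) * x ^ n))"
          by (simp only: kn) (simp add: algebra_simps)
      qed (use r in \<open>auto intro!: continuous_intros\<close>)
      then have "Z r \<le> C - \<kappa> / (n + 1) * r ^ (n + 1)" by (simp add: C_def)
      moreover have "r ^ n * F r \<le> Z r"
      proof -
        have "0 \<le> \<epsilon> * r ^ (n + 1) * (w r - l)" using eps_pos r1 l(3)[of r] by simp
        then show ?thesis by (simp add: Z_def J_def algebra_simps)
      qed
      ultimately have "r ^ n * F r \<le> C - \<kappa> / (n + 1) * r ^ (n + 1)" by simp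
      also have "\<dots> \<le> r ^ n * C - \<kappa> / (n + 1) * r ^ (n + 1)"
      proof -
        have "1 * C \<le> r ^ n * C" using r1 \<kappa>
          by (intro mult_right_mono) (auto simp: C_def T_def)
        then show ?thesis by simp
      qed
      also have "\<dots> = r ^ n * (C - \<kappa> / (n + 1) * r)" by (simp add: algebra_simps)
      finally show ?thesis using r1 by (simp add: mult_le_cancel_left)
    qed
    define T1 where "T1 = max T ((C + 1) * (n + 1) / \<kappa>)"
    have F1: "F r \<le> - 1" if "T1 \<le> r" for r
    proof -
      have "(C + 1) * (n + 1) / \<kappa> \<le> r" using that by (simp add: T1_def)
      then have "C + 1 \<le> \<kappa> / (n + 1) * r" using \<kappa> by (simp add: field_simps)
      then show ?thesis using Fle[of r] that by (simp add: T1_def)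
    qed
    have T10: "1 \<le> T1" by (simp add: T1_def T_def)
    show False
    proof (rule escape_unbounded[where Z = "\<lambda>r. - w r" and Z' = "\<lambda>r. - spow c (F r)" and ?t1.0 = T1
          and e = "- w T1" and c = 1 and B = 1])
      fix r assume r: "T1 \<le> r"
      show "((\<lambda>r. - w r) has_real_derivative - spow c (F r)) (at r)"
        using w_deriv_c[of r] r T10 by (intro DERIV_minus) auto
      show "- w r < 1" using nonneg[of r] r T10 by simp
      have "1 powr c \<le> (- F r) powr c" using F1[OF r] c_pos by (intro powr_mono2) auto
      then show "1 \<le> - spow c (F r)" using F1[OF r] by (simp add: spow_neg_eq)
    qed auto
  qed
  then show ?thesis using l(2) by simp
qed

section \<open>Zeros of nonnegative solutions: strict positivity or extinction\<close>

lemma F_eq_0_at_zero: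
  assumes nonneg: "\<And>r. 0 \<le> r \<Longrightarrow> 0 \<le> w r" and R: "0 \<le> R" "w R = 0"
  shows "0 < R" "F R = 0"
proof -
  show R0: "0 < R" using R w_0 a_pos by (cases "R = 0") auto
  have "spow c (F R) = 0"
    by (rule DERIV_local_min[OF w_deriv_c[OF R0] R0]) (use nonneg R in auto)
  then show "F R = 0" using spow_pos_iff[of c "F R"] spow_neg_iff[of c "F R"] by linarith
qed

text \<open>Backward uniqueness at a first zero \<open>R\<close>, where also \<open>F R = 0\<close>
  and hence \<open>J R = 0\<close>. Since \<open>w\<close> decreases, integrating \<open>J'\<close>
  from \<open>r\<close> to \<open>R\<close> bounds \<open>- F r\<close> by a multiple of
  \<open>w r\<close>, and for \<open>c > 1\<close> this gives \<open>- w' \<le> D w\<close>. Then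
  \<open>exp (D r) w\<close> is nondecreasing and cannot reach 0.\<close>

lemma no_zero_if_m_less_1:
  assumes "m < 1" and nonneg: "\<And>r. 0 \<le> r \<Longrightarrow> 0 \<le> w r" and "0 \<le> s"
  shows "0 < w s"
proof (rule ccontr)
  assume "\<not> 0 < w s"
  then obtain R where R: "0 < R" "w R = 0" "\<And>t. 0 \<le> t \<Longrightarrow> t < R \<Longrightarrow> 0 < w t"
    using first_zero[OF \<open>0 \<le> s\<close> continuous_on_w] w_0 a_pos by (metis linorder_not_le order_refl)
  have FR: "F R = 0" using F_eq_0_at_zero[OF nonneg] R by simp
  have wa: "w t \<le> w r" if "0 \<le> r" "r \<le> t" for r t using w_antimono[OF that] nonneg by (simp add: less_imp_le)
  define K where "K = \<epsilon> * (real n + 1 - \<alpha>) + a powr (q - 1)"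
  have K: "0 \<le> K" using eps_pos alpha_less by (simp add: K_def)
  have c1: "1 < c" using assms(1) m_pos by (simp add: c_def)
  \<comment> \<open>Restricting to \<open>R / 2 \<le> r\<close> gives
    \<open>R^n \<le> 2^n r^n\<close>, the origin of the factor \<open>2 ^ n\<close>.\<close>
  define C where "C = \<epsilon> * R + 2 ^ n * R * K"
  have C: "0 \<le> C" using R K eps_pos by (simp add: C_def)
  have Fle: "- F r \<le> C * w r" if r: "R / 2 \<le> r" "r < R" for r
  proof -
    have r0: "0 < r" using r R by simp
    have "J R - J r \<le> (\<lambda>x. R ^ n * K * w r * x) R - (\<lambda>x. R ^ n * K * w r * x) r"
    proof (rule diff_le_of_deriv_le[where f = J and g = "\<lambda>x. R ^ n * K * w r * x"
          and f' = "\<lambda>x. x ^ n * H (w x)" and g' = "\<lambda>_. R ^ n * K * w r"])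
      fix x assume x: "r < x" "x < R"
      then show "(J has_real_derivative x ^ n * H (w x)) (at x)" using r0 by (intro J_deriv) simp
      have "0 < w x" using R(3) x r0 by simp
      moreover have "w x \<le> w r" using wa x r0 by simp
      ultimately have "H (w x) \<le> K * w r"
      proof -
        have "H (w x) \<le> \<epsilon> * (real n + 1 - \<alpha>) * w x"
          using \<open>0 < w x\<close> spow_nonneg_iff[of q "w x"] by (simp add: H_def)
        also have "\<dots> \<le> K * w x" using \<open>0 < w x\<close> by (intro mult_right_mono) (auto simp: K_def)
        also have "\<dots> \<le> K * w r" using \<open>w x \<le> w r\<close> K by (intro mult_left_mono) auto
        finally show ?thesis .
      qed
      then have "x ^ n * H (w x) \<le> x ^ n * (K * w r)" using x r0 by (intro mult_left_mono) auto
      also have "\<dots> \<le> R ^ n * (K * w r)" using x r0 K nonneg[of r]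
        by (intro mult_right_mono power_mono) auto
      finally show "x ^ n * H (w x) \<le> R ^ n * K * w r" by simp
    qed (use r r0 in \<open>auto intro!: continuous_intros continuous_on_J derivative_eq_intros\<close>)
    then have "- J r \<le> R ^ n * K * w r * (R - r)"
      by (simp add: J_def FR R(2) algebra_simps)
    also have "\<dots> \<le> R ^ n * K * w r * R" using r0 K nonneg[of r] R
      by (intro mult_left_mono) auto
    also have "\<dots> \<le> (2 * r) ^ n * K * w r * R" using r r0 K nonneg[of r] R
      by (intro mult_right_mono power_mono) auto
    finally have "- J r / r ^ n \<le> 2 ^ n * K * w r * R"
      using r0 by (simp add: field_simps power_mult_distrib)
    moreover have "- F r = \<epsilon> * r * w r - J r / r ^ n" using F_eq_J[OF r0] by simp
    moreover have "\<epsilon> * r * w r \<le> \<epsilon> * R * w r"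
      using r r0 eps_pos nonneg[of r] by (intro mult_right_mono mult_left_mono) auto
    ultimately show ?thesis by (simp add: C_def algebra_simps)
  qed
  \<comment> \<open>From \<open>(C w)^c \<le> C^c a^(c-1) w\<close>, valid because
    \<open>c > 1\<close> and \<open>w \<le> a\<close>.\<close>
  define D where "D = C powr c * a powr (c - 1)"
  have dle: "- (D * w r) \<le> spow c (F r)" if r: "R / 2 \<le> r" "r < R" for r
  proof -
    have r0: "0 < r" using r R by simp
    have "F r \<le> 0" using F_nonpos nonneg r0 by simp
    then have "- spow c (F r) = (- F r) powr c" by (simp add: spow_neg_eq)
    also have "\<dots> \<le> (C * w r) powr c" using Fle[OF r] \<open>F r \<le> 0\<close> c1 by (intro powr_mono2) auto
    also have "\<dots> = C powr c * (w r powr (c - 1) * w r)"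
      using C R(3)[of r] r r0 by (simp add: powr_mult powr_diff)
    also have "\<dots> \<le> C powr c * (a powr (c - 1) * w r)"
      using wa[of 0 r] r0 nonneg[of r] w_0 c1 by (intro mult_left_mono mult_right_mono powr_mono2) auto
    finally show ?thesis by (simp add: D_def)
  qed
  have "(\<lambda>r. exp (D * r) * w r) (R / 2) \<le> (\<lambda>r. exp (D * r) * w r) R"
  proof (rule le_of_deriv_nonneg[where f = "\<lambda>r. exp (D * r) * w r" and f' = "\<lambda>r. exp (D * r) * (D * w r + spow c (F r))"])
    fix x assume x: "R / 2 < x" "x < R"
    then have x0: "0 < x" using R by simp
    show "((\<lambda>r. exp (D * r) * w r) has_real_derivative exp (D * x) * (D * w x + spow c (F x))) (at x)"
      by (rule derivative_eq_intros w_deriv_c x0 refl)+ (simp add: algebra_simps)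
    show "0 \<le> exp (D * x) * (D * w x + spow c (F x))" using dle[of x] x by simp
  qed (use R in \<open>auto intro!: continuous_intros continuous_on_w\<close>)
  then have "exp (D * (R / 2)) * w (R / 2) \<le> 0" by (simp add: R(2))
  then show False using R(3)[of "R / 2"] R(1) by (simp add: mult_le_0_iff)
qed

lemma w_powr_tendsto_0:
  assumes "\<And>r. 0 \<le> r \<Longrightarrow> 0 < w r" shows "((\<lambda>r. w r powr (q - 1)) \<longlongrightarrow> 0) at_top"
proof -
  have "((\<lambda>r. w r powr (q - 1)) \<longlongrightarrow> 0 powr (q - 1)) at_top"
    using q_gt assms by (intro tendsto_powr' tendsto_const tendsto_0)
      (auto intro!: eventually_at_top_linorderI[of 0] less_imp_le)
  then show ?thesis by simp
qed

text \<open>Once \<open>w\<close> is below the threshold, \<open>J\<close> increases strictly, so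
  \<open>J \<le> 0\<close> improves to \<open>J r < J (r + 1) \<le> 0\<close>.\<close>

lemma J_neg_eventually:
  assumes pos: "\<And>r. 0 \<le> r \<Longrightarrow> 0 < w r"
    and J: "\<And>r. 0 < r \<Longrightarrow> w r powr (q - 1) < \<epsilon> * (real n + 1 - \<alpha>) \<Longrightarrow> J r \<le> 0"
  obtains T where "1 \<le> T" "\<And>r. T \<le> r \<Longrightarrow> J r < 0" "\<And>r. T \<le> r \<Longrightarrow> w r powr (q - 1) < \<epsilon> * (real n + 1 - \<alpha>)"
proof -
  have "\<forall>\<^sub>F r in at_top. w r powr (q - 1) < \<epsilon> * (real n + 1 - \<alpha>)"
    by (rule order_tendstoD[OF w_powr_tendsto_0[OF pos]]) (use eps_pos alpha_less in auto)
  then obtain T0 where T0: "\<And>r. T0 \<le> r \<Longrightarrow> w r powr (q - 1) < \<epsilon> * (real n + 1 - \<alpha>)"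
    by (auto simp: eventually_at_top_linorder)
  have "J r < 0" if r: "max T0 1 \<le> r" for r
  proof -
    have "J r < J (r + 1)"
    proof (rule DERIV_pos_imp_increasing_open[where f = J])
      fix x assume "r < x"
      then have x: "0 < x" "T0 \<le> x" using r by auto
      have "0 < H (w x)" using H_pos pos x T0 by simp
      then show "\<exists>y. (J has_real_derivative y) (at x) \<and> 0 < y"
        using J_deriv[OF x(1)] x(1) by (intro exI[of _ "x ^ n * H (w x)"]) simp
    qed (use r in \<open>auto intro: continuous_on_J\<close>)
    also have "J (r + 1) \<le> 0" using r T0 by (intro J) auto
    finally show ?thesis .
  qed
  then show ?thesis using T0 by (intro that[of "max T0 1"]) auto
qed

text \<open>If \<open>w\<close> never vanished, \<open>J < 0\<close> would give
  \<open>- F \<ge> \<epsilon> r w \<ge> w\<close> for large \<open>r \<ge> 1 / \<epsilon>\<close>,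
  that is \<open>- w' \<ge> w^c\<close>. For \<open>c < 1\<close> this makes \<open>w^(1-c)\<close>
  decrease at a rate of at least \<open>1 - c\<close>, so it is exhausted at a finite radius. After
  a zero, \<open>zero_after\<close> applies.\<close>

lemma compact_support_if_m_greater_1:
  assumes "1 < m" and nonneg: "\<And>r. 0 \<le> r \<Longrightarrow> 0 \<le> w r"
    and J: "\<And>r. 0 < r \<Longrightarrow> (\<And>s. 0 \<le> s \<Longrightarrow> s \<le> r \<Longrightarrow> 0 < w s) \<Longrightarrow>
        w r powr (q - 1) < \<epsilon> * (real n + 1 - \<alpha>) \<Longrightarrow> J r \<le> 0"
  obtains R where "0 \<le> R" "\<And>r. R \<le> r \<Longrightarrow> w r = 0"
proof (cases "\<exists>R\<ge>0. w R = 0")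
  case True
  then obtain R where R: "0 \<le> R" "w R = 0" by auto
  then have "F R = 0" using F_eq_0_at_zero[OF nonneg] by simp
  then show ?thesis using zero_after R that by blast
next
  case False
  then have pos: "0 < w r" if "0 \<le> r" for r using nonneg[OF that] that by (metis less_eq_real_def)
  have c1: "c < 1" using assms(1) by (simp add: c_def)
  obtain T where T: "1 \<le> T" "\<And>r. T \<le> r \<Longrightarrow> J r < 0" using J_neg_eventually pos J by metis
  define T1 where "T1 = max T (1 / \<epsilon>)"
  have False
  proof (rule escape_unbounded[where Z = "\<lambda>r. - (w r powr (1 - c))" and ?t1.0 = T1
      and Z' = "\<lambda>r. - ((1 - c) * w r powr (- c) * spow c (F r))"
      and e = "- (w T1 powr (1 - c))" and c = "1 - c" and B = 1])
    fix r assume "T1 \<le> r"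
    then have r: "0 < r" "T \<le> r" "1 / \<epsilon> \<le> r" using T(1) by (auto simp: T1_def)
    have wr: "0 < w r" using pos r by simp
    show "((\<lambda>r. - (w r powr (1 - c))) has_real_derivative - ((1 - c) * w r powr (- c) * spow c (F r))) (at r)"
      using DERIV_fun_powr[OF w_deriv_c[OF r(1)] wr, of "1 - c"] by (intro DERIV_minus) simp
    show "- (w r powr (1 - c)) < 1" using powr_ge_zero[of "w r" "1 - c"] by linarith
    have "r ^ n * (\<epsilon> * r * w r + F r) < 0" using T(2)[OF r(2)] by (simp add: J_def)
    then have "\<epsilon> * r * w r \<le> - F r" using r(1) by (simp add: mult_less_0_iff)
    moreover have "1 * w r \<le> \<epsilon> * r * w r"
      using r eps_pos wr by (intro mult_right_mono) (auto simp: field_simps)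
    ultimately have wF: "w r \<le> - F r" by simp
    then have "w r powr c \<le> (- F r) powr c" using wr c_pos by (intro powr_mono2) auto
    then have "w r powr c \<le> - spow c (F r)" using wF wr by (simp add: spow_neg_eq)
    then have "w r powr (- c) * w r powr c \<le> w r powr (- c) * - spow c (F r)"
      by (intro mult_left_mono) auto
    then have "1 \<le> w r powr (- c) * - spow c (F r)" using wr by (simp add: powr_minus)
    then have "(1 - c) * 1 \<le> (1 - c) * (w r powr (- c) * - spow c (F r))"
      using c1 by (intro mult_left_mono) auto
    then show "1 - c \<le> - ((1 - c) * w r powr (- c) * spow c (F r))" by (simp add: mult.assoc)
  qed (use c1 in auto)
  then show ?thesis ..
qed

end

section \<open>Continuous dependence on the initial value\<close>

context radial_sol
begin

section \<open>A priori bounds and the behaviour near 0\<close>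

lemma w_abs_le:
  assumes "0 \<le> r" "0 \<le> W" "energy 0 \<le> \<epsilon> * \<alpha> / 2 * W\<^sup>2"
  shows "\<bar>w r\<bar> \<le> W"
proof -
  have "\<epsilon> * \<alpha> / 2 * (w r)\<^sup>2 \<le> energy r"
    using energy_nonneg_parts[of r] unfolding energy_def by linarith
  also have "\<dots> \<le> \<epsilon> * \<alpha> / 2 * W\<^sup>2"
    using energy_antimono[of 0 r] assms by simp
  finally have "(w r)\<^sup>2 \<le> W\<^sup>2" using eps_pos alpha_pos by simp
  then show ?thesis using assms(2) by (simp add: abs_le_square_iff[symmetric])
qed

lemma F_abs_le:
  assumes "0 \<le> r" "0 \<le> \<Phi>" "energy 0 \<le> 1 / (c + 1) * \<Phi> powr (c + 1)"
  shows "\<bar>F r\<bar> \<le> \<Phi>"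
proof -
  have "1 / (c + 1) * \<bar>F r\<bar> powr (c + 1) \<le> energy r"
    using energy_nonneg_parts[of r] unfolding energy_def by linarith
  also have "\<dots> \<le> 1 / (c + 1) * \<Phi> powr (c + 1)"
    using energy_antimono[of 0 r] assms by simp
  finally have "\<bar>F r\<bar> powr (c + 1) \<le> \<Phi> powr (c + 1)"
    using c_pos by (simp add: divide_le_cancel)
  then show ?thesis using assms(2) c_pos
    by (metis abs_ge_zero add_pos_pos linorder_not_le powr_less_mono2 zero_less_one)
qed

lemma w_ge_near_0:
  assumes V: "\<And>s. 0 \<le> s \<Longrightarrow> \<bar>spow c (F s)\<bar> \<le> V" and "0 \<le> r"
  shows "a - V * r \<le> w r"
proof -
  have "(- V) * r - (- V) * 0 \<le> w r - w 0"
  proof (rule diff_le_of_deriv_le[where f = "\<lambda>r. (- V) * r" and f' = "\<lambda>_. - V" and g = w])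
    fix x :: real assume "0 < x"
    then show "(w has_real_derivative spow c (F x)) (at x)" by (rule w_deriv_c)
    show "- V \<le> spow c (F x)" using V[of x] \<open>0 < x\<close> by (simp add: abs_le_iff)
  qed (use assms(2) in \<open>auto intro!: continuous_intros continuous_on_w derivative_eq_intros\<close>)
  then show ?thesis by (simp add: w_0)
qed

text \<open>To leading order \<open>- F\<close> is
  \<open>(\<epsilon> \<alpha> a + a^q) r / (n + 1)\<close>. The bound on \<open>V * r\<close> keeps
  \<open>w\<close> within \<open>\<alpha> a / (2 (n + 1))\<close> of \<open>a\<close>. In
  \<open>F = J / r^n - \<epsilon> r w\<close> this costs half of the part
  \<open>\<epsilon> \<alpha> a r / (n + 1)\<close>; the other half is the lower bound.\<close>

lemma F_near_0:
  assumes V: "\<And>s. 0 \<le> s \<Longrightarrow> \<bar>spow c (F s)\<bar> \<le> V" and r: "0 < r" "V * r \<le> \<alpha> * a / (2 * (real n + 1))"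
  shows "\<epsilon> * \<alpha> * a / (2 * (real n + 1)) * r \<le> - F r" "- F r \<le> (\<epsilon> * a + a powr q) * r"
proof -
  have "0 \<le> V" using V[of 0] by simp
  have "\<alpha> * a / (2 * (real n + 1)) < a"
  proof -
    have "\<alpha> * a < (real n + 1) * a" "0 < (real n + 1) * a"
      using a_pos alpha_less by auto
    then have "\<alpha> * a < 2 * ((real n + 1) * a)" by linarith
    then show ?thesis by (simp add: pos_divide_less_eq mult_ac)
  qed
  have wpos: "0 < w s" if "0 \<le> s" "s \<le> r" for s
  proof -
    have "V * s \<le> V * r" using that \<open>0 \<le> V\<close> by (intro mult_left_mono) auto
    then show ?thesis using w_ge_near_0[OF V that(1)] r \<open>\<alpha> * a / (2 * (real n + 1)) < a\<close> by simp
  qed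
  have wle: "w s \<le> a" if "0 \<le> s" "s \<le> r" for s
    using w_antimono[of 0 s] that wpos w_0 by (simp add: less_imp_le)
  have H: "- (a powr q) \<le> H (w s)" "H (w s) \<le> \<epsilon> * (real n + 1 - \<alpha>) * a" if s: "0 \<le> s" "s \<le> r" for s
  proof -
    have "0 \<le> \<epsilon> * (real n + 1 - \<alpha>) * w s" using wpos[OF s] eps_pos alpha_less by simp
    moreover have "spow q (w s) \<le> a powr q"
      using wpos[OF s] wle[OF s] q_gt by (simp add: spow_nonneg_eq powr_mono2)
    ultimately show "- (a powr q) \<le> H (w s)" by (simp add: H_def)
    have "\<epsilon> * (real n + 1 - \<alpha>) * w s \<le> \<epsilon> * (real n + 1 - \<alpha>) * a"
      using wle[OF s] eps_pos alpha_less by (intro mult_left_mono) auto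
    moreover have "0 < spow q (w s)" using wpos[OF s] by simp
    ultimately show "H (w s) \<le> \<epsilon> * (real n + 1 - \<alpha>) * a" unfolding H_def by linarith
  qed
  have Hn: "s ^ n * - (a powr q) \<le> s ^ n * H (w s)" "s ^ n * H (w s) \<le> s ^ n * (\<epsilon> * (real n + 1 - \<alpha>) * a)"
    if "0 < s" "s < r" for s
    using mult_left_mono[OF H(1)[of s], of "s ^ n"] mult_left_mono[OF H(2)[of s], of "s ^ n"] that by auto
  have D: "((\<lambda>s. K / (real n + 1) * s ^ (n + 1)) has_real_derivative s ^ n * K) (at s)" for K s
    by (rule derivative_eq_intros refl)+ (simp add: field_simps)
  have "J r - J 0 \<le> \<epsilon> * (real n + 1 - \<alpha>) * a / (real n + 1) * r ^ (n + 1)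
      - \<epsilon> * (real n + 1 - \<alpha>) * a / (real n + 1) * 0 ^ (n + 1)"
    by (rule diff_le_of_deriv_le[where f = J and g = "\<lambda>s. \<epsilon> * (real n + 1 - \<alpha>) * a / (real n + 1) * s ^ (n + 1)",
          OF _ _ _ J_deriv D Hn(2)])
      (use r in \<open>auto intro!: continuous_on_J continuous_intros\<close>)
  then have "J r \<le> \<epsilon> * (real n + 1 - \<alpha>) * a / (real n + 1) * r * r ^ n" by (simp add: J_0)
  then have "J r / r ^ n \<le> \<epsilon> * (real n + 1 - \<alpha>) * a / (real n + 1) * r"
    using r(1) by (simp add: pos_divide_le_eq)
  define X where "X = \<epsilon> * r * (\<alpha> * a / (real n + 1))"
  note \<open>J r / r ^ n \<le> \<epsilon> * (real n + 1 - \<alpha>) * a / (real n + 1) * r\<close>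
  also have "\<epsilon> * (real n + 1 - \<alpha>) * a / (real n + 1) * r = \<epsilon> * r * a - X"
    by (simp add: X_def field_simps)
  finally have 1: "J r / r ^ n \<le> \<epsilon> * r * a - X" .
  have "\<epsilon> * r * a - X / 2 = \<epsilon> * r * (a - \<alpha> * a / (2 * (real n + 1)))"
    by (simp add: X_def field_simps)
  also have "\<dots> \<le> \<epsilon> * r * w r"
    using w_ge_near_0[OF V, of r] r eps_pos by (intro mult_left_mono) auto
  finally have "X / 2 \<le> - F r"
    using 1 F_eq_J[OF r(1)] by linarith
  then show "\<epsilon> * \<alpha> * a / (2 * (real n + 1)) * r \<le> - F r"
    by (simp add: X_def field_simps)
  have "- (a powr q) / (real n + 1) * r ^ (n + 1) - - (a powr q) / (real n + 1) * 0 ^ (n + 1) \<le> J r - J 0"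
    by (rule diff_le_of_deriv_le[where g = J and f = "\<lambda>s. - (a powr q) / (real n + 1) * s ^ (n + 1)",
          OF _ _ _ D J_deriv Hn(1)])
      (use r in \<open>auto intro!: continuous_on_J continuous_intros\<close>)
  then have "- (a powr q) / (real n + 1) * r * r ^ n \<le> J r" by (simp add: J_0)
  then have "- (a powr q) / (real n + 1) * r \<le> J r / r ^ n"
    using r(1) by (simp add: pos_le_divide_eq)
  moreover have "a powr q / (real n + 1) * r \<le> a powr q / 1 * r"
    using r(1) by (intro mult_right_mono divide_left_mono) auto
  moreover have "\<epsilon> * r * w r \<le> \<epsilon> * r * a" using wle[of r] r eps_pos by (intro mult_left_mono) auto
  ultimately show "- F r \<le> (\<epsilon> * a + a powr q) * r"
    using F_eq_J[OF r(1)] by (simp add: algebra_simps)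
qed

lemma H_Lipschitz:
  assumes "\<bar>x\<bar> \<le> W" "\<bar>y\<bar> \<le> W"
  shows "\<bar>H x - H y\<bar> \<le> (\<epsilon> * (real n + 1) + q * W powr (q - 1)) * \<bar>x - y\<bar>"
proof -
  have "norm (H x - H y) \<le> (\<epsilon> * (real n + 1) + q * W powr (q - 1)) * norm (x - y)"
  proof (rule field_differentiable_bound[where S = "{- W..W}" and f' = "\<lambda>x. \<epsilon> * (real n + 1 - \<alpha>) - q * \<bar>x\<bar> powr (q - 1)"])
    fix z assume z: "z \<in> {- W..W}"
    show "(H has_real_derivative \<epsilon> * (real n + 1 - \<alpha>) - q * \<bar>z\<bar> powr (q - 1)) (at z within {- W..W})"
      unfolding H_def
      by (rule has_field_derivative_at_within[OF DERIV_diff[OF DERIV_cmult_Id DERIV_spow[OF q_gt]]])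
    have "\<bar>z\<bar> powr (q - 1) \<le> W powr (q - 1)" using z q_gt by (intro powr_mono2) auto
    then have "q * \<bar>z\<bar> powr (q - 1) \<le> q * W powr (q - 1)" using q_gt by simp
    moreover have "0 \<le> \<epsilon> * (real n + 1 - \<alpha>)" "\<epsilon> * (real n + 1 - \<alpha>) \<le> \<epsilon> * (real n + 1)"
      "0 \<le> q * \<bar>z\<bar> powr (q - 1)"
      using eps_pos alpha_pos alpha_less q_gt by auto
    ultimately show "norm (\<epsilon> * (real n + 1 - \<alpha>) - q * \<bar>z\<bar> powr (q - 1)) \<le> \<epsilon> * (real n + 1) + q * W powr (q - 1)"
      by (simp add: abs_le_iff)
  qed (use assms in \<open>auto simp: abs_le_iff\<close>)
  then show ?thesis by simp
qed

end

text \<open>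
  Near \<open>0\<close> the flux \<open>- F\<close> is comparable to \<open>r\<close>. Hence \<open>F \<mapsto> w'\<close> is Lipschitz there, with a constant
  of order \<open>r\<^sup>c\<^sup>-\<^sup>1\<close>, although for \<open>c < 1\<close> it is not Lipschitz at \<open>F = 0\<close>.
\<close>

lemma powr_Lipschitz:
  fixes x y c :: real
  assumes "0 < A" "0 < r" "A * r \<le> x" "x \<le> B * r" "A * r \<le> y" "y \<le> B * r" "0 < c"
  shows "\<bar>x powr c - y powr c\<bar> \<le> c * (A powr (c - 1) + B powr (c - 1)) * r powr (c - 1) * \<bar>x - y\<bar>"
proof -
  have "norm (x powr c - y powr c) \<le> c * (A powr (c - 1) + B powr (c - 1)) * r powr (c - 1) * norm (x - y)"
  proof (rule field_differentiable_bound[where S = "{A * r..B * r}" and f' = "\<lambda>x. c * x powr (c - 1)"])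
    fix z assume z: "z \<in> {A * r..B * r}"
    have Ar: "0 < A * r" using assms by simp
    then have zpos: "0 < z" using z by auto
    show "((\<lambda>x. x powr c) has_real_derivative c * z powr (c - 1)) (at z within {A * r..B * r})"
      by (rule has_field_derivative_at_within, rule has_real_derivative_powr[OF zpos])
    have "A * r \<le> B * r" using z by auto
    then have "0 < B" using assms(1,2) by simp
    \<comment> \<open>\<open>z^(c-1)\<close> is largest at the right end for
      \<open>c \<ge> 1\<close> and at the left end for \<open>c < 1\<close>; the sum of both values
      avoids a case distinction in the statement.\<close>
    have "z powr (c - 1) \<le> (A powr (c - 1) + B powr (c - 1)) * r powr (c - 1)"
    proof (cases "1 \<le> c")
      case True
      then have "z powr (c - 1) \<le> (B * r) powr (c - 1)" using z zpos by (intro powr_mono2) auto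
      then show ?thesis using assms \<open>0 < B\<close> by (simp add: powr_mult algebra_simps add_increasing)
    next
      case False
      then have "z powr (c - 1) \<le> (A * r) powr (c - 1)" using z Ar by (intro powr_mono2') auto
      then show ?thesis using assms \<open>0 < B\<close> by (simp add: powr_mult algebra_simps add_increasing2)
    qed
    then show "norm (c * z powr (c - 1)) \<le> c * (A powr (c - 1) + B powr (c - 1)) * r powr (c - 1)"
      using assms(7) by (simp add: mult.assoc)
  qed (use assms in auto)
  then show ?thesis by simp
qed

section \<open>Difference of two solutions\<close>

locale two_sols = S1: radial_sol n m \<alpha> q \<epsilon> a w F + S2: radial_sol n m \<alpha> q \<epsilon> b v G
  for n m \<alpha> q \<epsilon> a w F b v G +
  fixes W L :: real
  assumes w_le: "\<And>r. 0 \<le> r \<Longrightarrow> \<bar>w r\<bar> \<le> W" and v_le: "\<And>r. 0 \<le> r \<Longrightarrow> \<bar>v r\<bar> \<le> W"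
    and L_def: "L = \<epsilon> * (real n + 1) + q * W powr (q - 1)"
begin

lemma L_pos: "0 < L"
  using S1.eps_pos S1.q_gt by (simp add: L_def add_pos_nonneg)

lemma H_diff: "0 \<le> r \<Longrightarrow> \<bar>S1.H (w r) - S1.H (v r)\<bar> \<le> L * \<bar>w r - v r\<bar>"
  unfolding L_def by (intro S1.H_Lipschitz w_le v_le)

lemma J_diff:
  assumes "0 < r" and M: "\<And>s. 0 < s \<Longrightarrow> s \<le> r \<Longrightarrow> \<bar>w s - v s\<bar> \<le> M"
  shows "\<bar>S1.J r - S2.J r\<bar> \<le> L * M * r ^ (n + 1)"
proof -
  have "0 \<le> M" using M[of r] assms(1) by simp
  have D: "((\<lambda>s. L * M / (real n + 1) * s ^ (n + 1)) has_real_derivative s ^ n * (L * M)) (at s)" for s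
    by (rule derivative_eq_intros refl)+ (simp add: field_simps)
  have D2: "((\<lambda>s. - (L * M / (real n + 1) * s ^ (n + 1))) has_real_derivative - (s ^ n * (L * M))) (at s)" for s
    by (rule DERIV_minus[OF D])
  have DJ: "((\<lambda>s. S1.J s - S2.J s) has_real_derivative s ^ n * S1.H (w s) - s ^ n * S2.H (v s)) (at s)" if "0 < s" for s
    by (intro DERIV_diff S1.J_deriv S2.J_deriv that)
  have bound: "s ^ n * S1.H (w s) - s ^ n * S2.H (v s) \<le> s ^ n * (L * M)"
    "- (s ^ n * (L * M)) \<le> s ^ n * S1.H (w s) - s ^ n * S2.H (v s)" if s: "0 < s" "s < r" for s
  proof -
    have "L * \<bar>w s - v s\<bar> \<le> L * M" using M[of s] s L_pos by (intro mult_left_mono) auto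
    then have "\<bar>S1.H (w s) - S1.H (v s)\<bar> \<le> L * M" using H_diff[of s] s by simp
    then have "\<bar>s ^ n * (S1.H (w s) - S2.H (v s))\<bar> \<le> s ^ n * (L * M)"
      using s by (simp add: abs_mult)
    then show "s ^ n * S1.H (w s) - s ^ n * S2.H (v s) \<le> s ^ n * (L * M)"
      "- (s ^ n * (L * M)) \<le> s ^ n * S1.H (w s) - s ^ n * S2.H (v s)"
      by (auto simp: abs_le_iff algebra_simps)
  qed
  have "(S1.J r - S2.J r) - (S1.J 0 - S2.J 0) \<le> L * M / (real n + 1) * r ^ (n + 1) - L * M / (real n + 1) * 0 ^ (n + 1)"
    by (rule diff_le_of_deriv_le[where f = "\<lambda>s. S1.J s - S2.J s" and g = "\<lambda>s. L * M / (real n + 1) * s ^ (n + 1)",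
          OF _ _ _ DJ D])
      (use assms(1) bound in \<open>auto intro!: continuous_intros S1.continuous_on_J S2.continuous_on_J\<close>)
  moreover have "- (L * M / (real n + 1) * r ^ (n + 1)) - - (L * M / (real n + 1) * 0 ^ (n + 1)) \<le> (S1.J r - S2.J r) - (S1.J 0 - S2.J 0)"
    by (rule diff_le_of_deriv_le[where g = "\<lambda>s. S1.J s - S2.J s" and f = "\<lambda>s. - (L * M / (real n + 1) * s ^ (n + 1))",
          OF _ _ _ D2 DJ])
      (use assms(1) bound in \<open>auto intro!: continuous_intros S1.continuous_on_J S2.continuous_on_J\<close>)
  ultimately have "\<bar>S1.J r - S2.J r\<bar> \<le> L * M / (real n + 1) * r ^ (n + 1)"
    by (simp add: S1.J_0 S2.J_0 abs_le_iff)
  also have "\<dots> \<le> L * M / 1 * r ^ (n + 1)"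
    using assms(1) L_pos \<open>0 \<le> M\<close> by (intro mult_right_mono divide_left_mono) auto
  finally show ?thesis by simp
qed

text \<open>As \<open>J'\<close> involves \<open>w\<close> alone, the fluxes are compared without a
  modulus of continuity for \<open>F \<mapsto> w'\<close>. The factor \<open>r\<close> compensates
  the Lipschitz constant \<open>r^(c-1)\<close> of that map near 0.\<close>

lemma F_diff:
  assumes "0 < r" and M: "\<And>s. 0 < s \<Longrightarrow> s \<le> r \<Longrightarrow> \<bar>w s - v s\<bar> \<le> M"
  shows "\<bar>F r - G r\<bar> \<le> (\<epsilon> + L) * r * M"
proof -
  have "F r - G r = (S1.J r - S2.J r) / r ^ n - \<epsilon> * r * (w r - v r)"
    using S1.F_eq_J[OF assms(1)] S2.F_eq_J[OF assms(1)] by (simp add: diff_divide_distrib algebra_simps)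
  then have "\<bar>F r - G r\<bar> \<le> \<bar>(S1.J r - S2.J r) / r ^ n\<bar> + \<bar>\<epsilon> * r * (w r - v r)\<bar>" by linarith
  also have "\<bar>(S1.J r - S2.J r) / r ^ n\<bar> \<le> L * M * r"
    using J_diff[OF assms] assms(1) by (simp add: abs_divide pos_divide_le_eq mult_ac)
  also have "\<bar>\<epsilon> * r * (w r - v r)\<bar> \<le> \<epsilon> * r * M"
    using M[of r] assms(1) S1.eps_pos by (simp add: abs_mult)
  finally show ?thesis by (simp add: algebra_simps)
qed

text \<open>A contraction estimate for the maximum \<open>M\<close> of \<open>|w - v|\<close> on
  \<open>[0, r0]\<close>: \<open>F_diff\<close> and \<open>powr_Lipschitz\<close> bound
  \<open>|w' - v'|\<close> by a multiple of \<open>M\<close>, and integrating over a length of at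
  most \<open>r0\<close> gives \<open>M \<le> |a - b| + M / 2\<close>.\<close>

lemma diff_near_0:
  assumes "0 < r0" "0 < A"
    and F: "\<And>r. 0 < r \<Longrightarrow> r \<le> r0 \<Longrightarrow> A * r \<le> - F r \<and> - F r \<le> B * r"
    and G: "\<And>r. 0 < r \<Longrightarrow> r \<le> r0 \<Longrightarrow> A * r \<le> - G r \<and> - G r \<le> B * r"
    and small: "S1.c * (A powr (S1.c - 1) + B powr (S1.c - 1)) * (\<epsilon> + L) * r0 powr S1.c * r0 \<le> 1 / 2"
    and r: "0 \<le> r" "r \<le> r0"
  shows "\<bar>w r - v r\<bar> \<le> 2 * \<bar>a - b\<bar>"
proof -
  have cont: "continuous_on {x..y} (\<lambda>r. w r - v r)" if "0 \<le> x" for x y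
    using that by (intro continuous_intros S1.continuous_on_w S2.continuous_on_w)
  have "\<exists>x\<in>{0..r0}. \<forall>y\<in>{0..r0}. \<bar>w y - v y\<bar> \<le> \<bar>w x - v x\<bar>"
    by (rule continuous_attains_sup) (use assms(1) in \<open>auto intro!: continuous_intros cont\<close>)
  then obtain x where x: "0 \<le> x" "x \<le> r0" "\<And>y. 0 \<le> y \<Longrightarrow> y \<le> r0 \<Longrightarrow> \<bar>w y - v y\<bar> \<le> \<bar>w x - v x\<bar>"
    by auto
  define M where "M = \<bar>w x - v x\<bar>"
  define Q where "Q = S1.c * (A powr (S1.c - 1) + B powr (S1.c - 1)) * (\<epsilon> + L)"
  have Q: "0 \<le> Q" using S1.c_pos S1.eps_pos L_pos by (simp add: Q_def)
  have D: "\<bar>spow S1.c (F s) - spow S1.c (G s)\<bar> \<le> Q * r0 powr S1.c * M" if s: "0 < s" "s \<le> r0" for s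
  proof -
    have "F s \<le> 0" "G s \<le> 0"
      using F[OF s] G[OF s] mult_pos_pos[OF assms(2) s(1)] by linarith+
    then have "spow S1.c (F s) - spow S1.c (G s) = (- G s) powr S1.c - (- F s) powr S1.c"
      by (simp add: spow_neg_eq)
    also have "\<bar>\<dots>\<bar> \<le> S1.c * (A powr (S1.c - 1) + B powr (S1.c - 1)) * s powr (S1.c - 1) * \<bar>- G s - - F s\<bar>"
      by (rule powr_Lipschitz) (use F[OF s] G[OF s] assms(2) s S1.c_pos in auto)
    also have "\<dots> \<le> S1.c * (A powr (S1.c - 1) + B powr (S1.c - 1)) * s powr (S1.c - 1) * ((\<epsilon> + L) * s * M)"
    proof (intro mult_left_mono)
      show "\<bar>- G s - - F s\<bar> \<le> (\<epsilon> + L) * s * M"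
        using F_diff[of s M] s x(3) by (auto simp: M_def)
    qed (use S1.c_pos in auto)
    also have "\<dots> = Q * s powr S1.c * M" using s by (simp add: Q_def powr_diff)
    also have "\<dots> \<le> Q * r0 powr S1.c * M"
      using s Q S1.c_pos by (intro mult_right_mono mult_left_mono powr_mono2) (auto simp: M_def)
    finally show ?thesis .
  qed
  define K where "K = Q * r0 powr S1.c * M"
  have Dz: "((\<lambda>r. w r - v r) has_real_derivative spow S1.c (F s) - spow S1.c (G s)) (at s)" if "0 < s" for s
    by (intro DERIV_diff S1.w_deriv_c S2.w_deriv_c that)
  have "(w x - v x) - (w 0 - v 0) \<le> K * x - K * 0"
    by (rule diff_le_of_deriv_le[where f = "\<lambda>r. w r - v r" and g = "\<lambda>r. K * r" and g' = "\<lambda>_. K", OF _ _ _ Dz])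
      (use x D in \<open>auto intro!: continuous_intros cont derivative_eq_intros simp: K_def abs_le_iff\<close>)
  moreover have "(- K) * x - (- K) * 0 \<le> (w x - v x) - (w 0 - v 0)"
    by (rule diff_le_of_deriv_le[where g = "\<lambda>r. w r - v r" and f = "\<lambda>r. (- K) * r" and f' = "\<lambda>_. - K", OF _ _ _ _ Dz])
      (use x D in \<open>auto intro!: continuous_intros cont derivative_eq_intros simp: K_def abs_le_iff, use D in fastforce\<close>)
  ultimately have "M \<le> \<bar>a - b\<bar> + K * x" by (auto simp: M_def S1.w_0 S2.w_0)
  also have "K * x \<le> K * r0" using x Q by (intro mult_left_mono) (auto simp: K_def M_def)
  also have "K * r0 = (Q * r0 powr S1.c * r0) * M" by (simp add: K_def)
  also have "\<dots> \<le> 1 / 2 * M" using small by (intro mult_right_mono) (auto simp: Q_def M_def)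
  finally have "M \<le> 2 * \<bar>a - b\<bar>" by simp
  then show ?thesis using x(3)[OF r] by (simp add: M_def)
qed

text \<open>
  Away from \<open>0\<close> no Lipschitz bound for \<open>F \<mapsto> w'\<close> is needed: in \<open>F = J / r\<^sup>n - \<epsilon> r w\<close> the local term has
  a good sign and dominates the difference of the \<open>J\<close>s at a maximum of \<open>e\<^sup>-\<^sup>l\<^sup>r \<bar>w - v\<bar>\<close> for large \<open>l\<close>.
\<close>

lemma weighted_max:
  assumes "0 < r0" "r0 < x" and M0: "\<And>r. 0 \<le> r \<Longrightarrow> r \<le> r0 \<Longrightarrow> \<bar>w r - v r\<bar> \<le> M0"
    and max: "\<And>s. r0 \<le> s \<Longrightarrow> s \<le> x \<Longrightarrow> \<bar>w s - v s\<bar> \<le> exp (2 * L / (\<epsilon> * r0) * (s - x)) * (w x - v x)"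
  shows "w x - v x \<le> 2 * L / \<epsilon> * M0"
proof (rule ccontr)
  assume neg: "\<not> ?thesis"
  define \<mu> where "\<mu> = w x - v x"
  define l where "l = 2 * L / (\<epsilon> * r0)"
  have l: "0 < l" using L_pos S1.eps_pos assms(1) by (simp add: l_def)
  have M0': "0 \<le> M0" using M0[of 0] assms(1) by simp
  have "0 \<le> 2 * L / \<epsilon> * M0" using M0' L_pos S1.eps_pos by simp
  then have \<mu>: "2 * L / \<epsilon> * M0 < \<mu>" "0 \<le> \<mu>" using neg unfolding \<mu>_def by linarith+
  have x0: "0 < x" using assms by simp
  \<comment> \<open>Maximality of the weighted difference bounds the growth of
    \<open>S1.J - S2.J\<close> by an integral of \<open>exp (l (s - x))\<close>, which gains a
    factor \<open>1 / l\<close>.\<close>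
  have "(S1.J x - S2.J x) - (S1.J r0 - S2.J r0) \<le> x ^ n * L * \<mu> / l * exp (l * (x - x)) - x ^ n * L * \<mu> / l * exp (l * (r0 - x))"
  proof (rule diff_le_of_deriv_le[where f = "\<lambda>s. S1.J s - S2.J s" and g = "\<lambda>s. x ^ n * L * \<mu> / l * exp (l * (s - x))"
        and f' = "\<lambda>s. s ^ n * S1.H (w s) - s ^ n * S2.H (v s)" and g' = "\<lambda>s. x ^ n * L * \<mu> * exp (l * (s - x))"])
    fix s assume s: "r0 < s" "s < x"
    then have s0: "0 < s" using assms(1) by simp
    show "((\<lambda>s. S1.J s - S2.J s) has_real_derivative s ^ n * S1.H (w s) - s ^ n * S2.H (v s)) (at s)"
      by (intro DERIV_diff S1.J_deriv S2.J_deriv s0)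
    show "((\<lambda>s. x ^ n * L * \<mu> / l * exp (l * (s - x))) has_real_derivative x ^ n * L * \<mu> * exp (l * (s - x))) (at s)"
      using l by (auto intro!: derivative_eq_intros)
    have "S1.H (w s) - S1.H (v s) \<le> L * \<bar>w s - v s\<bar>"
      using H_diff[of s] s0 by (simp add: abs_le_iff)
    also have "\<dots> \<le> L * (exp (l * (s - x)) * \<mu>)"
      using max[of s] s L_pos unfolding l_def \<mu>_def by (intro mult_left_mono) auto
    finally have "S1.H (w s) - S1.H (v s) \<le> L * (exp (l * (s - x)) * \<mu>)" .
    then have "s ^ n * (S1.H (w s) - S1.H (v s)) \<le> s ^ n * (L * (exp (l * (s - x)) * \<mu>))"
      using s0 by (intro mult_left_mono) auto
    also have "\<dots> \<le> x ^ n * (L * (exp (l * (s - x)) * \<mu>))"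
      using s0 s L_pos \<mu> by (intro mult_right_mono power_mono) auto
    finally show "s ^ n * S1.H (w s) - s ^ n * S2.H (v s) \<le> x ^ n * L * \<mu> * exp (l * (s - x))"
      by (simp add: algebra_simps)
  qed (use assms l in \<open>auto intro!: continuous_intros S1.continuous_on_J S2.continuous_on_J\<close>)
  moreover have "0 \<le> x ^ n * L * \<mu> / l * exp (l * (r0 - x))" using x0 L_pos \<mu> l by simp
  moreover have "S1.J r0 - S2.J r0 \<le> L * M0 * r0 ^ (n + 1)" using J_diff[OF assms(1), of M0] M0 by (simp add: abs_le_iff)
  ultimately have "S1.J x - S2.J x \<le> L * M0 * r0 ^ (n + 1) + x ^ n * L * \<mu> / l" by simp
  also have "L * M0 * r0 ^ (n + 1) \<le> x ^ n * (L * M0 * r0)"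
  proof -
    have "r0 ^ n * (L * M0 * r0) \<le> x ^ n * (L * M0 * r0)"
      using assms(1,2) L_pos M0' by (intro mult_right_mono power_mono) auto
    then show ?thesis by (simp add: algebra_simps)
  qed
  finally have "S1.J x - S2.J x \<le> x ^ n * (L * M0 * r0 + L * \<mu> / l)" by (simp add: algebra_simps)
  then have "(S1.J x - S2.J x) / x ^ n \<le> L * M0 * r0 + L * \<mu> / l"
    using x0 by (simp add: pos_divide_le_eq mult.commute)
  \<comment> \<open>The choice of \<open>l\<close> makes this half of
    \<open>\<epsilon> r0 \<mu>\<close>, a lower bound of the local term; the assumed failure of the
    claim keeps the contribution of \<open>M0\<close> below the other half.\<close>
  moreover have "L * \<mu> / l = \<epsilon> * r0 * \<mu> / 2" using L_pos S1.eps_pos assms(1) by (simp add: l_def field_simps)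
  moreover have "\<epsilon> * r0 * \<mu> \<le> \<epsilon> * x * \<mu>" using assms \<mu>(2) S1.eps_pos by (intro mult_right_mono) auto
  moreover have "F x - G x = (S1.J x - S2.J x) / x ^ n - \<epsilon> * x * \<mu>"
    using S1.F_eq_J[OF x0] S2.F_eq_J[OF x0] by (simp add: \<mu>_def diff_divide_distrib algebra_simps)
  moreover have "L * M0 * r0 < \<epsilon> * r0 * \<mu> / 2"
  proof -
    have "2 * L * M0 < \<mu> * \<epsilon>" using \<mu>(1) S1.eps_pos by (simp add: field_simps)
    then have "r0 * (2 * L * M0) < r0 * (\<mu> * \<epsilon>)" using assms(1) by simp
    then show ?thesis by (simp add: algebra_simps)
  qed
  \<comment> \<open>Hence \<open>w - v\<close> exceeds \<open>\<mu>\<close> just to the left of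
    \<open>x\<close>, where the exponential weight permits at most \<open>\<mu>\<close>.\<close>
  ultimately have "F x < G x" by linarith
  then have "spow S1.c (F x) < spow S1.c (G x)" using S1.c_pos by (intro spow_strict_mono)
  then have "spow S1.c (F x) - spow S1.c (G x) < 0" by simp
  from DERIV_neg_dec_left[OF DERIV_diff[OF S1.w_deriv_c[OF x0] S2.w_deriv_c[OF x0]] this]
  obtain h where h: "0 < h" "\<And>y. 0 < y \<Longrightarrow> y < h \<Longrightarrow> w x - v x < w (x - y) - v (x - y)" by blast
  define y where "y = min (h / 2) (x - r0)"
  have y: "0 < y" "y < h" "r0 \<le> x - y" using h(1) assms(2) by (auto simp: y_def)
  have "\<mu> < \<bar>w (x - y) - v (x - y)\<bar>" using h(2)[OF y(1,2)] by (simp add: \<mu>_def)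
  also have "\<dots> \<le> exp (l * (x - y - x)) * \<mu>" using max[of "x - y"] y by (simp add: l_def \<mu>_def)
  also have "\<dots> \<le> 1 * \<mu>" using l y(1) \<mu>(2) by (intro mult_right_mono) auto
  finally show False by simp
qed

end

lemma two_sols_swap:
  assumes "two_sols n m \<alpha> q \<epsilon> a w F b v G W L"
  shows "two_sols n m \<alpha> q \<epsilon> b v G a w F W L"
  using assms unfolding two_sols_def two_sols_axioms_def by blast

context two_sols
begin

text \<open>The weighted difference attains its maximum over \<open>[r0, r]\<close> at some
  \<open>x\<close>. Either \<open>x = r0\<close>, where \<open>M0\<close> bounds it, or
  \<open>weighted_max\<close> applies to the two solutions in the order that makes their difference
  nonnegative. Undoing the weight costs \<open>exp (l R)\<close>.\<close>

lemma diff_far: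
  assumes "0 < r0" and M0: "\<And>r. 0 \<le> r \<Longrightarrow> r \<le> r0 \<Longrightarrow> \<bar>w r - v r\<bar> \<le> M0"
    and r: "0 \<le> r" "r \<le> R"
  shows "\<bar>w r - v r\<bar> \<le> exp (2 * L / (\<epsilon> * r0) * R) * ((1 + 2 * L / \<epsilon>) * M0)"
proof -
  interpret sw: two_sols n m \<alpha> q \<epsilon> b v G a w F W L
    by (rule two_sols_swap) unfold_locales
  define l where "l = 2 * L / (\<epsilon> * r0)"
  have l: "0 < l" using L_pos S1.eps_pos assms(1) by (simp add: l_def)
  have M0': "0 \<le> M0" using M0[of 0] assms(1) by simp
  have le: "M0 \<le> (1 + 2 * L / \<epsilon>) * M0" "2 * L / \<epsilon> * M0 \<le> (1 + 2 * L / \<epsilon>) * M0" "0 \<le> (1 + 2 * L / \<epsilon>) * M0"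
    using M0' L_pos S1.eps_pos by (auto simp: algebra_simps)
  have R0: "0 \<le> l * R" using r l by simp
  show ?thesis
  proof (cases "r \<le> r0")
    case True
    have "\<bar>w r - v r\<bar> \<le> 1 * ((1 + 2 * L / \<epsilon>) * M0)" using M0[OF r(1) True] le by simp
    also have "\<dots> \<le> exp (l * R) * ((1 + 2 * L / \<epsilon>) * M0)"
      using R0 le(3) by (intro mult_right_mono) auto
    finally show ?thesis by (simp add: l_def)
  next
    case False
    have "\<exists>x\<in>{r0..r}. \<forall>y\<in>{r0..r}. exp (- (l * y)) * \<bar>w y - v y\<bar> \<le> exp (- (l * x)) * \<bar>w x - v x\<bar>"
      by (rule continuous_attains_sup)
        (use False assms(1) in \<open>auto intro!: continuous_intros S1.continuous_on_w S2.continuous_on_w\<close>)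
    then obtain x where x: "r0 \<le> x" "x \<le> r"
      and max: "\<And>y. r0 \<le> y \<Longrightarrow> y \<le> r \<Longrightarrow> exp (- (l * y)) * \<bar>w y - v y\<bar> \<le> exp (- (l * x)) * \<bar>w x - v x\<bar>"
      by auto
    have max': "\<bar>w y - v y\<bar> \<le> exp (l * (y - x)) * \<bar>w x - v x\<bar>" if "r0 \<le> y" "y \<le> r" for y
    proof -
      have "exp (l * y) * (exp (- (l * y)) * \<bar>w y - v y\<bar>) \<le> exp (l * y) * (exp (- (l * x)) * \<bar>w x - v x\<bar>)"
        using max[OF that] by (intro mult_left_mono) auto
      then show ?thesis by (simp add: mult.assoc[symmetric] algebra_simps flip: exp_add)
    qed
    have "\<bar>w x - v x\<bar> \<le> (1 + 2 * L / \<epsilon>) * M0"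
    proof (cases "x = r0")
      case True
      then show ?thesis using M0[of r0] assms(1) le(1) by simp
    next
      case False
      then have "r0 < x" using x by simp
      show ?thesis
      proof (cases "0 \<le> w x - v x")
        case True
        have "w x - v x \<le> 2 * L / \<epsilon> * M0"
          by (rule weighted_max[OF assms(1) \<open>r0 < x\<close>]) (use M0 max' x True in \<open>auto simp: l_def\<close>)
        then show ?thesis using True le(2) by simp
      next
        case False
        have "v x - w x \<le> 2 * L / \<epsilon> * M0"
          by (rule sw.weighted_max[OF assms(1) \<open>r0 < x\<close>])
            (use M0 max' x False in \<open>auto simp: l_def abs_minus_commute[of "v _"] abs_of_neg\<close>)
        then show ?thesis using False le(2) by simp
      qed
    qed
    then have "exp (l * (r - x)) * \<bar>w x - v x\<bar> \<le> exp (l * R) * ((1 + 2 * L / \<epsilon>) * M0)"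
      using r x l assms(1) by (intro mult_mono) auto
    then show ?thesis using max'[of r] False by (simp add: l_def)
  qed
qed

end

text \<open>All initial values within \<open>a / 2\<close> of \<open>a\<close> share the constants
  \<open>W\<close>, \<open>V\<close>, \<open>A\<close> and \<open>B\<close>, so one
  \<open>r0\<close> serves them all. Then \<open>diff_near_0\<close> covers \<open>[0, r0]\<close>,
  \<open>diff_far\<close> the rest up to \<open>R\<close>, and \<open>F_diff\<close> passes from
  \<open>w\<close> to \<open>F\<close>.\<close>

lemma continuous_dependence:
  fixes w F :: "real \<Rightarrow> real \<Rightarrow> real"
  assumes sol: "\<And>a. 0 < a \<Longrightarrow> radial_sol n m \<alpha> q \<epsilon> a (w a) (F a)" and a: "0 < a" and R: "0 < R"
  obtains C where "0 < C"
    "\<And>b r. \<bar>b - a\<bar> < a / 2 \<Longrightarrow> 0 \<le> r \<Longrightarrow> r \<le> R \<Longrightarrow> \<bar>w b r - w a r\<bar> \<le> C * \<bar>b - a\<bar>"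
    "\<And>b r. \<bar>b - a\<bar> < a / 2 \<Longrightarrow> 0 < r \<Longrightarrow> r \<le> R \<Longrightarrow> \<bar>F b r - F a r\<bar> \<le> C * \<bar>b - a\<bar>"
proof -
  interpret Sa: radial_sol n m \<alpha> q \<epsilon> a "w a" "F a" by (rule sol[OF a])
  define c where "c = Sa.c"
  have c: "0 < c" using Sa.c_pos by (simp add: c_def)
  \<comment> \<open>Every admissible \<open>b\<close> is at most \<open>2 * a\<close>, so
    \<open>E\<close> bounds all initial energies; \<open>W\<close> and \<open>\<Phi>\<close> come
    from solving the two energy bounds for \<open>w\<close> and \<open>F\<close>.\<close>
  define E where "E = \<epsilon> * \<alpha> / 2 * (2 * a)\<^sup>2 + 1 / (q + 1) * (2 * a) powr (q + 1)"
  have E: "0 \<le> E" using Sa.eps_pos Sa.alpha_pos Sa.q_gt by (simp add: E_def)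
  define W where "W = sqrt (2 * E / (\<epsilon> * \<alpha>))"
  have W: "0 \<le> W" "E \<le> \<epsilon> * \<alpha> / 2 * W\<^sup>2"
    using E Sa.eps_pos Sa.alpha_pos by (auto simp: W_def)
  define \<Phi> where "\<Phi> = ((c + 1) * E) powr (1 / (c + 1))"
  have \<Phi>: "0 \<le> \<Phi>" "E \<le> 1 / (c + 1) * \<Phi> powr (c + 1)"
    using E c by (auto simp: \<Phi>_def powr_powr)
  define V where "V = \<Phi> powr c + 1"
  have V: "0 < V" by (simp add: V_def add_nonneg_pos)
  define L where "L = \<epsilon> * (real n + 1) + q * W powr (q - 1)"
  have L: "0 < L" using Sa.eps_pos Sa.q_gt by (simp add: L_def add_pos_nonneg)
  define A where "A = \<epsilon> * \<alpha> * (a / 2) / (2 * (real n + 1))"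
  define B where "B = \<epsilon> * (2 * a) + (2 * a) powr q"
  have A: "0 < A" using Sa.eps_pos Sa.alpha_pos a by (simp add: A_def)
  define Q where "Q = c * (A powr (c - 1) + B powr (c - 1)) * (\<epsilon> + L)"
  have Q: "0 \<le> Q" using c Sa.eps_pos L by (simp add: Q_def)
  \<comment> \<open>The bound \<open>1 / (2 * (Q + 1))\<close> makes the estimate near 0
    contracting; the last one is the condition of \<open>F_near_0\<close>, for every initial value
    from \<open>a / 2\<close> on.\<close>
  define r0 where "r0 = min (min 1 (1 / (2 * (Q + 1)))) (\<alpha> * (a / 2) / (2 * (real n + 1)) / V)"
  have r0: "0 < r0" "r0 \<le> 1" "r0 \<le> 1 / (2 * (Q + 1))" "r0 \<le> \<alpha> * (a / 2) / (2 * (real n + 1)) / V"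
    using Q V a Sa.alpha_pos by (simp_all add: r0_def min_le_iff_disj)
  have small: "Q * r0 powr c * r0 \<le> 1 / 2"
  proof -
    have "r0 powr c \<le> 1" using r0 c by (simp add: powr_le1)
    then have "Q * r0 powr c * r0 \<le> Q * 1 * (1 / (2 * (Q + 1)))"
      using Q r0 by (intro mult_mono) auto
    also have "\<dots> \<le> 1 / 2" using Q by (simp add: field_simps)
    finally show ?thesis .
  qed
  have bounds: "\<bar>w b r\<bar> \<le> W" "\<bar>spow c (F b r)\<bar> \<le> V" if b: "\<bar>b - a\<bar> < a / 2" and r: "0 \<le> r" for b r
  proof -
    have b0: "0 < b" "b \<le> 2 * a" using b a unfolding abs_less_iff by linarith+
    interpret Sb: radial_sol n m \<alpha> q \<epsilon> b "w b" "F b" by (rule sol[OF b0(1)])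
    have "Sb.energy 0 \<le> E" unfolding Sb.energy_0 E_def
      using b0 Sa.eps_pos Sa.alpha_pos Sa.q_gt
      by (intro add_mono mult_left_mono power_mono powr_mono2) auto
    then show "\<bar>w b r\<bar> \<le> W" using W r by (intro Sb.w_abs_le) auto
    have "\<bar>F b r\<bar> \<le> \<Phi>" using \<Phi> r \<open>Sb.energy 0 \<le> E\<close> unfolding c_def by (intro Sb.F_abs_le) auto
    then have "\<bar>F b r\<bar> powr c \<le> \<Phi> powr c" using c by (intro powr_mono2) auto
    then show "\<bar>spow c (F b r)\<bar> \<le> V" by (simp add: abs_spow V_def)
  qed
  have near: "A * r \<le> - F b r \<and> - F b r \<le> B * r" if b: "\<bar>b - a\<bar> < a / 2" and r: "0 < r" "r \<le> r0" for b r
  proof -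
    have b0: "a / 2 \<le> b" "0 < b" "b \<le> 2 * a" using b a unfolding abs_less_iff by linarith+
    interpret Sb: radial_sol n m \<alpha> q \<epsilon> b "w b" "F b" by (rule sol[OF b0(2)])
    have "V * r \<le> V * (\<alpha> * (a / 2) / (2 * (real n + 1)) / V)"
      using r r0(4) V by (intro mult_left_mono) auto
    also have "\<dots> = \<alpha> * (a / 2) / (2 * (real n + 1))" using V by simp
    also have "\<dots> \<le> \<alpha> * b / (2 * (real n + 1))"
      using b0 Sa.alpha_pos by (intro divide_right_mono mult_left_mono) auto
    finally have Vr: "V * r \<le> \<alpha> * b / (2 * (real n + 1))" .
    have Vb: "\<bar>spow Sb.c (F b s)\<bar> \<le> V" if "0 \<le> s" for s using bounds(2)[OF b that] by (simp add: c_def)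
    have "A * r \<le> \<epsilon> * \<alpha> * b / (2 * (real n + 1)) * r"
      unfolding A_def using b0 r Sa.eps_pos Sa.alpha_pos by (intro mult_right_mono divide_right_mono mult_left_mono) auto
    also have "\<dots> \<le> - F b r" by (rule Sb.F_near_0(1)[OF Vb r(1) Vr])
    finally have 1: "A * r \<le> - F b r" .
    have "- F b r \<le> (\<epsilon> * b + b powr q) * r" by (rule Sb.F_near_0(2)[OF Vb r(1) Vr])
    also have "\<dots> \<le> B * r"
      unfolding B_def using b0 r Sa.eps_pos Sa.q_gt by (intro mult_right_mono add_mono mult_left_mono powr_mono2) auto
    finally show ?thesis using 1 by simp
  qed
  define C1 where "C1 = exp (2 * L / (\<epsilon> * r0) * R) * ((1 + 2 * L / \<epsilon>) * 2)"
  have C1: "0 < C1" using L Sa.eps_pos by (simp add: C1_def add_pos_pos)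
  have aa: "\<bar>a - a\<bar> < a / 2" using a by simp
  have main: "\<bar>w b r - w a r\<bar> \<le> C1 * \<bar>b - a\<bar>" "0 < r \<Longrightarrow> \<bar>F b r - F a r\<bar> \<le> (\<epsilon> + L) * R * (C1 * \<bar>b - a\<bar>)"
    if b: "\<bar>b - a\<bar> < a / 2" and r: "0 \<le> r" "r \<le> R" for b r
  proof -
    have b0: "0 < b" using b a unfolding abs_less_iff by linarith+
    interpret T: two_sols n m \<alpha> q \<epsilon> b "w b" "F b" a "w a" "F a" W L
      by (intro two_sols.intro two_sols_axioms.intro sol b0 a bounds(1)[OF b] bounds(1)[OF aa] L_def)
    have n0: "\<bar>w b s - w a s\<bar> \<le> 2 * \<bar>b - a\<bar>" if "0 \<le> s" "s \<le> r0" for s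
      by (rule T.diff_near_0[OF r0(1) A near[OF b] near[OF aa] small[unfolded Q_def c_def] that])
    have far: "\<bar>w b s - w a s\<bar> \<le> C1 * \<bar>b - a\<bar>" if "0 \<le> s" "s \<le> R" for s
      using T.diff_far[OF r0(1) n0 that] by (simp only: C1_def mult.assoc)
    show "\<bar>w b r - w a r\<bar> \<le> C1 * \<bar>b - a\<bar>" by (rule far[OF r])
    assume "0 < r"
    then have "\<bar>F b r - F a r\<bar> \<le> (\<epsilon> + L) * r * (C1 * \<bar>b - a\<bar>)"
      using far r by (intro T.F_diff) auto
    also have "\<dots> \<le> (\<epsilon> + L) * R * (C1 * \<bar>b - a\<bar>)"
      using r L Sa.eps_pos C1 by (intro mult_right_mono mult_left_mono) auto
    finally show "\<bar>F b r - F a r\<bar> \<le> (\<epsilon> + L) * R * (C1 * \<bar>b - a\<bar>)" .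
  qed
  define C where "C = C1 + (\<epsilon> + L) * R * C1"
  have C: "0 < C" "C1 \<le> C" "(\<epsilon> + L) * R * C1 \<le> C"
    using C1 L R Sa.eps_pos by (auto simp: C_def add_pos_pos)
  show ?thesis
  proof (rule that[OF C(1)])
    fix b r :: real assume b: "\<bar>b - a\<bar> < a / 2"
    show "\<bar>w b r - w a r\<bar> \<le> C * \<bar>b - a\<bar>" if "0 \<le> r" "r \<le> R"
      using main(1)[OF b that] mult_right_mono[OF C(2), of "\<bar>b - a\<bar>"] by simp
    show "\<bar>F b r - F a r\<bar> \<le> C * \<bar>b - a\<bar>" if "0 < r" "r \<le> R"
      using main(2)[OF b _ that(2,1)] mult_right_mono[OF C(3), of "\<bar>b - a\<bar>"] that by (simp add: mult_ac)
  qed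
qed

section \<open>Sign change for large initial values\<close>

context radial_sol
begin

lemma flux_deriv:
  assumes "0 < s"
  shows "((\<lambda>s. s ^ n * F s) has_real_derivative
    - (s ^ n * (\<epsilon> * (s * spow c (F s) + \<alpha> * w s) + spow q (w s)))) (at s)"
proof -
  have p: "((\<lambda>r. r ^ n) has_real_derivative real n / s * s ^ n) (at s)"
    using assms by (auto intro!: derivative_eq_intros) (cases n; simp)
  show ?thesis
    by (rule derivative_eq_intros p F_deriv_c assms refl)+ (use assms in \<open>simp add: algebra_simps\<close>)
qed

text \<open>With \<open>n - m = N - p\<close> and \<open>m + 1 = p\<close> this is the Pohozaev
  functional of the Lane--Emden terms, those without \<open>\<epsilon>\<close>. For
  \<open>\<epsilon> = 0\<close> and nonnegative \<open>w\<close> its derivative is a multiple of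
  \<open>s^n w^(q+1)\<close>, with a coefficient that is positive exactly in the subcritical
  range.\<close>

definition pohozaev :: "real \<Rightarrow> real" where
  "pohozaev s = s ^ (n + 1) * (1 / (c + 1) * \<bar>F s\<bar> powr (c + 1) + 1 / (q + 1) * \<bar>w s\<bar> powr (q + 1))
    + (real n - m) / (m + 1) * (w s * (s ^ n * F s))"

section \<open>Constraints on a nonnegative solution with slope bound \<open>V\<close>\<close>

context
  fixes V :: real
  assumes V: "\<And>s. 0 \<le> s \<Longrightarrow> \<bar>spow c (F s)\<bar> \<le> V" and nonneg: "\<And>s. 0 \<le> s \<Longrightarrow> 0 \<le> w s"
begin

text \<open>The term \<open>\<epsilon> V s^(n+2)\<close> is added because
  \<open>w' \<ge> - V\<close>: its derivative outweighs \<open>\<epsilon> s^(n+1) w'\<close>, the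
  only possibly negative contribution to the derivative of \<open>- s^n F\<close>. What remains is
  at least \<open>s^n w^q\<close>.\<close>

lemma flux_lower:
  assumes "0 \<le> x" "x \<le> s" and K: "\<And>t. x < t \<Longrightarrow> t < s \<Longrightarrow> K \<le> spow q (w t)"
  shows "K / (real n + 1) * (s ^ (n + 1) - x ^ (n + 1))
    \<le> (\<epsilon> * V * s ^ (n + 2) - s ^ n * F s) - (\<epsilon> * V * x ^ (n + 2) - x ^ n * F x)"
proof -
  have "K / (real n + 1) * s ^ (n + 1) - K / (real n + 1) * x ^ (n + 1)
    \<le> (\<epsilon> * V * s ^ (n + 2) - s ^ n * F s) - (\<epsilon> * V * x ^ (n + 2) - x ^ n * F x)"
  proof (rule diff_le_of_deriv_le[where f = "\<lambda>s. K / (real n + 1) * s ^ (n + 1)"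
        and g = "\<lambda>s. \<epsilon> * V * s ^ (n + 2) - s ^ n * F s" and f' = "\<lambda>s. s ^ n * K"
        and g' = "\<lambda>s. \<epsilon> * V * ((real n + 2) * s ^ (n + 1)) + s ^ n * (\<epsilon> * (s * spow c (F s) + \<alpha> * w s) + spow q (w s))"])
    fix t assume t: "x < t" "t < s"
    then have t0: "0 < t" using assms(1) by simp
    show "((\<lambda>s. K / (real n + 1) * s ^ (n + 1)) has_real_derivative t ^ n * K) (at t)"
      by (rule derivative_eq_intros refl)+ (simp add: field_simps)
    have "((\<lambda>s. \<epsilon> * V * s ^ (n + 2)) has_real_derivative \<epsilon> * V * ((real n + 2) * t ^ (n + 1))) (at t)"
      by (rule derivative_eq_intros refl)+ (simp add: algebra_simps)
    from DERIV_diff[OF this flux_deriv[OF t0]]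
    show "((\<lambda>s. \<epsilon> * V * s ^ (n + 2) - s ^ n * F s) has_real_derivative \<epsilon> * V * ((real n + 2) * t ^ (n + 1)) + t ^ n * (\<epsilon> * (t * spow c (F t) + \<alpha> * w t) + spow q (w t))) (at t)"
      by simp
    have V0: "0 \<le> V" "- V \<le> spow c (F t)" using V[of 0] V[of t] t0 by (auto simp: abs_le_iff)
    have "0 \<le> \<epsilon> * t ^ (n + 1) * (V + spow c (F t))" using V0 t0 eps_pos by simp
    moreover have "0 \<le> \<epsilon> * V * (real n + 1) * t ^ (n + 1)" using V0 t0 eps_pos by simp
    moreover have "0 \<le> t ^ n * (\<epsilon> * \<alpha> * w t)" using nonneg[of t] t0 eps_pos alpha_pos by simp
    moreover have "t ^ n * K \<le> t ^ n * spow q (w t)" using K[OF t] t0 by (intro mult_left_mono) auto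
    ultimately show "t ^ n * K \<le> \<epsilon> * V * ((real n + 2) * t ^ (n + 1)) + t ^ n * (\<epsilon> * (t * spow c (F t) + \<alpha> * w t) + spow q (w t))"
      by (simp add: algebra_simps)
  qed (use assms in \<open>auto intro!: continuous_intros continuous_on_F\<close>)
  then show ?thesis by (simp add: algebra_simps)
qed

lemma w_le_a: "0 \<le> s \<Longrightarrow> w s \<le> a"
  using w_antimono[of 0 s] nonneg w_0 by (simp add: less_imp_le)

text \<open>Up to \<open>s0\<close> the slope bound keeps \<open>w \<ge> 1 / 2\<close>, which
  produces a fixed amount of flux; beyond \<open>s0\<close> it can be lost only through the
  \<open>\<epsilon>\<close> correction.\<close>

lemma F_lower_far:
  assumes "a = 1" "0 < s0" "V * s0 \<le> 1 / 2" "s0 \<le> s"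
  shows "(1 / 2) powr q * s0 ^ (n + 1) / (real n + 1) - \<epsilon> * V * s ^ (n + 2) \<le> - (s ^ n * F s)"
proof -
  have V0: "0 \<le> V" using V[of 0] by simp
  have "(1 / 2) powr q \<le> spow q (w t)" if "0 < t" "t < s0" for t
  proof -
    have "V * t \<le> V * s0" using that V0 by (intro mult_left_mono) auto
    then have "1 / 2 \<le> w t" using w_ge_near_0[OF V, of t] that assms by simp
    then show ?thesis using q_gt by (simp add: spow_nonneg_eq powr_mono2)
  qed
  from flux_lower[OF order_refl less_imp_le[OF assms(2)] this]
  have "(1 / 2) powr q / (real n + 1) * s0 ^ (n + 1) \<le> \<epsilon> * V * s0 ^ (n + 2) - s0 ^ n * F s0"
    by (simp add: F_0)
  also have "\<dots> \<le> \<epsilon> * V * s ^ (n + 2) - s ^ n * F s"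
    using flux_lower[of s0 s 0] assms nonneg by simp
  finally show ?thesis by simp
qed

text \<open>The flux retains the amount \<open>K\<close>, so \<open>- w' \<ge> (K / s^n)^c\<close>.
  Because \<open>n c \<le> 1\<close>, this is at least \<open>K^c / s\<close> for
  \<open>s \<ge> 1\<close>, whose integral diverges logarithmically. \<open>S\<close> is where the
  logarithm has lowered \<open>w\<close> by 2.\<close>

lemma changes_sign_low_dimension:
  assumes "a = 1" "0 < s0" "s0 \<le> 1" "V * s0 \<le> 1 / 2" and low: "real n \<le> m"
    and K: "K = (1 / 2) powr q * s0 ^ (n + 1) / (real n + 1) / 2"
    and S: "S = exp (2 / K powr c)" and small: "\<epsilon> * V * S ^ (n + 2) \<le> K"
  shows False
proof -
  have V0: "0 \<le> V" using V[of 0] by simp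
  have K0: "0 < K" using K assms(2) by simp
  have K2: "(1 / 2) powr q * s0 ^ (n + 1) / (real n + 1) = 2 * K"
  proof -
    have "Y = 2 * (Y / 2)" for Y :: real by simp
    then show ?thesis unfolding K .
  qed
  have S1: "1 \<le> S" using K0 by (simp add: S)
  have nc: "real n * c \<le> 1" using low m_pos by (simp add: c_def)
  have "w S - w 1 \<le> - (K powr c) * ln S - - (K powr c) * ln 1"
  proof (rule diff_le_of_deriv_le[where f = w and g = "\<lambda>s. - (K powr c) * ln s" and g' = "\<lambda>s. - (K powr c) * (1 / s)", OF S1])
    fix s assume s: "1 < s" "s < S"
    then have s0: "0 < s" by simp
    show "(w has_real_derivative spow c (F s)) (at s)" by (rule w_deriv_c[OF s0])
    show "((\<lambda>s. - (K powr c) * ln s) has_real_derivative - (K powr c) * (1 / s)) (at s)"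
      by (intro DERIV_cmult DERIV_ln_divide s0)
    have "\<epsilon> * V * s ^ (n + 2) \<le> \<epsilon> * V * S ^ (n + 2)"
      using s V0 eps_pos by (intro mult_left_mono power_mono) auto
    then have "K \<le> - (s ^ n * F s)"
      using F_lower_far[OF assms(1,2,4), of s, unfolded K2] s assms(3) small by linarith
    then have F: "K / s ^ n \<le> - F s" using s0 by (simp add: pos_divide_le_eq mult_ac)
    have "s powr (real n * c) \<le> s powr 1" using nc s by (intro powr_mono) auto
    then have "K powr c * (1 / s) \<le> K powr c * (1 / s powr (real n * c))"
      using s0 by (intro mult_left_mono divide_left_mono) auto
    also have "\<dots> = (K / s ^ n) powr c" using K0 s0 by (simp add: powr_divide powr_powr flip: powr_realpow)
    also have "\<dots> \<le> (- F s) powr c" using F K0 s0 c_pos by (intro powr_mono2) auto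
    also have "\<dots> = - spow c (F s)" using F_nonpos[of s] nonneg s0 by (simp add: spow_neg_eq)
    finally show "spow c (F s) \<le> - (K powr c) * (1 / s)" by simp
  qed (auto intro!: continuous_intros continuous_on_w)
  also have "\<dots> = - 2" using K0 by (simp add: S)
  finally have "w S \<le> - 1" using w_le_a[of 1] assms(1) by simp
  then show False using nonneg[of S] S1 by simp
qed

lemma pohozaev_deriv:
  assumes "0 < s"
  shows "(pohozaev has_real_derivative
     ((real n + 1) / (q + 1) - (real n - m) / (m + 1)) * (s ^ n * w s powr (q + 1))
     - \<epsilon> * (s * spow c (F s) + \<alpha> * w s) * (s ^ (n + 1) * spow c (F s) + (real n - m) / (m + 1) * (s ^ n * w s))) (at s)"
proof -
  have 1: "((\<lambda>r. \<bar>F r\<bar> powr (c + 1)) has_real_derivative (c + 1) * spow c (F s) *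
     (- (real n / s) * F s - \<epsilon> * (s * spow c (F s) + \<alpha> * w s) - spow q (w s))) (at s)"
    by (rule DERIV_chain2[OF DERIV_abs_powr[OF c_pos] F_deriv_c[OF assms]])
  have 2: "((\<lambda>r. \<bar>w r\<bar> powr (q + 1)) has_real_derivative (q + 1) * spow q (w s) * spow c (F s)) (at s)"
    by (rule DERIV_chain2[OF DERIV_abs_powr w_deriv_c[OF assms]]) (use q_gt in auto)
  have p: "((\<lambda>s. s ^ (n + 1)) has_real_derivative (real n + 1) * s ^ n) (at s)"
    by (rule derivative_eq_intros refl)+ simp
  have c1: "1 / (c + 1) * (c + 1) = 1" "1 / (q + 1) * (q + 1) = 1" using c_pos q_gt by auto
  have cm: "1 / (c + 1) = m / (m + 1)" using m_pos by (simp add: c_def field_simps)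
  define g where "g = spow c (F s)"
  define \<kappa> where "\<kappa> = (real n - m) / (m + 1)"
  define X where "X = \<epsilon> * (s * g + \<alpha> * w s)"
  define P where "P = spow q (w s)"
  have wq: "w s powr (q + 1) = P * w s"
    using nonneg[of s] assms by (simp add: spow_mult_self P_def)
  have Fg: "\<bar>F s\<bar> powr (c + 1) = g * F s" by (simp add: g_def spow_mult_self)
  \<comment> \<open>This cancellation of the kinetic terms dictates the coefficient
    \<open>\<kappa>\<close> in \<open>pohozaev\<close>.\<close>
  have coeff: "(real n + 1) * (1 / (c + 1)) - real n + \<kappa> = 0"
    unfolding cm \<kappa>_def using m_pos by (simp add: field_simps)
  have "(pohozaev has_real_derivative
      ((real n + 1) * s ^ n) * (1 / (c + 1) * \<bar>F s\<bar> powr (c + 1) + 1 / (q + 1) * \<bar>w s\<bar> powr (q + 1))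
      + (1 / (c + 1) * ((c + 1) * g * (- (real n / s) * F s - X - P)) + 1 / (q + 1) * ((q + 1) * P * g)) * s ^ (n + 1)
      + \<kappa> * (g * (s ^ n * F s) + - (s ^ n * (X + P)) * w s)) (at s)"
    unfolding pohozaev_def \<kappa>_def g_def X_def P_def
    by (intro DERIV_add DERIV_cmult DERIV_mult p 1 2 w_deriv_c[OF assms] flux_deriv[OF assms])
  moreover have "1 / (c + 1) * ((c + 1) * g * Z) = g * Z" "1 / (q + 1) * ((q + 1) * P * g) = P * g" for Z
    using c1 by (simp_all only: mult.assoc[symmetric] mult_1)
  ultimately have D: "(pohozaev has_real_derivative
      ((real n + 1) * s ^ n) * (1 / (c + 1) * (g * F s) + 1 / (q + 1) * (P * w s))
      + (g * (- (real n / s) * F s - X - P) + P * g) * s ^ (n + 1)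
      + \<kappa> * (g * (s ^ n * F s) + - (s ^ n * (X + P)) * w s)) (at s)"
    using wq Fg nonneg[of s] assms by simp
  have gen: "g * (- B * f - X - P) * A = - (B * A) * (g * f) - g * (X + P) * A" for A B f :: real
    by (simp add: algebra_simps)
  have gen2: "(k * B) * (i1 * (g * f) + i2 * (P * W)) + (- (l * B) * (g * f) - g * (X + P) * A + P * g * A)
      + \<kappa> * (g * (B * f) + - (B * (X + P)) * W)
     = (k * i1 - l + \<kappa>) * (B * (g * f)) + (k * i2 - \<kappa>) * (B * (P * W)) - X * (A * g + \<kappa> * (B * W))"
    for A B f W k l i1 i2 :: real
    by (simp add: algebra_simps)
  have "(real n / s) * s ^ (n + 1) = real n * s ^ n" using assms by simp
  then have ns: "g * (- (real n / s) * F s - X - P) * s ^ (n + 1) = - (real n * s ^ n) * (g * F s) - g * (X + P) * s ^ (n + 1)"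
    using gen[of "real n / s" "F s" "s ^ (n + 1)"] by (simp only:)
  have "((real n + 1) * s ^ n) * (1 / (c + 1) * (g * F s) + 1 / (q + 1) * (P * w s))
      + (g * (- (real n / s) * F s - X - P) + P * g) * s ^ (n + 1)
      + \<kappa> * (g * (s ^ n * F s) + - (s ^ n * (X + P)) * w s)
     = ((real n + 1) * (1 / (c + 1)) - real n + \<kappa>) * (s ^ n * (g * F s))
       + ((real n + 1) * (1 / (q + 1)) - \<kappa>) * (s ^ n * (P * w s))
       - X * (s ^ (n + 1) * g + \<kappa> * (s ^ n * w s))"
    unfolding distrib_right[of "g * _"] ns by (rule gen2)
  then show ?thesis using D unfolding coeff by (elim DERIV_cong) (simp add: X_def g_def \<kappa>_def wq)
qed

text \<open>As \<open>w\<close> decreases, \<open>flux_lower\<close> with the constant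
  \<open>w(s)^q\<close> gives \<open>- F \<ge> w^q s / (2 (n + 1))\<close>, the
  \<open>\<epsilon>\<close> term being absorbed in the other half. Since \<open>w \<le> 1\<close>,
  \<open>w^q \<ge> w^(m+b)\<close>, so \<open>- w'\<close> is at least a multiple of
  \<open>w^(1+bc) s^c\<close>; integrating the derivative of \<open>w^(-bc)\<close> gives the bound
  \<open>y\<close>. Taking \<open>b > 0\<close> as a separate parameter yields a power law even when
  \<open>q \<le> m\<close>.\<close>

lemma decay_at:
  assumes "a = 1" "0 < b" "q \<le> m + b" "0 < S" "0 < y"
    and y: "y = (b * c * (2 * (real n + 1)) powr (- c) / (c + 1) * S powr (c + 1)) powr (- (1 / (b * c)))"
    and small: "2 * (real n + 1) * \<epsilon> * V * S \<le> y powr q"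
  shows "w S \<le> y"
proof (rule ccontr)
  assume neg: "\<not> w S \<le> y"
  let ?N = "real n + 1"
  have V0: "0 \<le> V" using V[of 0] by simp
  have bc: "0 < b * c" using assms(2) c_pos by simp
  have mc: "m * c = 1" using m_pos by (simp add: c_def)
  have wS: "w S \<le> w s" if "0 \<le> s" "s \<le> S" for s
    using w_antimono[OF that] nonneg by (simp add: less_imp_le)
  have wpos: "0 < w s" if "0 \<le> s" "s \<le> S" for s using wS[OF that] neg assms(5) by linarith
  have wle: "w s \<le> 1" if "0 \<le> s" for s using w_le_a[OF that] assms(1) by simp
  define C where "C = b * c * (2 * ?N) powr (- c) / (c + 1)"
  have C: "0 < C" using bc c_pos by (simp add: C_def)
  have "C * S powr (c + 1) - C * 0 powr (c + 1) \<le> w S powr (- (b * c)) - w 0 powr (- (b * c))"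
  proof (rule diff_le_of_deriv_le[where f = "\<lambda>s. C * s powr (c + 1)" and g = "\<lambda>s. w s powr (- (b * c))"
        and f' = "\<lambda>s. C * ((c + 1) * s powr c)" and g' = "\<lambda>s. - (b * c) * w s powr (- (b * c) - 1) * spow c (F s)"])
    show "continuous_on {0..S} (\<lambda>s. C * s powr (c + 1))"
      by (intro continuous_intros continuous_on_powr') (use c_pos in auto)
    show "continuous_on {0..S} (\<lambda>s. w s powr (- (b * c)))"
      by (intro continuous_on_powr' continuous_on_w continuous_intros) (use wpos in \<open>auto simp: less_imp_le less_imp_neq[symmetric]\<close>)
    fix s assume s: "0 < s" "s < S"
    have ws: "0 < w s" using wpos[of s] s by simp
    have "((\<lambda>s. s powr (c + 1)) has_real_derivative (c + 1) * s powr (c + 1 - 1)) (at s)"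
      using s(1) by (rule has_real_derivative_powr)
    then show "((\<lambda>s. C * s powr (c + 1)) has_real_derivative C * ((c + 1) * s powr c)) (at s)"
      by (intro DERIV_cmult) simp
    show "((\<lambda>s. w s powr (- (b * c))) has_real_derivative - (b * c) * w s powr (- (b * c) - 1) * spow c (F s)) (at s)"
      using DERIV_fun_powr[OF w_deriv_c[OF s(1)] ws, of "- (b * c)"] by simp
    \<comment> \<open>The inequality \<open>y < w S\<close> that is to be refuted lets the
      \<open>\<epsilon>\<close> term be absorbed, since \<open>small\<close> compares that term with
      \<open>y^q\<close>.\<close>
    have yq: "y powr q \<le> w s powr q" using wS[of s] s neg assms(5) q_gt by (intro powr_mono2) auto
    have cancel: "k * A * (B * X * Y) = k * X * Y" if "A * B = 1" for k A B X Y :: real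
    proof -
      have "k * A * (B * X * Y) = k * (A * B) * X * Y" by (simp only: mult_ac)
      then show ?thesis by (simp add: that)
    qed
    have halve: "Y \<le> f" if "X \<le> E + f" "E \<le> Y" "X = Y + Y" for X Y E f :: real
      using that by linarith
    have "w s powr q / ?N * (s ^ (n + 1) - 0 ^ (n + 1)) \<le> (\<epsilon> * V * s ^ (n + 2) - s ^ n * F s) - (\<epsilon> * V * 0 ^ (n + 2) - 0 ^ n * F 0)"
    proof (rule flux_lower)
      fix t assume t: "0 < t" "t < s"
      have "w s \<le> w t" using w_antimono[of t s] t nonneg by (simp add: less_imp_le)
      then show "w s powr q \<le> spow q (w t)" using ws q_gt by (simp add: spow_nonneg_eq powr_mono2)
    qed (use s in auto)
    then have "s ^ n * (w s powr q / ?N * s) \<le> s ^ n * (\<epsilon> * V * s * s - F s)" by (simp add: F_0 algebra_simps)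
    then have "w s powr q / ?N * s \<le> \<epsilon> * V * s * s - F s"
      by (rule mult_left_le_imp_le[OF _ zero_less_power[OF s(1)]])
    then have "w s powr q / ?N * s \<le> \<epsilon> * V * s * s + - F s" by simp
    moreover have "\<epsilon> * V * s * s \<le> w s powr q / (2 * ?N) * s"
    proof -
      have "2 * ?N * (\<epsilon> * V * s) \<le> 2 * ?N * (\<epsilon> * V * S)"
        using s V0 eps_pos by (intro mult_left_mono) auto
      also have "\<dots> \<le> w s powr q" using small yq by (simp only: mult.assoc)
      finally have "\<epsilon> * V * s \<le> w s powr q / (2 * ?N)" by (simp add: pos_le_divide_eq mult_ac)
      then show ?thesis using s(1) by (intro mult_right_mono) auto
    qed
    moreover have "w s powr q / ?N * s = w s powr q / (2 * ?N) * s + w s powr q / (2 * ?N) * s"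
    proof -
      have "Y / (2 * M) + Y / (2 * M) = Y / M" for Y M :: real by (simp flip: add_divide_distrib)
      then show ?thesis by (simp only: distrib_right[symmetric])
    qed
    ultimately have "w s powr q / (2 * ?N) * s \<le> - F s"
      by (rule halve)
    moreover have "w s powr (m + b) \<le> w s powr q" using ws wle[of s] s assms(3) by (intro powr_mono') auto
    then have "w s powr (m + b) / (2 * ?N) * s \<le> w s powr q / (2 * ?N) * s"
      using s by (intro mult_right_mono divide_right_mono) auto
    ultimately have "w s powr (m + b) / (2 * ?N) * s \<le> - F s" by simp
    then have "(w s powr (m + b) / (2 * ?N) * s) powr c \<le> (- F s) powr c"
      using ws s c_pos by (intro powr_mono2) auto
    also have "\<dots> = - spow c (F s)" using F_nonpos[of s] nonneg s by (simp add: spow_neg_eq)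
    also have "(w s powr (m + b) / (2 * ?N) * s) powr c = w s powr (1 + b * c) * (2 * ?N) powr (- c) * s powr c"
      using ws s mc by (simp add: powr_mult powr_divide powr_powr distrib_right powr_minus_divide)
    finally have "b * c * w s powr (- (b * c) - 1) * (w s powr (1 + b * c) * (2 * ?N) powr (- c) * s powr c)
        \<le> b * c * w s powr (- (b * c) - 1) * - spow c (F s)"
      using bc by (intro mult_left_mono) auto
    note ge = this
    have inv: "w s powr (- (b * c) - 1) * w s powr (1 + b * c) = 1" using ws by (simp flip: powr_add)
    have "C * ((c + 1) * s powr c) = b * c * (2 * ?N) powr (- c) * s powr c"
      using c_pos by (simp add: C_def)
    also have "\<dots> = b * c * w s powr (- (b * c) - 1) * (w s powr (1 + b * c) * (2 * ?N) powr (- c) * s powr c)"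
      by (rule cancel[OF inv, symmetric])
    also note ge
    finally show "C * ((c + 1) * s powr c) \<le> - (b * c) * w s powr (- (b * c) - 1) * spow c (F s)"
      by (simp only: mult_minus_left mult_minus_right)
  qed (use assms(4) in auto)
  then have le: "C * S powr (c + 1) \<le> w S powr (- (b * c))" using c_pos by (simp add: w_0 assms(1))
  have "y powr (- (b * c)) = C * S powr (c + 1)"
    unfolding y powr_powr C_def[symmetric] using assms(2) c_pos C assms(4) by simp
  moreover have "w S powr (- (b * c)) < y powr (- (b * c))"
    using neg assms(5) bc by (intro powr_less_mono2_neg) auto
  ultimately show False using le by simp
qed

text \<open>Up to \<open>s0\<close>, where \<open>w \<ge> 1 / 2\<close>, the functional gains a
  fixed positive amount, and its Lane--Emden part never decreases afterwards. The
  \<open>\<epsilon>\<close> terms cost at most \<open>\<epsilon> D\<close> per unit of length: the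
  mixed products of \<open>w\<close> and \<open>w'\<close> have a favourable sign.\<close>

lemma pohozaev_lower:
  assumes "a = 1" "0 < s0" "V * s0 \<le> 1 / 2" "s0 \<le> \<xi>" "\<xi> \<le> R" and mn: "m < real n"
    and c0: "c0 = (real n + 1) / (q + 1) - (real n - m) / (m + 1)" "0 < c0"
    and D: "D = R ^ (n + 2) * V\<^sup>2 + (real n - m) / (m + 1) * R ^ n * \<alpha>"
  shows "c0 * (1 / 2) powr (q + 1) * s0 ^ (n + 1) / (real n + 1) - \<epsilon> * D * \<xi> \<le> pohozaev \<xi>"
proof -
  let ?N = "real n + 1"
  define \<kappa> where "\<kappa> = (real n - m) / (m + 1)"
  have \<kappa>: "0 < \<kappa>" using mn m_pos by (simp add: \<kappa>_def)
  have V0: "0 \<le> V" using V[of 0] by simp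
  define P' where "P' s = c0 * (s ^ n * w s powr (q + 1))
     - \<epsilon> * (s * spow c (F s) + \<alpha> * w s) * (s ^ (n + 1) * spow c (F s) + \<kappa> * (s ^ n * w s))" for s
  have P_deriv: "(pohozaev has_real_derivative P' s) (at s)" if "0 < s" for s
    using pohozaev_deriv[OF that] by (simp only: P'_def c0(1) \<kappa>_def)
  have lower: "c0 * (s ^ n * w s powr (q + 1)) - \<epsilon> * D \<le> P' s" if s: "0 < s" "s \<le> R" for s
  proof -
    define g where "g = - spow c (F s)"
    have g: "0 \<le> g" "g \<le> V" using V[of s] F_nonpos[of s] nonneg s by (auto simp: g_def abs_le_iff)
    have w: "0 \<le> w s" "w s \<le> 1" using nonneg[of s] w_le_a[of s] s assms(1) by auto
    have "(s * spow c (F s) + \<alpha> * w s) * (s ^ (n + 1) * spow c (F s) + \<kappa> * (s ^ n * w s))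
      = s ^ (n + 2) * g\<^sup>2 + \<kappa> * s ^ n * (\<alpha> * (w s)\<^sup>2) - (\<alpha> * w s * s ^ (n + 1) * g + s * g * \<kappa> * s ^ n * w s)"
      by (simp add: g_def algebra_simps power2_eq_square)
    also have "\<dots> \<le> s ^ (n + 2) * g\<^sup>2 + \<kappa> * s ^ n * (\<alpha> * (w s)\<^sup>2)"
    proof -
      have "0 \<le> \<alpha> * w s * s ^ (n + 1) * g" "0 \<le> s * g * \<kappa> * s ^ n * w s"
        using s g w \<kappa> alpha_pos by auto
      then show ?thesis by linarith
    qed
    also have "\<dots> \<le> R ^ (n + 2) * V\<^sup>2 + \<kappa> * R ^ n * (\<alpha> * 1)"
    proof (intro add_mono mult_mono power_mono)
      show "(w s)\<^sup>2 \<le> 1" using w by (simp add: power_le_one)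
    qed (use s g w \<kappa> alpha_pos in auto)
    also have "\<dots> = D" by (simp add: D \<kappa>_def)
    finally have "\<epsilon> * ((s * spow c (F s) + \<alpha> * w s) * (s ^ (n + 1) * spow c (F s) + \<kappa> * (s ^ n * w s))) \<le> \<epsilon> * D"
      using eps_pos by (intro mult_left_mono) auto
    then show ?thesis by (simp add: P'_def mult.assoc)
  qed
  have cont: "continuous_on {x..y} pohozaev" if "0 \<le> x" for x y
    unfolding pohozaev_def spow_mult_self[symmetric]
    using that c_pos q_gt by (intro continuous_intros continuous_on_spow_comp continuous_on_w continuous_on_F) auto
  define k where "k = c0 * (1 / 2) powr (q + 1)"
  have D1: "((\<lambda>s. k / ?N * s ^ (n + 1) - \<epsilon> * D * s) has_real_derivative k * s ^ n - \<epsilon> * D) (at s)" for s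
    by (rule derivative_eq_intros refl)+ (simp add: field_simps)
  have "(\<lambda>s. k / ?N * s ^ (n + 1) - \<epsilon> * D * s) s0 - (\<lambda>s. k / ?N * s ^ (n + 1) - \<epsilon> * D * s) 0 \<le> pohozaev s0 - pohozaev 0"
  proof (rule diff_le_of_deriv_le[where f = "\<lambda>s. k / ?N * s ^ (n + 1) - \<epsilon> * D * s" and g = pohozaev and g' = P', OF _ _ cont D1 P_deriv])
    fix s assume s: "0 < s" "s < s0"
    have "V * s \<le> V * s0" using s V0 by (intro mult_left_mono) auto
    then have "1 / 2 \<le> w s" using w_ge_near_0[OF V, of s] s assms by simp
    then have "(1 / 2) powr (q + 1) \<le> w s powr (q + 1)" using q_gt by (intro powr_mono2) auto
    then have "c0 * (s ^ n * (1 / 2) powr (q + 1)) \<le> c0 * (s ^ n * w s powr (q + 1))"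
      using s c0 by (intro mult_left_mono) auto
    then show "k * s ^ n - \<epsilon> * D \<le> P' s" using lower[of s] s assms(4,5) by (simp add: k_def mult_ac)
  qed (use assms in \<open>auto intro!: continuous_intros\<close>)
  then have 1: "k / ?N * s0 ^ (n + 1) - \<epsilon> * D * s0 \<le> pohozaev s0" by (simp add: pohozaev_def F_0)
  have "(- (\<epsilon> * D)) * \<xi> - (- (\<epsilon> * D)) * s0 \<le> pohozaev \<xi> - pohozaev s0"
  proof (rule diff_le_of_deriv_le[where f = "\<lambda>s. (- (\<epsilon> * D)) * s" and g = pohozaev and f' = "\<lambda>_. - (\<epsilon> * D)" and g' = P', OF _ _ cont _ P_deriv])
    fix s assume s: "s0 < s" "s < \<xi>"
    have "0 \<le> c0 * (s ^ n * w s powr (q + 1))" using s assms(2) c0 by simp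
    then show "- (\<epsilon> * D) \<le> P' s" using lower[of s] s assms(2,5) by linarith
  qed (use assms in \<open>auto intro!: continuous_intros derivative_eq_intros\<close>)
  with 1 have "k / ?N * s0 ^ (n + 1) - \<epsilon> * D * \<xi> \<le> pohozaev \<xi>" by (simp add: algebra_simps)
  then show ?thesis by (simp add: k_def)
qed

text \<open>Since \<open>F \<xi> \<le> 0 \<le> w \<xi>\<close>, the last term of the functional is
  nonpositive, and only the sizes of \<open>w\<close> and \<open>w'\<close> at \<open>\<xi>\<close>
  remain.\<close>

lemma pohozaev_upper:
  assumes "0 < S" "S \<le> \<xi>" "\<xi> \<le> 2 * S" "w S \<le> y" "\<bar>spow c (F \<xi>)\<bar> \<le> y / S" "m < real n"
  shows "pohozaev \<xi> \<le> (2 * S) ^ (n + 1) * ((y / S) powr (m + 1) + y powr (q + 1))"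
proof -
  have \<xi>0: "0 < \<xi>" using assms by simp
  have w: "0 \<le> w \<xi>" "w \<xi> \<le> y"
    using nonneg[of \<xi>] w_antimono[of S \<xi>] nonneg assms by (auto simp: less_imp_le)
  have Fn: "F \<xi> \<le> 0" using F_nonpos[of \<xi>] nonneg \<xi>0 by simp
  have "c * (m + 1) = c + 1" using m_pos by (simp add: c_def field_simps)
  then have "\<bar>F \<xi>\<bar> powr (c + 1) = \<bar>spow c (F \<xi>)\<bar> powr (m + 1)"
    by (simp add: abs_spow powr_powr)
  also have "\<dots> \<le> (y / S) powr (m + 1)" using assms(5) m_pos by (intro powr_mono2) auto
  finally have 1: "\<bar>F \<xi>\<bar> powr (c + 1) \<le> (y / S) powr (m + 1)" .
  have 2: "\<bar>w \<xi>\<bar> powr (q + 1) \<le> y powr (q + 1)" using w q_gt by (intro powr_mono2) auto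
  have "1 / (c + 1) * \<bar>F \<xi>\<bar> powr (c + 1) \<le> 1 * (y / S) powr (m + 1)"
    using 1 c_pos by (intro mult_mono) auto
  moreover have "1 / (q + 1) * \<bar>w \<xi>\<bar> powr (q + 1) \<le> 1 * y powr (q + 1)"
    using 2 q_gt by (intro mult_mono) auto
  ultimately have sum: "1 / (c + 1) * \<bar>F \<xi>\<bar> powr (c + 1) + 1 / (q + 1) * \<bar>w \<xi>\<bar> powr (q + 1)
      \<le> (y / S) powr (m + 1) + y powr (q + 1)" by simp
  have "(real n - m) / (m + 1) * (w \<xi> * (\<xi> ^ n * F \<xi>)) \<le> 0"
    using Fn w \<xi>0 assms(6) m_pos by (intro mult_nonneg_nonpos) auto
  then have "pohozaev \<xi> \<le> \<xi> ^ (n + 1) * (1 / (c + 1) * \<bar>F \<xi>\<bar> powr (c + 1) + 1 / (q + 1) * \<bar>w \<xi>\<bar> powr (q + 1))"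
    unfolding pohozaev_def by (simp only: add_le_same_cancel1)
  also have "\<dots> \<le> (2 * S) ^ (n + 1) * ((y / S) powr (m + 1) + y powr (q + 1))"
    using sum assms \<xi>0 c_pos q_gt by (intro mult_mono power_mono) auto
  finally show ?thesis .
qed

end

end

section \<open>Choice of the radius and of the size of \<open>\<epsilon>\<close>\<close>

lemma tendsto_power_decay:
  fixes A e :: real and n :: nat
  assumes "real n < e"
  shows "((\<lambda>S. A * S ^ n * S powr (- e)) \<longlongrightarrow> 0) at_top"
proof -
  have "((\<lambda>S. A * S powr (- (e - real n))) \<longlongrightarrow> A * 0) at_top"
    by (intro tendsto_mult tendsto_const tendsto_neg_powr filterlim_ident) (use assms in simp)
  then have "((\<lambda>S. A * S powr (- (e - real n))) \<longlongrightarrow> 0) at_top" by simp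
  moreover have "\<forall>\<^sub>F S in at_top. A * S powr (- (e - real n)) = A * S ^ n * S powr (- e)"
    using eventually_gt_at_top[of 0]
    by eventually_elim (simp add: powr_diff powr_minus_divide powr_realpow)
  ultimately show ?thesis by (rule Lim_transform_eventually)
qed

text \<open>For \<open>w\<close> of order \<open>S^(-(m+1)/b)\<close> and \<open>w'\<close> smaller
  by a factor \<open>1 / S\<close>, the two conditions on \<open>b\<close> say that
  \<open>|w'|^(m+1)\<close> and \<open>w^(q+1)\<close> decay faster than \<open>S^(-(n+1))\<close>,
  so the upper bound for the functional tends to 0.\<close>

lemma decay_scale:
  fixes m q b C :: real and n :: nat
  assumes "0 < m" "1 < q" "0 < b" "0 < C" "0 < \<eta>"
    and b1: "b * (real n - m) < (m + 1) * (m + 1)" and b2: "b * (real n + 1) < (m + 1) * (q + 1)"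
  obtains S where "1 \<le> S"
    "(2 * S) ^ (n + 1) * ((C * S powr (- ((m + 1) / b)) / S) powr (m + 1) + (C * S powr (- ((m + 1) / b))) powr (q + 1)) < \<eta>"
proof -
  let ?\<kappa> = "(m + 1) / b"
  have e1: "real (n + 1) < (?\<kappa> + 1) * (m + 1)"
    using b1 assms(3) by (simp add: field_simps)
  have e2: "real (n + 1) < ?\<kappa> * (q + 1)"
    using b2 assms(3) by (simp add: field_simps)
  have "((\<lambda>S. 2 ^ (n + 1) * C powr (m + 1) * S ^ (n + 1) * S powr (- ((?\<kappa> + 1) * (m + 1)))
      + 2 ^ (n + 1) * C powr (q + 1) * S ^ (n + 1) * S powr (- (?\<kappa> * (q + 1)))) \<longlongrightarrow> 0 + 0) at_top"
    by (intro tendsto_add tendsto_power_decay e1 e2)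
  then have "\<forall>\<^sub>F S in at_top. 2 ^ (n + 1) * C powr (m + 1) * S ^ (n + 1) * S powr (- ((?\<kappa> + 1) * (m + 1)))
      + 2 ^ (n + 1) * C powr (q + 1) * S ^ (n + 1) * S powr (- (?\<kappa> * (q + 1))) < \<eta>"
    by (rule order_tendstoD) (use assms(5) in simp)
  from eventually_happens'[OF _ eventually_conj[OF this eventually_ge_at_top[of 1]]]
  obtain S :: real where S: "2 ^ (n + 1) * C powr (m + 1) * S ^ (n + 1) * S powr (- ((?\<kappa> + 1) * (m + 1)))
      + 2 ^ (n + 1) * C powr (q + 1) * S ^ (n + 1) * S powr (- (?\<kappa> * (q + 1))) < \<eta>" "1 \<le> S"
    by auto
  have "C * S powr (- ?\<kappa>) / S = C * S powr (- (?\<kappa> + 1))"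
    using S(2) by (simp add: powr_diff)
  then have "(C * S powr (- ?\<kappa>) / S) powr (m + 1) = C powr (m + 1) * S powr (- ((?\<kappa> + 1) * (m + 1)))"
    using S(2) assms(4) by (simp only: powr_mult powr_powr mult_minus_left)
  moreover have "(C * S powr (- ?\<kappa>)) powr (q + 1) = C powr (q + 1) * S powr (- (?\<kappa> * (q + 1)))"
    using S(2) assms(4) by (simp add: powr_mult powr_powr)
  ultimately have "(2 * S) ^ (n + 1) * ((C * S powr (- ?\<kappa>) / S) powr (m + 1) + (C * S powr (- ?\<kappa>)) powr (q + 1))
    = 2 ^ (n + 1) * C powr (m + 1) * S ^ (n + 1) * S powr (- ((?\<kappa> + 1) * (m + 1)))
      + 2 ^ (n + 1) * C powr (q + 1) * S ^ (n + 1) * S powr (- (?\<kappa> * (q + 1)))"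
    by (simp only: power_mult_distrib algebra_simps)
  then show ?thesis using that[of S] S by simp
qed

text \<open>The slope bound has to be fixed before \<open>\<epsilon>\<close>. For
  \<open>\<epsilon> \<le> 1\<close> and \<open>w 0 = 1\<close> the initial energy is at most
  \<open>\<alpha> / 2 + 1\<close>, whatever the solution.\<close>

lemma exists_velocity_bound:
  assumes "0 < m" "0 < \<alpha>" "1 < q"
  obtains V where "1 \<le> V"
    "\<And>\<epsilon> w F s. radial_sol n m \<alpha> q \<epsilon> 1 w F \<Longrightarrow> \<epsilon> \<le> 1 \<Longrightarrow> 0 \<le> s \<Longrightarrow> \<bar>spow (1 / m) (F s)\<bar> \<le> V"
proof -
  define mi where "mi = 1 / m"
  have mi: "0 < mi" using assms by (simp add: mi_def)
  define \<Phi> where "\<Phi> = ((mi + 1) * (\<alpha> / 2 + 1)) powr (1 / (mi + 1))"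
  have \<Phi>: "0 \<le> \<Phi>" "\<alpha> / 2 + 1 \<le> 1 / (mi + 1) * \<Phi> powr (mi + 1)"
    using assms mi by (auto simp: \<Phi>_def powr_powr)
  show ?thesis
  proof (rule that[of "\<Phi> powr mi + 1"])
    fix \<epsilon> w F and s :: real
    assume "radial_sol n m \<alpha> q \<epsilon> 1 w F" and e: "\<epsilon> \<le> 1" and s: "0 \<le> s"
    then interpret radial_sol n m \<alpha> q \<epsilon> 1 w F by simp
    have cc: "c = mi" by (simp add: mi_def c_def)
    have "\<epsilon> * \<alpha> \<le> 1 * \<alpha>" using e alpha_pos by (intro mult_right_mono) auto
    moreover have "1 / (q + 1) \<le> 1" using q_gt by simp
    ultimately have "energy 0 \<le> \<alpha> / 2 + 1" unfolding energy_0 by simp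
    then have "\<bar>F s\<bar> \<le> \<Phi>" using \<Phi> s unfolding cc[symmetric] by (intro F_abs_le) auto
    then have "\<bar>F s\<bar> powr mi \<le> \<Phi> powr mi" using mi by (intro powr_mono2) auto
    then show "\<bar>spow (1 / m) (F s)\<bar> \<le> \<Phi> powr mi + 1" by (simp add: abs_spow mi_def)
  qed simp
qed

text \<open>If \<open>n \<le> m\<close>, the flux argument suffices. Otherwise a nonnegative
  solution would make the Pohozaev functional at some \<open>\<xi>\<close> at least \<open>k\<close>
  up to an error of order \<open>\<epsilon>\<close>, by its gain near 0, and less than
  \<open>k / 2\<close>, by the decay of \<open>w\<close>. The radius \<open>S\<close> depends
  neither on \<open>\<epsilon>\<close> nor on the solution, so \<open>\<epsilon>0\<close> can be
  chosen last.\<close>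

lemma changes_sign_small_eps:
  assumes "0 < m" "0 < \<alpha>" "1 < q" and sub: "m < real n \<Longrightarrow> q * (real n - m) < real n * m + 2 * m + 1"
  obtains \<epsilon>0 where "0 < \<epsilon>0"
    "\<And>\<epsilon> w F. radial_sol n m \<alpha> q \<epsilon> 1 w F \<Longrightarrow> \<epsilon> < \<epsilon>0 \<Longrightarrow> \<exists>s\<ge>0. w s < 0"
proof -
  define mi where "mi = 1 / m"
  have mi: "0 < mi" using assms by (simp add: mi_def)
  obtain V where V1: "1 \<le> V" and V: "\<And>\<epsilon> w F s. radial_sol n m \<alpha> q \<epsilon> 1 w F \<Longrightarrow> \<epsilon> \<le> 1 \<Longrightarrow> 0 \<le> s \<Longrightarrow> \<bar>spow mi (F s)\<bar> \<le> V"
    using exists_velocity_bound[OF assms(1-3)] unfolding mi_def by blast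
  define s0 where "s0 = 1 / (2 * V)"
  have s0: "0 < s0" "s0 \<le> 1" "V * s0 \<le> 1 / 2" using V1 by (auto simp: s0_def)
  show ?thesis
  proof (cases "m < real n")
    case False
    define K where "K = (1 / 2) powr q * s0 ^ (n + 1) / (real n + 1) / 2"
    define S where "S = exp (2 / K powr mi)"
    have K: "0 < K" using s0 by (simp add: K_def)
    have S: "0 < S" by (simp add: S_def)
    show ?thesis
    proof (rule that[of "min 1 (K / (V * S ^ (n + 2)))"])
      show "0 < min 1 (K / (V * S ^ (n + 2)))" using K S V1 by simp
      fix \<epsilon> w F assume sol: "radial_sol n m \<alpha> q \<epsilon> 1 w F" and e: "\<epsilon> < min 1 (K / (V * S ^ (n + 2)))"
      show "\<exists>s\<ge>0. w s < 0"
      proof (rule ccontr)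
        assume "\<not> (\<exists>s\<ge>0. w s < 0)"
        then have nonneg: "\<And>s. 0 \<le> s \<Longrightarrow> 0 \<le> w s" by (meson not_le)
        interpret radial_sol n m \<alpha> q \<epsilon> 1 w F by (rule sol)
        have cc: "c = mi" by (simp add: mi_def c_def)
        have Vb: "\<bar>spow c (F s)\<bar> \<le> V" if "0 \<le> s" for s
          unfolding cc by (rule V[OF sol _ that]) (use e in simp)
        have "\<epsilon> < K / (V * S ^ (n + 2))" using e by simp
        then have "\<epsilon> * V * S ^ (n + 2) \<le> K"
          using V1 S by (simp add: pos_less_divide_eq mult.assoc less_imp_le)
        then show False
          by (intro changes_sign_low_dimension[OF Vb nonneg refl s0 _ K_def S_def[folded cc]]) (use False in auto)
      qed
    qed
  next
    case True
    \<comment> \<open>For \<open>b = q - m\<close> both conditions of \<open>decay_scale\<close> are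
      equivalent to the subcritical inequality; for \<open>q \<le> m\<close> any sufficiently small
      \<open>b\<close> will do.\<close>
    define b where "b = (if m < q then q - m else 1 / (real n + 1))"
    have b: "0 < b" "q \<le> m + b" by (auto simp: b_def add_increasing2)
    have b1: "b * (real n - m) < (m + 1) * (m + 1)"
    proof (cases "m < q")
      case True
      then show ?thesis using sub[OF \<open>m < real n\<close>] by (simp add: b_def algebra_simps)
    next
      case False
      have "1 < (m + 1) * (m + 1)" using assms(1) by (simp add: less_1_mult)
      moreover have "(real n - m) / (real n + 1) < 1" using assms(1) by simp
      moreover have "b * (real n - m) = (real n - m) / (real n + 1)" using False by (simp add: b_def)
      ultimately show ?thesis by linarith
    qed
    have b2: "b * (real n + 1) < (m + 1) * (q + 1)"
    proof (cases "m < q")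
      case True
      then show ?thesis using sub[OF \<open>m < real n\<close>] by (simp add: b_def algebra_simps)
    next
      case False
      have "1 < (m + 1) * (q + 1)" using assms(1,3) by (simp add: less_1_mult)
      then show ?thesis using False by (simp add: b_def)
    qed
    define c0 where "c0 = (real n + 1) / (q + 1) - (real n - m) / (m + 1)"
    have c0: "0 < c0"
    proof -
      have "(real n - m) * (q + 1) < (real n + 1) * (m + 1)"
        using sub[OF True] by (simp add: algebra_simps)
      then have "real n - m < (real n + 1) * (m + 1) / (q + 1)" using assms(3) by (simp add: pos_less_divide_eq)
      then have "real n - m < (real n + 1) / (q + 1) * (m + 1)" by simp
      then have "(real n - m) / (m + 1) < (real n + 1) / (q + 1)" using assms(1) by (simp only: pos_divide_less_eq)
      then show ?thesis by (simp add: c0_def)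
    qed
    define k where "k = c0 * (1 / 2) powr (q + 1) * s0 ^ (n + 1) / (real n + 1)"
    have k: "0 < k" using c0 s0 by (simp add: k_def)
    define C2 where "C2 = b * mi * (2 * (real n + 1)) powr (- mi) / (mi + 1)"
    have C2: "0 < C2" using b mi by (simp add: C2_def)
    define C where "C = C2 powr (- (1 / (b * mi)))"
    have C: "0 < C" using C2 by (simp add: C_def)
    obtain S where S: "1 \<le> S" and Sb: "(2 * S) ^ (n + 1) * ((C * S powr (- ((m + 1) / b)) / S) powr (m + 1)
        + (C * S powr (- ((m + 1) / b))) powr (q + 1)) < k / 2"
      using decay_scale[OF assms(1,3) b(1) C _ b1 b2, of "k / 2"] k by auto
    define y where "y = C * S powr (- ((m + 1) / b))"
    have y0: "0 < y" using C S by (simp add: y_def)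
    have cm: "(mi + 1) / (b * mi) = (m + 1) / b" using assms(1) b by (simp add: mi_def field_simps)
    have y: "y = (C2 * S powr (mi + 1)) powr (- (1 / (b * mi)))"
      using C2 S cm by (simp add: y_def C_def powr_mult powr_powr)
    define D where "D = (2 * S) ^ (n + 2) * V\<^sup>2 + (real n - m) / (m + 1) * (2 * S) ^ n * \<alpha>"
    have D: "0 < D" using S V1 True assms(1,2) by (simp add: D_def add_pos_nonneg)
    \<comment> \<open>In this order: validity of the slope bound \<open>V\<close>, the absorption in
      \<open>decay_at\<close>, and an error \<open>\<epsilon> D \<xi>\<close> below
      \<open>k / 2\<close> for \<open>\<xi> < 2 * S\<close>.\<close>
    define \<epsilon>0 where "\<epsilon>0 = min 1 (min (y powr q / (2 * (real n + 1) * V * S)) (k / (2 * (D * (2 * S)))))"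
    show ?thesis
    proof (rule that[of \<epsilon>0])
      show "0 < \<epsilon>0" using y0 V1 S k D by (simp add: \<epsilon>0_def)
      fix \<epsilon> w F assume sol: "radial_sol n m \<alpha> q \<epsilon> 1 w F" and e: "\<epsilon> < \<epsilon>0"
      show "\<exists>s\<ge>0. w s < 0"
      proof (rule ccontr)
        assume "\<not> (\<exists>s\<ge>0. w s < 0)"
        then have nonneg: "\<And>s. 0 \<le> s \<Longrightarrow> 0 \<le> w s" by (meson not_le)
        interpret radial_sol n m \<alpha> q \<epsilon> 1 w F by (rule sol)
        have cc: "c = mi" by (simp add: mi_def c_def)
        have Vb: "\<bar>spow c (F s)\<bar> \<le> V" if "0 \<le> s" for s
          unfolding cc by (rule V[OF sol _ that]) (use e in \<open>simp add: \<epsilon>0_def\<close>)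
        have e1: "\<epsilon> < y powr q / (2 * (real n + 1) * V * S)" "\<epsilon> < k / (2 * (D * (2 * S)))"
          using e by (auto simp: \<epsilon>0_def)
        have P: "0 < 2 * (real n + 1) * V * S" using V1 S by simp
        have small: "2 * (real n + 1) * \<epsilon> * V * S \<le> y powr q"
        proof -
          have "\<epsilon> * (2 * (real n + 1) * V * S) \<le> y powr q"
            using e1(1) P by (simp only: pos_less_divide_eq less_imp_le)
          then show ?thesis by (simp only: mult_ac)
        qed
        have wS: "w S \<le> y"
          by (rule decay_at[OF Vb nonneg refl b _ y0 y[unfolded C2_def, folded cc] small]) (use S in auto)
        \<comment> \<open>The decay of \<open>w\<close> gives no pointwise decay of
          \<open>w'\<close>, but the mean value theorem finds a point with slope at most
          \<open>w S / S\<close>, and one point is enough.\<close>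
        have "\<exists>\<xi>>S. \<xi> < 2 * S \<and> w (2 * S) - w S = (2 * S - S) * spow c (F \<xi>)"
          by (rule MVT2) (use S in \<open>auto intro: w_deriv_c\<close>)
        then obtain \<xi> where \<xi>: "S < \<xi>" "\<xi> < 2 * S" "w (2 * S) - w S = S * spow c (F \<xi>)" by auto
        have "F \<xi> \<le> 0" using F_nonpos[of \<xi>] nonneg \<xi> S by simp
        then have "\<bar>spow c (F \<xi>)\<bar> = - spow c (F \<xi>)" by simp
        also have "\<dots> \<le> y / S"
        proof -
          have "- (S * spow c (F \<xi>)) \<le> y" using \<xi>(3) wS nonneg[of "2 * S"] S by simp
          then show ?thesis using S by (simp add: pos_le_divide_eq mult.commute)
        qed
        finally have g: "\<bar>spow c (F \<xi>)\<bar> \<le> y / S" .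
        have "k - \<epsilon> * D * \<xi> \<le> pohozaev \<xi>"
          unfolding k_def
          by (rule pohozaev_lower[OF Vb nonneg refl s0(1,3) _ _ True c0_def c0 D_def]) (use \<xi> S s0 in auto)
        also have "\<dots> \<le> (2 * S) ^ (n + 1) * ((y / S) powr (m + 1) + y powr (q + 1))"
          by (rule pohozaev_upper[OF Vb nonneg _ _ _ wS g True]) (use \<xi> S in auto)
        also have "\<dots> < k / 2" using Sb by (simp only: y_def)
        finally have "k / 2 < \<epsilon> * D * \<xi>" by simp
        also have "\<dots> \<le> \<epsilon> * D * (2 * S)" using \<xi> D eps_pos by (intro mult_left_mono) auto
        also have "\<dots> < k / 2"
        proof -
          have "0 < 2 * (D * (2 * S))" using D S by simp
          then have "\<epsilon> * (2 * (D * (2 * S))) < k" using e1(2) by (simp only: pos_less_divide_eq)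
          then show ?thesis by (simp add: mult_ac)
        qed
        finally show False .
      qed
    qed
  qed
qed

text \<open>\<open>\<sigma>\<close> is determined by keeping the coefficient 1 of the power term,
  which requires \<open>(\<sigma> / a)^m \<sigma> = a^(-q)\<close>. The terms with
  \<open>\<epsilon>\<close> then carry the factor
  \<open>(\<sigma> / a)^m \<sigma> a = a^(1-q)\<close>.\<close>

lemma radial_sol_scale:
  assumes "radial_sol n m \<alpha> q 1 a w F" and \<sigma>: "\<sigma> = a powr ((m - q) / (m + 1))"
  shows "radial_sol n m \<alpha> q (a powr (1 - q)) 1 (\<lambda>s. w (\<sigma> * s) / a) (\<lambda>s. (\<sigma> / a) powr m * F (\<sigma> * s))"
proof -
  interpret radial_sol n m \<alpha> q 1 a w F by (rule assms(1))
  have s0: "0 < \<sigma>" using a_pos by (simp add: \<sigma>)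
  let ?k = "(\<sigma> / a) powr m"
  have k0: "0 < ?k" using s0 a_pos by simp
  have spow_k: "spow (1 / m) (?k * x) = \<sigma> / a * spow (1 / m) x" for x
    using s0 a_pos m_pos by (simp add: spow_mult powr_powr)
  have "\<sigma> powr (m + 1) = a powr (m - q)" using m_pos by (simp add: \<sigma> powr_powr)
  then have "\<sigma> powr m * \<sigma> = a powr (m - q)" using s0 by (simp add: powr_add)
  then have k\<sigma>: "?k * \<sigma> = a powr (- q)" using s0 a_pos by (simp add: powr_divide powr_diff powr_minus field_simps)
  have ka: "?k * \<sigma> * a = a powr (1 - q)" unfolding k\<sigma> using a_pos by (simp add: powr_diff powr_minus field_simps)
  have kq: "?k * \<sigma> * spow q (w x) = spow q (w x / a)" for x
    unfolding k\<sigma> using spow_mult[of "1 / a" q "w x"] a_pos by (simp add: powr_divide powr_minus_divide)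
  show ?thesis
  proof
    show "continuous_on {0..} (\<lambda>s. w (\<sigma> * s) / a)"
      by (intro continuous_intros continuous_on_compose2[OF cont_w]) (use s0 a_pos in auto)
    show "continuous_on {0..} (\<lambda>s. ?k * F (\<sigma> * s))"
      by (intro continuous_intros continuous_on_compose2[OF cont_F]) (use s0 in auto)
    fix r :: real assume r: "0 < r"
    then have sr: "0 < \<sigma> * r" using s0 by simp
    have D: "((\<lambda>s. \<sigma> * s) has_real_derivative \<sigma>) (at r)" by (auto intro!: derivative_eq_intros)
    have "((\<lambda>s. w (\<sigma> * s) / a) has_real_derivative spow (1 / m) (F (\<sigma> * r)) * \<sigma> / a) (at r)"
      by (intro DERIV_cdivide DERIV_chain2[OF w_deriv[OF sr] D])
    then show "((\<lambda>s. w (\<sigma> * s) / a) has_real_derivative spow (1 / m) (?k * F (\<sigma> * r))) (at r)"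
      unfolding spow_k by (simp add: mult_ac)
    define g where "g = spow (1 / m) (F (\<sigma> * r))"
    have "((\<lambda>s. ?k * F (\<sigma> * s)) has_real_derivative ?k * ((- (real n / (\<sigma> * r)) * F (\<sigma> * r)
        - 1 * (\<sigma> * r * g + \<alpha> * w (\<sigma> * r)) - spow q (w (\<sigma> * r))) * \<sigma>)) (at r)"
      unfolding g_def by (intro DERIV_cmult DERIV_chain2[OF F_deriv[OF sr] D])
    moreover have "?k * ((- (real n / (\<sigma> * r)) * F (\<sigma> * r) - 1 * (\<sigma> * r * g + \<alpha> * w (\<sigma> * r)) - spow q (w (\<sigma> * r))) * \<sigma>)
      = - (real n / (\<sigma> * r) * \<sigma>) * (?k * F (\<sigma> * r)) - (?k * \<sigma> * a) * (r * (\<sigma> / a * g) + \<alpha> * (w (\<sigma> * r) / a)) - ?k * \<sigma> * spow q (w (\<sigma> * r))"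
      using a_pos by (simp add: algebra_simps)
    moreover have "real n / (\<sigma> * r) * \<sigma> = real n / r" using s0 by simp
    ultimately show "((\<lambda>s. ?k * F (\<sigma> * s)) has_real_derivative
        - (real n / r) * (?k * F (\<sigma> * r))
        - a powr (1 - q) * (r * spow (1 / m) (?k * F (\<sigma> * r)) + \<alpha> * (w (\<sigma> * r) / a))
        - spow q (w (\<sigma> * r) / a)) (at r)"
      unfolding ka kq spow_k g_def by simp
  qed (use m_pos alpha_pos alpha_less q_gt a_pos w_0 F_0 in auto)
qed

lemma changes_sign_large:
  fixes w F :: "real \<Rightarrow> real \<Rightarrow> real"
  assumes sol: "\<And>a. 0 < a \<Longrightarrow> radial_sol n m \<alpha> q 1 a (w a) (F a)"
    and sub: "m < real n \<Longrightarrow> q * (real n - m) < real n * m + 2 * m + 1"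
  obtains a r where "0 < a" "0 \<le> r" "w a r < 0"
proof -
  interpret radial_sol n m \<alpha> q 1 1 "w 1" "F 1" by (rule sol) simp
  obtain \<epsilon>0 where \<epsilon>0: "0 < \<epsilon>0" "\<And>\<epsilon> w F. radial_sol n m \<alpha> q \<epsilon> 1 w F \<Longrightarrow> \<epsilon> < \<epsilon>0 \<Longrightarrow> \<exists>s\<ge>0. w s < 0"
    using changes_sign_small_eps[OF m_pos alpha_pos q_gt sub] by blast
  have "((\<lambda>a. a powr (1 - q)) \<longlongrightarrow> 0) at_top"
    by (rule tendsto_neg_powr) (use q_gt in \<open>auto intro: filterlim_ident\<close>)
  then have "\<forall>\<^sub>F a in at_top. a powr (1 - q) < \<epsilon>0" by (rule order_tendstoD) (rule \<epsilon>0(1))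
  from eventually_happens'[OF _ eventually_conj[OF this eventually_gt_at_top[of 0]]]
  obtain a :: real where a: "a powr (1 - q) < \<epsilon>0" "0 < a" by auto
  define \<sigma> where "\<sigma> = a powr ((m - q) / (m + 1))"
  obtain s where s: "0 \<le> s" "w a (\<sigma> * s) / a < 0"
    using \<epsilon>0(2)[OF radial_sol_scale[OF sol[OF a(2)] \<sigma>_def] a(1)] by blast
  have "w a (\<sigma> * s) < 0" using s(2) a(2) by (simp add: divide_less_0_iff)
  then show ?thesis using that[of a "\<sigma> * s"] a(2) s(1) by (simp add: \<sigma>_def)
qed

section \<open>The asymptotic system\<close>

text \<open>
  Here \<open>d\<close> stands for \<open>\<delta>\<close>, \<open>t\<close> for \<open>ln r\<close>, \<open>U\<close> for \<open>r\<^sup>\<delta> w\<close>, \<open>k\<close> for \<open>- r\<^sup>\<delta>\<^sup>-\<^sup>N J\<close>, \<open>\<beta>\<close> for \<open>N - \<alpha>\<close> and \<open>\<theta>\<close> for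
  \<open>w\<^sup>q\<^sup>-\<^sup>1\<close>.
\<close>

locale decay_system =
  fixes d N \<beta> c t0 :: real and U k \<theta> :: "real \<Rightarrow> real"
  assumes d_pos: "0 < d" and N_pos: "0 < N" and beta_pos: "0 < \<beta>" and c_gt: "1 < c"
    and U_pos: "\<And>t. t0 \<le> t \<Longrightarrow> 0 < U t" and k_pos: "\<And>t. t0 \<le> t \<Longrightarrow> 0 < k t"
    and U_deriv: "\<And>t. t0 \<le> t \<Longrightarrow> (U has_real_derivative d * U t - (U t + k t) powr c) (at t)"
    and k_deriv: "\<And>t. t0 \<le> t \<Longrightarrow> (k has_real_derivative (d - N) * k t - (\<beta> - \<theta> t) * U t) (at t)"
    and theta_nonneg: "\<And>t. t0 \<le> t \<Longrightarrow> 0 \<le> \<theta> t" and theta_less: "\<And>t. t0 \<le> t \<Longrightarrow> \<theta> t < \<beta>"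
    and theta_0: "(\<theta> \<longlongrightarrow> 0) at_top"
begin

abbreviation dU :: "real \<Rightarrow> real" where "dU t \<equiv> d * U t - (U t + k t) powr c"
abbreviation dk :: "real \<Rightarrow> real" where "dk t \<equiv> (d - N) * k t - (\<beta> - \<theta> t) * U t"

text \<open>From \<open>k > 0\<close> follows \<open>U' \<le> d U - U^c\<close>, which is
  nonpositive for \<open>U\<close> above \<open>d^(1/(c-1))\<close>.\<close>

lemma U_bounded: obtains B where "0 < B" "\<And>t. t0 \<le> t \<Longrightarrow> U t \<le> B"
proof -
  define B where "B = max (U t0) (d powr (1 / (c - 1)))"
  have "U t \<le> B" if "t0 \<le> t" for t
  proof (rule barrier_above[where Z = U, OF U_deriv _ _ that])
    fix s assume s: "t0 \<le> s" "B < U s"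
    then have "d powr (1 / (c - 1)) < U s" by (simp add: B_def)
    then have "(d powr (1 / (c - 1))) powr (c - 1) \<le> U s powr (c - 1)"
      using c_gt by (intro powr_mono2) auto
    then have "d \<le> U s powr (c - 1)" using c_gt d_pos by (simp add: powr_powr)
    then have "d * U s \<le> U s powr (c - 1) * U s" using U_pos[OF s(1)] by (intro mult_right_mono) auto
    also have "\<dots> = U s powr c" using U_pos[OF s(1)] by (simp add: powr_diff)
    also have "\<dots> \<le> (U s + k s) powr c"
      using U_pos[OF s(1)] k_pos[OF s(1)] c_gt by (intro powr_mono2) auto
    finally show "dU s \<le> 0" by simp
  qed (auto simp: B_def)
  moreover have "0 < B" using U_pos[of t0] by (simp add: B_def less_max_iff_disj)
  ultimately show ?thesis using that by blast
qed

text \<open>A large \<open>k\<close> sustains itself: as \<open>U \<le> B\<close>, the term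
  \<open>(d - N) k\<close> dominates in \<open>k'\<close>. It would also make
  \<open>(U + k)^c\<close> exceed \<open>d U\<close> by at least 1 forever and drive
  \<open>U\<close> below 0. The two entries of \<open>e\<close> are the thresholds for these two
  effects.\<close>

lemma k_bounded_above:
  assumes "N < d" obtains B where "0 < B" "\<And>t. t0 \<le> t \<Longrightarrow> k t \<le> B"
proof -
  obtain B where B: "0 < B" "\<And>t. t0 \<le> t \<Longrightarrow> U t \<le> B" using U_bounded by blast
  define e where "e = max ((\<beta> * B + 1) / (d - N)) ((d * B + 1) powr (1 / c))"
  have "k t \<le> e" if t: "t0 \<le> t" for t
  proof (rule ccontr)
    assume "\<not> k t \<le> e"
    then have kt: "e \<le> k t" by simp
    have stay: "e \<le> k s" if s: "t \<le> s" for s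
    proof (rule escape(1)[where Z = k and c = 1, OF k_deriv kt _ _ s])
      fix r assume r: "t \<le> r" "e \<le> k r"
      then have r0: "t0 \<le> r" using t by simp
      have "(\<beta> * B + 1) / (d - N) \<le> k r" using r by (simp add: e_def)
      then have "\<beta> * B + 1 \<le> (d - N) * k r" using assms by (simp add: field_simps)
      moreover have "(\<beta> - \<theta> r) * U r \<le> \<beta> * B"
        using theta_nonneg[OF r0] theta_less[OF r0] U_pos[OF r0] B(2)[OF r0] beta_pos by (intro mult_mono) auto
      ultimately show "1 \<le> dk r" by simp
    qed (use t in auto)
    show False
    proof (rule escape_unbounded[where Z = "\<lambda>s. - U s" and Z' = "\<lambda>s. - (dU s)"
          and ?t1.0 = t and e = "- U t" and c = 1 and B = 0])
      fix s assume s: "t \<le> s"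
      then have s0: "t0 \<le> s" using t by simp
      show "((\<lambda>s. - U s) has_real_derivative - (dU s)) (at s)"
        by (intro DERIV_minus U_deriv s0)
      show "- U s < 0" using U_pos[OF s0] by simp
      have "(d * B + 1) powr (1 / c) \<le> U s + k s"
        using stay[OF s] U_pos[OF s0] by (simp add: e_def)
      then have "((d * B + 1) powr (1 / c)) powr c \<le> (U s + k s) powr c"
        using c_gt by (intro powr_mono2) auto
      then have "d * B + 1 \<le> (U s + k s) powr c" using c_gt d_pos B(1) by (simp add: powr_powr)
      moreover have "d * U s \<le> d * B" using B(2)[OF s0] d_pos by simp
      ultimately show "1 \<le> - (dU s)" by simp
    qed auto
  qed
  moreover have "0 < e" using k_pos[of t0] calculation[of t0] by simp
  ultimately show ?thesis using that by blast
qed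

text \<open>
  At a critical point of \<open>U\<close> the second derivative is a negative multiple of \<open>k'\<close>, so the type of the
  extremum fixes the sign of \<open>k'\<close>. This bounds \<open>U\<close> from above at maxima and from below at minima
  by (almost) the same value.
\<close>

lemma dU_deriv:
  assumes "t0 \<le> t" "dU t = 0"
  shows "((\<lambda>t. dU t) has_real_derivative
    - (c * (U t + k t) powr (c - 1) * (dk t))) (at t)"
proof -
  have U0: "(U has_real_derivative 0) (at t)" using U_deriv[OF assms(1)] assms(2) by simp
  have pos: "0 < U t + k t" using U_pos[OF assms(1)] k_pos[OF assms(1)] by simp
  have "((\<lambda>t. (U t + k t) powr c) has_real_derivative
      c * (U t + k t) powr (c - 1) * (0 + (dk t))) (at t)"
    using DERIV_fun_powr[OF DERIV_add[OF U0 k_deriv[OF assms(1)]] pos, of c] by simp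
  from DERIV_diff[OF DERIV_cmult[OF U0, of d] this] show ?thesis by simp
qed

lemma critical_value:
  assumes "t0 \<le> t" "dU t = 0"
  shows "k t = (d powr (1 / c) * U t powr (1 / c - 1) - 1) * U t"
proof -
  have "(U t + k t) powr c = d * U t" using assms(2) by simp
  then have "((U t + k t) powr c) powr (1 / c) = (d * U t) powr (1 / c)" by simp
  then have "U t + k t = (d * U t) powr (1 / c)"
    using c_gt U_pos[OF assms(1)] k_pos[OF assms(1)] by (simp add: powr_powr)
  also have "\<dots> = d powr (1 / c) * (U t powr (1 / c - 1) * U t)"
    using U_pos[OF assms(1)] d_pos by (simp add: powr_mult powr_diff)
  finally show ?thesis by (simp add: algebra_simps)
qed

lemma local_max_bound:
  assumes "N < d" "t0 \<le> t" and crit: "dU t = 0"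
    and "0 < h" and max: "\<And>s. t < s \<Longrightarrow> s < t + h \<Longrightarrow> U s \<le> U t"
  shows "U t powr (1 - 1 / c) \<le> (d - N) * d powr (1 / c) / (d - N + \<beta> - \<theta> t)"
proof -
  let ?k' = "dk t"
  have "0 \<le> ?k'"
  proof (rule ccontr)
    assume "\<not> 0 \<le> ?k'"
    moreover have "0 < (U t + k t) powr (c - 1)"
      using U_pos[OF assms(2)] k_pos[OF assms(2)] by simp
    ultimately have "0 < - (c * (U t + k t) powr (c - 1) * ?k')"
      using c_gt by (simp add: mult_pos_neg)
    from DERIV_pos_inc_right[OF dU_deriv[OF assms(2) crit] this]
    obtain h' where h': "0 < h'" "\<And>x. 0 < x \<Longrightarrow> x < h' \<Longrightarrow> 0 < dU (t + x)"
      using crit by auto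
    define s where "s = t + min h h' / 2"
    have s: "t < s" "s < t + h" "s < t + h'" using \<open>0 < h\<close> h'(1) by (auto simp: s_def min_def)
    have "U t < U s"
    proof (rule DERIV_pos_imp_increasing_open[where f = U])
      fix x assume x: "t < x" "x < s"
      then show "\<exists>y. (U has_real_derivative y) (at x) \<and> 0 < y"
        using U_deriv[of x] h'(2)[of "x - t"] s assms(2) by (intro exI) auto
    next
      show "continuous_on {t..s} U"
        by (rule DERIV_continuous_on[OF has_field_derivative_at_within[OF U_deriv]]) (use assms(2) in auto)
    qed (use s in auto)
    then show False using max[of s] s by simp
  qed
  \<comment> \<open>Eliminating \<open>k\<close> by \<open>critical_value\<close> turns the sign of
    \<open>k'\<close> into an inequality for \<open>U t\<close> alone.\<close>
  then have "(\<beta> - \<theta> t) * U t \<le> (d - N) * (d powr (1 / c) * U t powr (1 / c - 1) - 1) * U t"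
    using critical_value[OF assms(2) crit] by simp
  then have "\<beta> - \<theta> t \<le> (d - N) * (d powr (1 / c) * U t powr (1 / c - 1) - 1)"
    using U_pos[OF assms(2)] by (simp add: mult_le_cancel_right)
  then have "d - N + \<beta> - \<theta> t \<le> (d - N) * d powr (1 / c) * U t powr (1 / c - 1)"
    by (simp add: algebra_simps)
  then have "U t powr (1 - 1 / c) * (d - N + \<beta> - \<theta> t)
      \<le> U t powr (1 - 1 / c) * ((d - N) * d powr (1 / c) * U t powr (1 / c - 1))"
    by (intro mult_left_mono) auto
  also have "\<dots> = (d - N) * d powr (1 / c) * (U t powr (1 - 1 / c) * U t powr (1 / c - 1))"
    by (simp add: algebra_simps)
  also have "U t powr (1 - 1 / c) * U t powr (1 / c - 1) = 1"
    using U_pos[OF assms(2)] by (simp add: powr_add[symmetric])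
  finally show ?thesis using assms(1) theta_less[OF assms(2)] by (simp add: pos_le_divide_eq)
qed

lemma local_min_bound:
  assumes "N < d" "t0 \<le> t" and crit: "dU t = 0"
    and "0 < h" and min: "\<And>s. t < s \<Longrightarrow> s < t + h \<Longrightarrow> U t \<le> U s"
  shows "(d - N) * d powr (1 / c) / (d - N + \<beta>) \<le> U t powr (1 - 1 / c)"
proof -
  let ?k' = "dk t"
  have "?k' \<le> 0"
  proof (rule ccontr)
    assume "\<not> ?k' \<le> 0"
    moreover have "0 < (U t + k t) powr (c - 1)"
      using U_pos[OF assms(2)] k_pos[OF assms(2)] by simp
    ultimately have "- (c * (U t + k t) powr (c - 1) * ?k') < 0"
      using c_gt by simp
    from DERIV_neg_dec_right[OF dU_deriv[OF assms(2) crit] this]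
    obtain h' where h': "0 < h'" "\<And>x. 0 < x \<Longrightarrow> x < h' \<Longrightarrow> dU (t + x) < 0"
      using crit by auto
    define s where "s = t + min h h' / 2"
    have s: "t < s" "s < t + h" "s < t + h'" using \<open>0 < h\<close> h'(1) by (auto simp: s_def min_def)
    have "U s < U t"
    proof (rule DERIV_neg_imp_decreasing_open[where f = U])
      fix x assume x: "t < x" "x < s"
      then show "\<exists>y. (U has_real_derivative y) (at x) \<and> y < 0"
        using U_deriv[of x] h'(2)[of "x - t"] s assms(2) by (intro exI) auto
    next
      show "continuous_on {t..s} U"
        by (rule DERIV_continuous_on[OF has_field_derivative_at_within[OF U_deriv]]) (use assms(2) in auto)
    qed (use s in auto)
    then show False using min[of s] s by simp
  qed
  then have "(d - N) * (d powr (1 / c) * U t powr (1 / c - 1) - 1) * U t \<le> (\<beta> - \<theta> t) * U t"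
    using critical_value[OF assms(2) crit] by simp
  then have "(d - N) * (d powr (1 / c) * U t powr (1 / c - 1) - 1) \<le> \<beta> - \<theta> t"
    using U_pos[OF assms(2)] by (simp add: mult_le_cancel_right)
  then have "(d - N) * d powr (1 / c) * U t powr (1 / c - 1) \<le> d - N + \<beta>"
    using theta_nonneg[OF assms(2)] by (simp add: algebra_simps)
  then have "U t powr (1 - 1 / c) * ((d - N) * d powr (1 / c) * U t powr (1 / c - 1))
      \<le> U t powr (1 - 1 / c) * (d - N + \<beta>)"
    by (intro mult_left_mono) auto
  moreover have "U t powr (1 - 1 / c) * ((d - N) * d powr (1 / c) * U t powr (1 / c - 1))
      = (d - N) * d powr (1 / c) * (U t powr (1 - 1 / c) * U t powr (1 / c - 1))"
    by (simp add: algebra_simps)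
  moreover have "U t powr (1 - 1 / c) * U t powr (1 / c - 1) = 1"
    using U_pos[OF assms(2)] by (simp add: powr_add[symmetric])
  ultimately show ?thesis using assms(1) beta_pos by (simp add: pos_divide_le_eq)
qed

section \<open>Convergence in the case \<open>N < d\<close>\<close>

lemma U_continuous: "t0 \<le> x \<Longrightarrow> continuous_on {x..y} U"
  by (rule DERIV_continuous_on[OF has_field_derivative_at_within[OF U_deriv]]) auto

lemma k_continuous: "t0 \<le> x \<Longrightarrow> continuous_on {x..y} k"
  by (rule DERIV_continuous_on[OF has_field_derivative_at_within[OF k_deriv]]) auto

lemma sum_powr_tendsto_0:
  assumes "(U \<longlongrightarrow> 0) at_top" "(k \<longlongrightarrow> 0) at_top"
  shows "((\<lambda>t. (U t + k t) powr (c - 1)) \<longlongrightarrow> 0) at_top"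
proof -
  have "0 \<le> U t + k t" if "t0 \<le> t" for t
    using U_pos[OF that] k_pos[OF that] by simp
  then have "((\<lambda>t. (U t + k t) powr (c - 1)) \<longlongrightarrow> (0 + 0) powr (c - 1)) at_top"
    by (intro tendsto_powr' tendsto_intros assms)
      (use c_gt in \<open>auto intro!: eventually_at_top_linorderI[of t0]\<close>)
  then show ?thesis by simp
qed

text \<open>Every late \<open>t\<close> lies between a time with \<open>U' > 0\<close> and a later
  one with \<open>U' < 0\<close>, so \<open>U t\<close> is dominated by an interior maximum, to
  which \<open>local_max_bound\<close> applies; minima are used likewise. Because
  \<open>\<theta> \<ge> 0\<close>, the lower bound is already the limit, and the upper one tends to
  it as \<open>\<theta>\<close> tends to 0.\<close>

lemma oscillating_limit:
  assumes "N < d"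
    and up: "\<And>T. \<exists>t\<ge>T. 0 < dU t"
    and down: "\<And>T. \<exists>t\<ge>T. dU t < 0"
  shows "((\<lambda>t. U t powr (1 - 1 / c)) \<longlongrightarrow> (d - N) * d powr (1 / c) / (d - N + \<beta>)) at_top"
proof (rule tendstoI)
  let ?L = "(d - N) * d powr (1 / c) / (d - N + \<beta>)"
  fix e :: real assume e: "0 < e"
  have s: "0 \<le> 1 - 1 / c" using c_gt by simp
  have "((\<lambda>t. (d - N) * d powr (1 / c) / (d - N + \<beta> - \<theta> t)) \<longlongrightarrow> (d - N) * d powr (1 / c) / (d - N + \<beta> - 0)) at_top"
    by (intro tendsto_intros theta_0) (use assms(1) beta_pos in auto)
  then have "\<forall>\<^sub>F t in at_top. (d - N) * d powr (1 / c) / (d - N + \<beta> - \<theta> t) < ?L + e"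
    by (rule order_tendstoD) (use e in simp)
  then obtain T0 where T0: "\<And>t. T0 \<le> t \<Longrightarrow> (d - N) * d powr (1 / c) / (d - N + \<beta> - \<theta> t) < ?L + e"
    by (auto simp: eventually_at_top_linorder)
  obtain ta where ta: "max T0 t0 \<le> ta" "0 < dU ta" using up by blast
  obtain tc where tc: "t0 \<le> tc" "dU tc < 0" using down by blast
  have upper: "U t powr (1 - 1 / c) < ?L + e" if t: "ta \<le> t" for t
  proof -
    obtain tb where tb: "t \<le> tb" "dU tb < 0" using down by blast
    obtain x where x: "ta < x" "x < tb" "dU x = 0" "\<And>y. ta \<le> y \<Longrightarrow> y \<le> tb \<Longrightarrow> U y \<le> U x"
      using interior_max[of ta tb U dU] U_deriv ta tb t by auto
    have "U x powr (1 - 1 / c) \<le> (d - N) * d powr (1 / c) / (d - N + \<beta> - \<theta> x)"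
      by (rule local_max_bound[OF assms(1) _ x(3), of "tb - x"]) (use x ta in auto)
    also have "\<dots> < ?L + e" using T0[of x] x ta by simp
    finally have "U x powr (1 - 1 / c) < ?L + e" .
    moreover have "U t powr (1 - 1 / c) \<le> U x powr (1 - 1 / c)"
      using s x(4)[of t] t tb U_pos[of t] ta by (intro powr_mono2) auto
    ultimately show ?thesis by simp
  qed
  have lower: "?L \<le> U t powr (1 - 1 / c)" if t: "tc \<le> t" for t
  proof -
    obtain tb where tb: "t \<le> tb" "0 < dU tb" using up by blast
    obtain x where x: "tc < x" "x < tb" "- dU x = 0" "\<And>y. tc \<le> y \<Longrightarrow> y \<le> tb \<Longrightarrow> - U y \<le> - U x"
      by (rule interior_max[of tc tb "\<lambda>t. - U t" "\<lambda>t. - dU t"]) (use DERIV_minus[OF U_deriv] tc tb t in auto)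
    have "?L \<le> U x powr (1 - 1 / c)"
      by (rule local_min_bound[OF assms(1), of x "tb - x"]) (use x tc in auto)
    also have "\<dots> \<le> U t powr (1 - 1 / c)"
      using s x(4)[of t] t tb U_pos[of x] x(1) tc by (intro powr_mono2) auto
    finally show ?thesis .
  qed
  have "dist (U t powr (1 - 1 / c)) ?L < e" if "max ta tc \<le> t" for t
    using upper[of t] lower[of t] that e by (simp add: dist_real_def)
  then show "\<forall>\<^sub>F t in at_top. dist (U t powr (1 - 1 / c)) ?L < e"
    using eventually_at_top_linorder by blast
qed

lemma derivative_limit_0:
  assumes U: "(U \<longlongrightarrow> u) at_top" and P: "((\<lambda>t. dU t) \<longlongrightarrow> P) at_top"
  shows "P = 0"
proof (rule ccontr)
  assume "P \<noteq> 0"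
  obtain B where B: "0 < B" "\<And>t. t0 \<le> t \<Longrightarrow> U t \<le> B" using U_bounded by blast
  have "\<forall>\<^sub>F t in at_top. dist (dU t) P < \<bar>P\<bar> / 2"
    using P \<open>P \<noteq> 0\<close> by (intro tendstoD) auto
  then obtain T where T: "\<And>t. T \<le> t \<Longrightarrow> \<bar>dU t - P\<bar> < \<bar>P\<bar> / 2"
    by (auto simp: eventually_at_top_linorder dist_real_def)
  define t1 where "t1 = max t0 T"
  have t1: "t0 \<le> t" "T \<le> t" if "t1 \<le> t" for t using that by (auto simp: t1_def)
  show False
  proof (cases "0 < P")
    case True
    show False
    proof (rule escape_unbounded[where Z = U and ?t1.0 = t1 and e = "U t1" and c = "P / 2" and B = "B + 1"])
      fix t assume t: "t1 \<le> t"
      show "(U has_real_derivative dU t) (at t)" by (rule U_deriv[OF t1(1)[OF t]])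
      show "U t < B + 1" using B(2)[OF t1(1)[OF t]] by simp
      show "P / 2 \<le> dU t" using T[OF t1(2)[OF t]] True by linarith
    qed (use True in auto)
  next
    case False
    show False
    proof (rule escape_unbounded[where Z = "\<lambda>t. - U t" and ?t1.0 = t1 and e = "- U t1" and c = "- P / 2" and B = 0])
      fix t assume t: "t1 \<le> t"
      show "((\<lambda>t. - U t) has_real_derivative - (dU t)) (at t)"
        by (intro DERIV_minus U_deriv[OF t1(1)[OF t]])
      show "- U t < 0" using U_pos[OF t1(1)[OF t]] by simp
      show "- P / 2 \<le> - (dU t)" using T[OF t1(2)[OF t]] False by linarith
    qed (use False \<open>P \<noteq> 0\<close> in auto)
  qed
qed

text \<open>The equation for \<open>k\<close> is unstable when \<open>N < d\<close>, so the bounded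
  \<open>k\<close> must follow \<open>U\<close>. Then \<open>U'\<close> converges as well,
  necessarily to 0, and this equilibrium equation is solved for \<open>u\<close>.\<close>

lemma convergent_limit:
  assumes "N < d" and U: "(U \<longlongrightarrow> u) at_top" and "0 \<le> u"
  shows "(k \<longlongrightarrow> \<beta> * u / (d - N)) at_top"
    and "0 < u \<Longrightarrow> u powr (1 - 1 / c) = (d - N) * d powr (1 / c) / (d - N + \<beta>)"
proof -
  obtain B where B: "0 < B" "\<And>t. t0 \<le> t \<Longrightarrow> k t \<le> B" using k_bounded_above[OF assms(1)] by blast
  have "((\<lambda>t. (\<beta> - \<theta> t) * U t) \<longlongrightarrow> (\<beta> - 0) * u) at_top"
    by (intro tendsto_intros theta_0 U)
  then have "((\<lambda>t. (\<beta> - \<theta> t) * U t) \<longlongrightarrow> \<beta> * u) at_top" by simp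
  then show k: "(k \<longlongrightarrow> \<beta> * u / (d - N)) at_top"
    by (intro bounded_solution_limit[where V = k and B = B and ?t0.0 = t0, OF k_deriv])
      (use assms(1) B(2) k_pos in \<open>auto simp: abs_of_pos\<close>)
  assume u: "0 < u"
  have sum: "u + \<beta> * u / (d - N) = (d - N + \<beta>) / (d - N) * u"
    using assms(1) by (simp add: field_simps)
  have sumpos: "0 < u + \<beta> * u / (d - N)"
    using u beta_pos assms(1) by (intro add_pos_pos) auto
  have "((\<lambda>t. dU t) \<longlongrightarrow> d * u - (u + \<beta> * u / (d - N)) powr c) at_top"
    by (intro tendsto_intros U k) (use sumpos in auto)
  from derivative_limit_0[OF U this]
  have "(u + \<beta> * u / (d - N)) powr c = d * u" by simp
  then have "((u + \<beta> * u / (d - N)) powr c) powr (1 / c) = (d * u) powr (1 / c)" by simp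
  then have "u + \<beta> * u / (d - N) = (d * u) powr (1 / c)"
    using sumpos c_gt by (simp add: powr_powr)
  then have *: "(d - N + \<beta>) / (d - N) * u = d powr (1 / c) * u powr (1 / c)"
    using sum d_pos u by (simp add: powr_mult)
  have "u powr (1 - 1 / c) = u / u powr (1 / c)" using u by (simp add: powr_diff)
  also have "\<dots> = (d - N) * d powr (1 / c) / (d - N + \<beta>)"
    using * u assms(1) beta_pos by (simp add: field_simps)
  finally show "u powr (1 - 1 / c) = (d - N) * d powr (1 / c) / (d - N + \<beta>)" .
qed

text \<open>With both components small, \<open>U' \<le> 0\<close> makes \<open>U\<close> small
  relative to \<open>k\<close>, because \<open>d U \<le> (U + k)^c \<le> e (U + k)\<close>. Then
  \<open>k' \<ge> (d - N) k / 2\<close>, and \<open>k\<close> grows without bound.\<close>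

lemma not_tendsto_0:
  assumes "N < d" and U: "(U \<longlongrightarrow> 0) at_top"
    and "t0 \<le> T" and neg: "\<And>t. T \<le> t \<Longrightarrow> dU t \<le> 0"
  shows False
proof -
  have k: "(k \<longlongrightarrow> 0) at_top" using convergent_limit(1)[OF assms(1) U] by simp
  \<comment> \<open>The first entry leaves \<open>d U / 2\<close> after \<open>e U\<close> is
    subtracted from \<open>d U\<close>; the second makes \<open>\<beta> U\<close> at most half of
    \<open>(d - N) k\<close>.\<close>
  define e where "e = min (d / 2) (d * (d - N) / (4 * \<beta>))"
  have e: "0 < e" "e \<le> d / 2" "e \<le> d * (d - N) / (4 * \<beta>)"
    using d_pos assms(1) beta_pos by (auto simp: e_def)
  have "\<forall>\<^sub>F t in at_top. (U t + k t) powr (c - 1) < e"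
    by (rule order_tendstoD(2)[OF sum_powr_tendsto_0[OF U k] e(1)])
  then obtain T1 where T1: "\<And>t. T1 \<le> t \<Longrightarrow> (U t + k t) powr (c - 1) < e"
    by (auto simp: eventually_at_top_linorder)
  define t1 where "t1 = max T T1"
  obtain B where B: "0 < B" "\<And>t. t0 \<le> t \<Longrightarrow> k t \<le> B" using k_bounded_above[OF assms(1)] by blast
  have t1: "t0 \<le> t1" using assms(3) by (simp add: t1_def)
  show False
  proof (rule escape_unbounded[where Z = k and ?t1.0 = t1 and e = "k t1" and c = "(d - N) / 2 * k t1" and B = "B + 1"])
    fix t assume "t1 \<le> t"
    then have t: "t0 \<le> t" "T \<le> t" "T1 \<le> t" using assms(3) by (auto simp: t1_def)
    show "(k has_real_derivative dk t) (at t)" by (rule k_deriv[OF t(1)])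
    show "k t < B + 1" using B(2)[OF t(1)] by simp
    assume kt: "k t1 \<le> k t"
    have pos: "0 < U t" "0 < k t" using U_pos k_pos t by auto
    have "d * U t \<le> (U t + k t) powr c" using neg[OF t(2)] by simp
    also have "\<dots> = (U t + k t) powr (c - 1) * (U t + k t)" using pos by (simp add: powr_diff)
    also have "\<dots> \<le> e * (U t + k t)" using T1[OF t(3)] pos by (intro mult_right_mono) auto
    also have "\<dots> \<le> d / 2 * U t + e * k t"
      using e(2) pos by (simp add: algebra_simps)
    finally have "U t \<le> 2 * e / d * k t" using d_pos by (simp add: field_simps)
    then have "\<beta> * U t \<le> \<beta> * (2 * e / d * k t)" using beta_pos by (intro mult_left_mono) auto
    also have "\<dots> = (2 * \<beta> / d * e) * k t" by simp
    also have "\<dots> \<le> (2 * \<beta> / d * (d * (d - N) / (4 * \<beta>))) * k t"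
      using e(3) beta_pos d_pos pos by (intro mult_right_mono mult_left_mono) auto
    also have "\<dots> = (d - N) / 2 * k t" using beta_pos d_pos by (simp add: field_simps)
    finally have "\<beta> * U t \<le> (d - N) / 2 * k t" .
    moreover have "(\<beta> - \<theta> t) * U t \<le> \<beta> * U t" using theta_nonneg[OF t(1)] pos by (intro mult_right_mono) auto
    moreover have "(d - N) / 2 * k t1 \<le> (d - N) / 2 * k t" using kt assms(1) by (intro mult_left_mono) auto
    ultimately show "(d - N) / 2 * k t1 \<le> dk t"
      by (simp add: field_simps)
  qed (use assms(1) k_pos[OF t1] in auto)
qed

text \<open>Either \<open>U'\<close> keeps changing sign, or \<open>U\<close> is eventually monotone
  and converges. A zero limit can then occur only for decreasing \<open>U\<close>, and
  \<open>not_tendsto_0\<close> excludes it.\<close>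

theorem limit_if_greater:
  assumes "N < d"
  shows "(U \<longlongrightarrow> ((d - N) * d powr (1 / c) / (d - N + \<beta>)) powr (1 / (1 - 1 / c))) at_top"
proof -
  let ?P = "\<lambda>t. dU t"
  let ?L = "(d - N) * d powr (1 / c) / (d - N + \<beta>)"
  have s: "0 < 1 - 1 / c" using c_gt by simp
  have L: "0 < ?L" using assms d_pos beta_pos by simp
  obtain B where B: "0 < B" "\<And>t. t0 \<le> t \<Longrightarrow> U t \<le> B" using U_bounded by blast
  have conv: ?thesis if u: "(U \<longlongrightarrow> u) at_top" "0 < u" for u
  proof -
    have "(u powr (1 - 1 / c)) powr (1 / (1 - 1 / c)) = u" using s u(2) c_gt by (simp add: powr_powr)
    then show ?thesis using convergent_limit(2)[OF assms u(1)] u by simp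
  qed
  consider "\<And>T. \<exists>t\<ge>T. 0 < ?P t" "\<And>T. \<exists>t\<ge>T. ?P t < 0"
    | T where "\<And>t. T \<le> t \<Longrightarrow> ?P t \<le> 0" | T where "\<And>t. T \<le> t \<Longrightarrow> 0 \<le> ?P t"
    by (meson not_le)
  then show ?thesis
  proof cases
    case 1
    have "((\<lambda>t. (U t powr (1 - 1 / c)) powr (1 / (1 - 1 / c))) \<longlongrightarrow> ?L powr (1 / (1 - 1 / c))) at_top"
      by (rule tendsto_powr[OF oscillating_limit[OF assms 1] tendsto_const]) (use L in auto)
    moreover have "\<forall>\<^sub>F t in at_top. (U t powr (1 - 1 / c)) powr (1 / (1 - 1 / c)) = U t"
      by (rule eventually_at_top_linorderI[of t0]) (use s U_pos c_gt in \<open>simp add: powr_powr less_imp_le\<close>)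
    ultimately show ?thesis by (rule Lim_transform_eventually)
  next
    case (2 T)
    have anti: "U y \<le> U x" if "max T t0 \<le> x" "x \<le> y" for x y
    proof -
      have "- U x \<le> - U y"
      proof (rule le_of_deriv_nonneg[where f = "\<lambda>t. - U t" and f' = "\<lambda>t. - ?P t"])
        show "((\<lambda>t. - U t) has_real_derivative - ?P s) (at s)" if "x < s" "s < y" for s
          using that \<open>max T t0 \<le> x\<close> by (intro DERIV_minus U_deriv) simp
      qed (use that 2 in \<open>auto intro!: continuous_intros U_continuous\<close>)
      then show ?thesis by simp
    qed
    obtain u where u: "0 \<le> u" "(U \<longlongrightarrow> u) at_top"
      using antimono_limit[of "max T t0" U 0] anti U_pos by (metis less_imp_le max.bounded_iff)
    have "u \<noteq> 0" using not_tendsto_0[OF assms, of "max T t0"] u(2) 2 by auto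
    then show ?thesis using conv u by simp
  next
    case (3 T)
    have mono: "U x \<le> U y" if "max T t0 \<le> x" "x \<le> y" for x y
      by (rule le_of_deriv_nonneg[where f = U and f' = ?P])
        (use that 3 in \<open>auto intro!: U_continuous U_deriv\<close>)
    obtain v where v: "((\<lambda>t. - U t) \<longlongrightarrow> v) at_top" "\<And>x. max T t0 \<le> x \<Longrightarrow> v \<le> - U x"
      using antimono_limit[of "max T t0" "\<lambda>t. - U t" "- B"] mono B(2) by (metis max.bounded_iff neg_le_iff_le)
    have "(U \<longlongrightarrow> - v) at_top" using tendsto_minus[OF v(1)] by simp
    moreover have "0 < - v" using v(2)[of "max T t0"] U_pos[of "max T t0"] by simp
    ultimately show ?thesis using conv by blast
  qed
qed

section \<open>The case \<open>d \<le> N\<close>: decay of both components\<close>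

lemma k_antimono:
  assumes "d \<le> N" "t0 \<le> x" "x \<le> y" shows "k y \<le> k x"
proof -
  have "- k x \<le> - k y"
  proof (rule le_of_deriv_nonneg[where f = "\<lambda>t. - k t" and f' = "\<lambda>t. - (dk t)"])
    fix t assume "x < t"
    then have t: "t0 \<le> t" using assms by simp
    show "((\<lambda>t. - k t) has_real_derivative - (dk t)) (at t)"
      by (intro DERIV_minus k_deriv t)
    have "(d - N) * k t \<le> 0" using assms(1) k_pos[OF t] by (simp add: mult_le_0_iff)
    moreover have "0 \<le> (\<beta> - \<theta> t) * U t" using theta_less[OF t] U_pos[OF t] by simp
    ultimately show "0 \<le> - (dk t)" by linarith
  qed (use assms in \<open>auto intro!: continuous_intros k_continuous\<close>)
  then show ?thesis by simp
qed

text \<open>\<open>k\<close> decreases to a limit, so late losses of a fixed size are impossible.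
  But \<open>U' \<ge> - C\<close> keeps \<open>U \<ge> e / 2\<close> for a time \<open>h\<close>
  after \<open>U t \<ge> e\<close>, and meanwhile \<open>k\<close> loses at least
  \<open>G * h\<close>.\<close>

lemma U_tendsto_0:
  assumes "d \<le> N" shows "(U \<longlongrightarrow> 0) at_top"
proof (rule tendstoI)
  fix e :: real assume e: "0 < e"
  obtain B where B: "0 < B" "\<And>t. t0 \<le> t \<Longrightarrow> U t \<le> B" using U_bounded by blast
  obtain \<kappa> where \<kappa>: "(k \<longlongrightarrow> \<kappa>) at_top" "\<And>t. t0 \<le> t \<Longrightarrow> \<kappa> \<le> k t"
    using antimono_limit[of t0 k 0] k_antimono[OF assms] k_pos by (metis less_imp_le)
  define C where "C = d * B + (B + k t0) powr c"
  have C: "0 < C" using d_pos B(1) by (simp add: C_def add_pos_nonneg)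
  define h where "h = e / (2 * C)"
  have h: "0 < h" "C * h = e / 2" using e C by (auto simp: h_def)
  have "\<forall>\<^sub>F t in at_top. k t < \<kappa> + \<beta> / 2 * (e / 2) * h"
    using \<kappa>(1) by (rule order_tendstoD) (use beta_pos e h in auto)
  moreover have "\<forall>\<^sub>F t in at_top. \<theta> t < \<beta> / 2"
    using theta_0 by (rule order_tendstoD) (use beta_pos in auto)
  ultimately have "\<forall>\<^sub>F t in at_top. k t < \<kappa> + \<beta> / 2 * (e / 2) * h \<and> \<theta> t < \<beta> / 2"
    by (rule eventually_conj)
  then obtain T where T: "\<And>t. T \<le> t \<Longrightarrow> k t < \<kappa> + \<beta> / 2 * (e / 2) * h" "\<And>t. T \<le> t \<Longrightarrow> \<theta> t < \<beta> / 2"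
    unfolding eventually_at_top_linorder by blast
  define G where "G = \<beta> / 2 * (e / 2)"
  have "U t < e" if "max t0 T \<le> t" for t
  proof (rule ccontr)
    assume "\<not> U t < e"
    have t: "t0 \<le> t" "T \<le> t" using that by auto
    have Us: "e / 2 \<le> U s" if s: "t \<le> s" "s \<le> t + h" for s
    proof -
      have "(- C) * s - (- C) * t \<le> U s - U t"
      proof (rule diff_le_of_deriv_le[where f = "\<lambda>s. (- C) * s" and g = U and f' = "\<lambda>_. - C"])
        fix x assume "t < x"
        then have x: "t0 \<le> x" using t by simp
        show "(U has_real_derivative dU x) (at x)" by (rule U_deriv[OF x])
        have "(U x + k x) powr c \<le> (B + k t0) powr c"
          using U_pos[OF x] k_pos[OF x] B(2)[OF x] k_antimono[OF assms, of t0 x] x c_gt by (intro powr_mono2) auto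
        moreover have "0 \<le> d * U x" "0 \<le> d * B" using d_pos U_pos[OF x] B(1) by auto
        ultimately show "- C \<le> dU x" by (simp add: C_def)
      qed (use s t in \<open>auto intro!: continuous_intros U_continuous derivative_eq_intros\<close>)
      moreover have "C * (s - t) \<le> C * h" using s C by (intro mult_left_mono) auto
      ultimately show ?thesis using \<open>\<not> U t < e\<close> h(2) by (simp add: algebra_simps)
    qed
    have "k (t + h) - k t \<le> - G * (t + h) - - G * t"
    proof (rule diff_le_of_deriv_le[where f = k and g = "\<lambda>s. - G * s" and g' = "\<lambda>_. - G"])
      fix x assume xx: "t < x" "x < t + h"
      then have x: "t0 \<le> x" "T \<le> x" using t by auto
      show "(k has_real_derivative dk x) (at x)" by (rule k_deriv[OF x(1)])
      have "(d - N) * k x \<le> 0" using assms(1) k_pos[OF x(1)] by (simp add: mult_le_0_iff)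
      moreover have "G \<le> (\<beta> - \<theta> x) * U x"
        unfolding G_def using T(2)[OF x(2)] Us[of x] xx beta_pos e by (intro mult_mono) auto
      ultimately show "dk x \<le> - G" by linarith
    qed (use h t in \<open>auto intro!: continuous_intros k_continuous derivative_eq_intros\<close>)
    then have "k (t + h) \<le> k t - G * h" by (simp add: algebra_simps)
    then show False using T(1)[OF t(2), folded G_def] \<kappa>(2)[of "t + h"] t h by simp
  qed
  then have "\<forall>t\<ge>max t0 T. dist (U t) 0 < e" using U_pos by (simp add: dist_real_def abs_of_pos)
  then show "\<forall>\<^sub>F t in at_top. dist (U t) 0 < e" unfolding eventually_at_top_linorder by blast
qed

text \<open>If \<open>\<kappa>\<close> is the limit of \<open>k\<close>, then \<open>U'\<close>
  tends to \<open>- \<kappa>^c\<close>; as \<open>U\<close> converges, this can only be 0.\<close>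

lemma k_tendsto_0:
  assumes "d \<le> N" shows "(k \<longlongrightarrow> 0) at_top"
proof -
  obtain \<kappa> where \<kappa>: "0 \<le> \<kappa>" "(k \<longlongrightarrow> \<kappa>) at_top"
    using antimono_limit[of t0 k 0] k_antimono[OF assms] k_pos by (metis less_imp_le)
  have pos: "0 \<le> U t + k t" if "t0 \<le> t" for t
    using U_pos[OF that] k_pos[OF that] by simp
  have "((\<lambda>t. dU t) \<longlongrightarrow> d * 0 - (0 + \<kappa>) powr c) at_top"
    by (intro tendsto_intros tendsto_powr' U_tendsto_0[OF assms] \<kappa>(2))
      (use c_gt pos in \<open>auto intro!: eventually_at_top_linorderI[of t0]\<close>)
  from derivative_limit_0[OF U_tendsto_0[OF assms] this]
  have "\<kappa> = 0" by simp
  then show ?thesis using \<kappa>(2) by simp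
qed

text \<open>Whenever \<open>U \<ge> e k\<close> at a late time, smallness of
  \<open>(U + k)^(c-1)\<close> gives \<open>(U + k)^c \<le> N U\<close>, and then
  \<open>(k / U)' \<le> - \<beta> / 2\<close>. This preserves \<open>U \<ge> e k\<close> and would
  make \<open>k / U\<close> negative.\<close>

lemma ratio_tendsto_0:
  assumes "d \<le> N" shows "((\<lambda>t. U t / k t) \<longlongrightarrow> 0) at_top"
proof (rule tendstoI)
  fix e :: real assume e: "0 < e"
  have "\<forall>\<^sub>F t in at_top. (U t + k t) powr (c - 1) < N * e / (1 + e)"
    by (rule order_tendstoD[OF sum_powr_tendsto_0[OF U_tendsto_0[OF assms] k_tendsto_0[OF assms]]])
      (use e N_pos in auto)
  moreover have "\<forall>\<^sub>F t in at_top. \<theta> t < \<beta> / 2"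
    using theta_0 by (rule order_tendstoD) (use beta_pos in auto)
  ultimately have "\<forall>\<^sub>F t in at_top. (U t + k t) powr (c - 1) < N * e / (1 + e) \<and> \<theta> t < \<beta> / 2"
    by (rule eventually_conj)
  then obtain T where T: "\<And>t. T \<le> t \<Longrightarrow> (U t + k t) powr (c - 1) < N * e / (1 + e)" "\<And>t. T \<le> t \<Longrightarrow> \<theta> t < \<beta> / 2"
    unfolding eventually_at_top_linorder by blast
  have "U t1 / k t1 < e" if "max t0 T \<le> t1" for t1
  proof (rule ccontr)
    assume neg: "\<not> U t1 / k t1 < e"
    have t1: "t0 \<le> t1" using that by simp
    show False
    proof (rule escape_unbounded[where Z = "\<lambda>t. - (k t / U t)" and ?t1.0 = t1 and e = "- (1 / e)" and c = "\<beta> / 2" and B = 0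
          and Z' = "\<lambda>t. - (((dk t) * U t - k t * (dU t)) / (U t * U t))"])
      show "- (1 / e) \<le> - (k t1 / U t1)" using neg e U_pos[OF t1] k_pos[OF t1] by (simp add: field_simps)
      show "0 < \<beta> / 2" using beta_pos by simp
      fix t assume "t1 \<le> t"
      then have t: "t0 \<le> t" "T \<le> t" using that by auto
      have pos: "0 < U t" "0 < k t" using U_pos k_pos t by auto
      show "((\<lambda>t. - (k t / U t)) has_real_derivative
          - (((dk t) * U t - k t * (dU t)) / (U t * U t))) (at t)"
        by (intro DERIV_minus DERIV_divide k_deriv U_deriv t) (use pos in simp)
      show "- (k t / U t) < 0" using pos by simp
      assume "- (1 / e) \<le> - (k t / U t)"
      then have ke: "e * k t \<le> U t" using e pos by (simp add: field_simps)
      have "(U t + k t) powr c = (U t + k t) powr (c - 1) * (U t + k t)" using pos by (simp add: powr_diff)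
      also have "\<dots> \<le> N * e / (1 + e) * (U t + k t)" using T(1)[OF t(2)] pos by (intro mult_right_mono) auto
      also have "\<dots> = N / (1 + e) * (e * U t + e * k t)" by (simp add: algebra_simps add_divide_distrib)
      also have "\<dots> \<le> N / (1 + e) * (e * U t + U t)" using ke N_pos e by (intro mult_left_mono) auto
      also have "\<dots> = N * U t" using e by (simp add: field_simps)
      finally have "k t * (U t + k t) powr c \<le> k t * (N * U t)" using pos by (intro mult_left_mono) auto
      moreover have "\<beta> / 2 * (U t * U t) \<le> (\<beta> - \<theta> t) * (U t * U t)"
        using T(2)[OF t(2)] by (intro mult_right_mono) auto
      ultimately have "\<beta> / 2 * (U t * U t) \<le> - ((dk t) * U t - k t * (dU t))"
        by (simp add: algebra_simps)
      then show "\<beta> / 2 \<le> - (((dk t) * U t - k t * (dU t)) / (U t * U t))"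
        using pos by (simp only: minus_divide_left pos_le_divide_eq mult_pos_pos)
    qed
  qed
  then have "\<forall>t\<ge>max t0 T. dist (U t / k t) 0 < e" using U_pos k_pos by (simp add: dist_real_def abs_of_pos)
  then show "\<forall>\<^sub>F t in at_top. dist (U t / k t) 0 < e" unfolding eventually_at_top_linorder by blast
qed

section \<open>Comparison of \<open>U\<close> with \<open>k^c\<close>\<close>

lemma one_plus_ratio:
  assumes "t0 \<le> t" shows "(U t + k t) powr c = k t powr c * (1 + U t / k t) powr c"
proof -
  have "U t + k t = k t * (1 + U t / k t)" using k_pos[OF assms] by (simp add: field_simps)
  then show ?thesis using k_pos[OF assms] U_pos[OF assms] by (simp add: powr_mult)
qed

lemma one_plus_ratio_tendsto:
  assumes "d \<le> N" shows "((\<lambda>t. (1 + U t / k t) powr c) \<longlongrightarrow> 1) at_top"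
proof -
  have "((\<lambda>t. (1 + U t / k t) powr c) \<longlongrightarrow> (1 + 0) powr c) at_top"
    by (intro tendsto_intros ratio_tendsto_0[OF assms]) simp
  then show ?thesis by simp
qed

text \<open>Suppose \<open>N U > (1 + e) k^c\<close> at a late time. Then
  \<open>U' / U \<ge> d - N + g\<close> against \<open>k' / k \<le> d - N\<close>. Since
  \<open>c > 1\<close> and \<open>d \<le> N\<close>, \<open>ln U - c ln k\<close> increases, so the
  inequality persists, and \<open>ln U - ln k\<close> grows linearly although \<open>U / k\<close>
  tends to 0.\<close>

lemma sigma_upper:
  assumes "d \<le> N" "0 < e"
  shows "\<forall>\<^sub>F t in at_top. N * U t \<le> (1 + e) * k t powr c"
proof -
  have "\<forall>\<^sub>F t in at_top. (1 + U t / k t) powr c < 1 + e / 2"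
    by (rule order_tendstoD[OF one_plus_ratio_tendsto[OF assms(1)]]) (use assms(2) in simp)
  moreover have "\<forall>\<^sub>F t in at_top. U t / k t < 1"
    by (rule order_tendstoD[OF ratio_tendsto_0[OF assms(1)]]) simp
  ultimately have "\<forall>\<^sub>F t in at_top. (1 + U t / k t) powr c < 1 + e / 2 \<and> U t / k t < 1"
    by (rule eventually_conj)
  then obtain T where T: "\<And>t. T \<le> t \<Longrightarrow> (1 + U t / k t) powr c < 1 + e / 2" "\<And>t. T \<le> t \<Longrightarrow> U t / k t < 1"
    unfolding eventually_at_top_linorder by blast
  \<comment> \<open>\<open>N (1 + e / 2) / (1 + e) = N - g\<close>, where \<open>1 + e / 2\<close>
    bounds \<open>(1 + U / k)^c\<close>.\<close>
  define g where "g = N * (e / 2) / (1 + e)"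
  have g: "0 < g" using N_pos assms(2) by (simp add: g_def)
  let ?dlnU = "\<lambda>t. (dU t) / U t"
  let ?dlnk = "\<lambda>t. (dk t) / k t"
  have DU: "((\<lambda>t. ln (U t)) has_real_derivative ?dlnU t) (at t)" if "t0 \<le> t" for t
    using DERIV_ln_divide[OF U_pos[OF that]] DERIV_chain2[OF _ U_deriv[OF that], of ln "1 / U t"]
    by simp
  have Dk: "((\<lambda>t. ln (k t)) has_real_derivative ?dlnk t) (at t)" if "t0 \<le> t" for t
    using DERIV_ln_divide[OF k_pos[OF that]] DERIV_chain2[OF _ k_deriv[OF that], of ln "1 / k t"]
    by simp
  have "N * U t1 \<le> (1 + e) * k t1 powr c" if "max t0 T \<le> t1" for t1
  proof (rule ccontr)
    assume neg: "\<not> N * U t1 \<le> (1 + e) * k t1 powr c"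
    have t1: "t0 \<le> t1" using that by simp
    define b where "b = ln ((1 + e) / N)"
    have iff: "b \<le> ln (U t) - c * ln (k t) \<longleftrightarrow> (1 + e) * k t powr c \<le> N * U t" if "t0 \<le> t" for t
    proof -
      have pos: "0 < U t" "0 < k t" "0 < (1 + e) / N" using U_pos k_pos that assms(2) N_pos by auto
      have "b + c * ln (k t) = ln ((1 + e) / N * k t powr c)"
        using ln_mult_pos[of "(1 + e) / N" "k t powr c"] pos N_pos assms(2)
        unfolding b_def by (simp add: ln_powr)
      then have "b \<le> ln (U t) - c * ln (k t) \<longleftrightarrow> ln ((1 + e) / N * k t powr c) \<le> ln (U t)" by linarith
      also have "\<dots> \<longleftrightarrow> (1 + e) / N * k t powr c \<le> U t" using pos N_pos assms(2) by (intro ln_le_cancel_iff) auto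
      also have "\<dots> \<longleftrightarrow> (1 + e) * k t powr c \<le> N * U t" using N_pos by (simp add: field_simps)
      finally show ?thesis .
    qed
    have core: "?dlnU t \<ge> d - N + g" if t: "t0 \<le> t" "T \<le> t" "(1 + e) * k t powr c \<le> N * U t" for t
    proof -
      have pos: "0 < U t" using U_pos t by auto
      have "(U t + k t) powr c \<le> k t powr c * (1 + e / 2)"
        unfolding one_plus_ratio[OF t(1)] using T(1)[OF t(2)] by (intro mult_left_mono) auto
      also have "\<dots> = ((1 + e) * k t powr c) * ((1 + e / 2) / (1 + e))" using assms(2) by simp
      also have "\<dots> \<le> N * U t * ((1 + e / 2) / (1 + e))"
        using t(3) assms(2) by (intro mult_right_mono) auto
      also have "\<dots> = (N - g) * U t" using assms(2) by (simp add: g_def field_simps)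
      finally have "(d - N + g) * U t \<le> dU t" by (simp add: algebra_simps)
      then show ?thesis using pos by (simp add: pos_le_divide_eq)
    qed
    have dk: "?dlnk t \<le> d - N" if "t0 \<le> t" for t
      using theta_less[OF that] U_pos[OF that] k_pos[OF that] by (simp add: pos_divide_le_eq)
    have stay: "(1 + e) * k t powr c \<le> N * U t" if "t1 \<le> t" for t
    proof -
      have "b \<le> ln (U t) - c * ln (k t)"
      proof (rule escape(1)[where Z = "\<lambda>t. ln (U t) - c * ln (k t)" and ?t1.0 = t1 and c = g
            and Z' = "\<lambda>t. ?dlnU t - c * ?dlnk t"])
        fix s assume "t1 \<le> s"
        then have s: "t0 \<le> s" "T \<le> s" using \<open>max t0 T \<le> t1\<close> by auto
        show "((\<lambda>t. ln (U t) - c * ln (k t)) has_real_derivative ?dlnU s - c * ?dlnk s) (at s)"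
          by (intro DERIV_diff DERIV_cmult DU Dk s)
        assume "b \<le> ln (U s) - c * ln (k s)"
        then have 1: "?dlnU s \<ge> d - N + g" using core iff s by blast
        have "c * ?dlnk s \<le> c * (d - N)" using dk[OF s(1)] c_gt by (intro mult_left_mono) auto
        also have "\<dots> \<le> 1 * (d - N)" using assms(1) c_gt by (intro mult_right_mono_neg) auto
        finally show "g \<le> ?dlnU s - c * ?dlnk s" using 1 by simp
      next
        show "b \<le> ln (U t1) - c * ln (k t1)" using iff[OF t1] neg by simp
      qed (use g that in auto)
      then show ?thesis using iff that t1 by simp
    qed
    show False
    proof (rule escape_unbounded[where Z = "\<lambda>t. ln (U t) - ln (k t)" and ?t1.0 = t1 and c = g
            and Z' = "\<lambda>t. ?dlnU t - ?dlnk t" and B = 0 and e = "ln (U t1) - ln (k t1)"])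
      fix s assume s1: "t1 \<le> s"
      then have s: "t0 \<le> s" "T \<le> s" using \<open>max t0 T \<le> t1\<close> by auto
      show "((\<lambda>t. ln (U t) - ln (k t)) has_real_derivative ?dlnU s - ?dlnk s) (at s)"
        by (intro DERIV_diff DU Dk s)
      show "g \<le> ?dlnU s - ?dlnk s" using core[OF s stay[OF s1]] dk[OF s(1)] by simp
      have "U s < k s" using T(2)[OF s(2)] k_pos[OF s(1)] by simp
      then show "ln (U s) - ln (k s) < 0" using U_pos[OF s(1)] k_pos[OF s(1)] by simp
    qed (use g in auto)
  qed
  then show ?thesis unfolding eventually_at_top_linorder by blast
qed

text \<open>\<open>K = exp ((N - d) t) k\<close> is nonincreasing, and by \<open>sigma_upper\<close>
  its logarithmic derivative is of order \<open>exp (- \<gamma> t)\<close>, which is integrable;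
  hence its limit \<open>\<nu>\<close> is positive. The rescaled \<open>U\<close> is a bounded
  solution of \<open>V' = \<eta> V - f\<close> with \<open>f\<close> tending to
  \<open>\<nu>^c\<close>.\<close>

lemma exists_rate_if_less:
  assumes "d < N"
  obtains \<nu> where "0 < \<nu>"
    "((\<lambda>t. exp (c * (N - d) * t) * U t) \<longlongrightarrow> \<nu> powr c / (d + c * (N - d))) at_top"
proof -
  define K where "K t = exp ((N - d) * t) * k t" for t
  have dN: "d \<le> N" using assms by simp
  have Kpos: "0 < K t" if "t0 \<le> t" for t using k_pos[OF that] by (simp add: K_def)
  have K_deriv: "(K has_real_derivative - (exp ((N - d) * t) * ((\<beta> - \<theta> t) * U t))) (at t)" if "t0 \<le> t" for t
    unfolding K_def by (rule derivative_eq_intros k_deriv that refl)+ (simp add: algebra_simps)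
  have K_cont: "continuous_on {x..y} K" if "t0 \<le> x" for x y
    by (rule DERIV_continuous_on[OF has_field_derivative_at_within[OF K_deriv]]) (use that in auto)
  have K_anti: "K y \<le> K x" if "t0 \<le> x" "x \<le> y" for x y
  proof -
    have "- K x \<le> - K y"
    proof (rule le_of_deriv_nonneg[where f = "\<lambda>t. - K t" and f' = "\<lambda>t. exp ((N - d) * t) * ((\<beta> - \<theta> t) * U t)"])
      fix t assume "x < t"
      then have t: "t0 \<le> t" using that by simp
      show "((\<lambda>t. - K t) has_real_derivative exp ((N - d) * t) * ((\<beta> - \<theta> t) * U t)) (at t)"
        using DERIV_minus[OF K_deriv[OF t]] by simp
      show "0 \<le> exp ((N - d) * t) * ((\<beta> - \<theta> t) * U t)"
        using theta_less[OF t] U_pos[OF t] by simp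
    qed (use that in \<open>auto intro!: continuous_intros K_cont\<close>)
    then show ?thesis by simp
  qed
  obtain T0 where T0: "\<And>t. T0 \<le> t \<Longrightarrow> N * U t \<le> 2 * k t powr c"
    using sigma_upper[OF dN, of 1] by (auto simp: eventually_at_top_linorder)
  define T where "T = max t0 T0"
  have T: "t0 \<le> t" "T0 \<le> t" if "T \<le> t" for t using that by (auto simp: T_def)
  have Kne: "K t \<noteq> 0" if "T \<le> t" for t using Kpos[OF T(1)[OF that]] by simp
  \<comment> \<open>The rate in \<open>k^(c-1) = exp (- \<gamma> t) K^(c-1)\<close>.\<close>
  define \<gamma> where "\<gamma> = (c - 1) * (N - d)"
  have \<gamma>: "0 < \<gamma>" using assms c_gt by (simp add: \<gamma>_def)
  define C where "C = 2 * \<beta> / N * K T powr (c - 1)"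
  have k_K: "k t = exp (- ((N - d) * t)) * K t" for t
    by (simp add: K_def mult.assoc[symmetric] flip: exp_add)
  have lower: "exp (ln (K T) - C / \<gamma> * exp (- (\<gamma> * T))) \<le> K t" if t: "T \<le> t" for t
  proof -
    have "ln (K T) - C / \<gamma> * exp (- (\<gamma> * T)) \<le> ln (K t) - C / \<gamma> * exp (- (\<gamma> * t))"
    proof (rule le_of_deriv_nonneg[where f = "\<lambda>t. ln (K t) - C / \<gamma> * exp (- (\<gamma> * t))" and
          f' = "\<lambda>t. - (exp ((N - d) * t) * ((\<beta> - \<theta> t) * U t)) / K t + C * exp (- (\<gamma> * t))", OF t])
      show "continuous_on {T..t} (\<lambda>t. ln (K t) - C / \<gamma> * exp (- (\<gamma> * t)))"
        by (intro continuous_intros K_cont) (use T(1)[of T] Kne in auto)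
      fix x assume x: "T < x"
      then have x0: "t0 \<le> x" "T0 \<le> x" using T[of x] by auto
      have "((\<lambda>t. ln (K t)) has_real_derivative 1 / K x * - (exp ((N - d) * x) * ((\<beta> - \<theta> x) * U x))) (at x)"
        by (rule DERIV_chain2[OF DERIV_ln_divide[OF Kpos[OF x0(1)]] K_deriv[OF x0(1)]])
      moreover have "((\<lambda>t. C / \<gamma> * exp (- (\<gamma> * t))) has_real_derivative C / \<gamma> * (- \<gamma> * exp (- (\<gamma> * x)))) (at x)"
        by (auto intro!: derivative_eq_intros)
      ultimately show "((\<lambda>t. ln (K t) - C / \<gamma> * exp (- (\<gamma> * t))) has_real_derivative
          - (exp ((N - d) * x) * ((\<beta> - \<theta> x) * U x)) / K x + C * exp (- (\<gamma> * x))) (at x)"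
        by (rule DERIV_cong[OF DERIV_diff]) (use \<gamma> in simp)
      have pos: "0 < U x" "0 < k x" using U_pos k_pos x0 by auto
      have "exp ((N - d) * x) * ((\<beta> - \<theta> x) * U x) \<le> exp ((N - d) * x) * (\<beta> * (2 * k x powr c / N))"
        using theta_nonneg[OF x0(1)] theta_less[OF x0(1)] T0[OF x0(2)] pos beta_pos N_pos
        by (intro mult_left_mono mult_mono) (auto simp: field_simps)
      also have "\<dots> = 2 * \<beta> / N * k x powr (c - 1) * K x"
        using pos by (simp add: K_def powr_diff)
      also have "k x powr (c - 1) = exp (- (\<gamma> * x)) * K x powr (c - 1)"
        unfolding k_K[of x] using Kpos[OF x0(1)]
        by (simp add: powr_mult powr_def[of "exp _"] \<gamma>_def algebra_simps)
      finally have "exp ((N - d) * x) * ((\<beta> - \<theta> x) * U x)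
          \<le> (2 * \<beta> / N * K x powr (c - 1) * exp (- (\<gamma> * x))) * K x" by (simp add: mult_ac)
      also have "\<dots> \<le> (C * exp (- (\<gamma> * x))) * K x"
        unfolding C_def using K_anti[of T x] T(1)[of T] x c_gt Kpos[OF x0(1)] beta_pos N_pos
        by (intro mult_right_mono mult_left_mono powr_mono2) auto
      finally have "exp ((N - d) * x) * ((\<beta> - \<theta> x) * U x) / K x \<le> C * exp (- (\<gamma> * x))"
        using Kpos[OF x0(1)] by (simp add: pos_divide_le_eq)
      then show "0 \<le> - (exp ((N - d) * x) * ((\<beta> - \<theta> x) * U x)) / K x + C * exp (- (\<gamma> * x))"
        by simp
    qed
    moreover have "0 \<le> C / \<gamma> * exp (- (\<gamma> * t))" using \<gamma> beta_pos N_pos by (simp add: C_def)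
    ultimately have "ln (K T) - C / \<gamma> * exp (- (\<gamma> * T)) \<le> ln (K t)" by linarith
    then show ?thesis using Kpos[OF T(1)[OF t]] by (metis exp_le_cancel_iff exp_ln)
  qed
  obtain \<nu> where \<nu>: "exp (ln (K T) - C / \<gamma> * exp (- (\<gamma> * T))) \<le> \<nu>" "(K \<longlongrightarrow> \<nu>) at_top"
    using antimono_limit[of T K] lower K_anti T(1) by metis
  then have "0 < \<nu>" by (meson exp_gt_zero less_le_trans)
  define \<eta> where "\<eta> = d + c * (N - d)"
  have \<eta>: "0 < \<eta>" using d_pos assms c_gt by (simp add: \<eta>_def add_pos_pos)
  define f where "f t = K t powr c * (1 + U t / k t) powr c" for t
  have Kk: "exp (c * (N - d) * t) * k t powr c = K t powr c" if "t0 \<le> t" for t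
    using k_pos[OF that] by (simp add: K_def powr_mult powr_def[of "exp _"] mult_ac)
  have "((\<lambda>t. exp (c * (N - d) * t) * U t) \<longlongrightarrow> \<nu> powr c / \<eta>) at_top"
  proof (rule bounded_solution_limit[where ?t0.0 = T and f = f and B = "2 / N * K T powr c"])
    fix t assume t: "T \<le> t"
    have "((\<lambda>t. exp (c * (N - d) * t) * U t) has_real_derivative
        c * (N - d) * exp (c * (N - d) * t) * U t + (dU t) * exp (c * (N - d) * t)) (at t)"
      by (rule derivative_eq_intros U_deriv T(1)[OF t] refl)+ (simp add: algebra_simps)
    moreover have "exp (c * (N - d) * t) * (U t + k t) powr c = f t"
      unfolding f_def one_plus_ratio[OF T(1)[OF t]] using Kk[OF T(1)[OF t]] by simp
    ultimately show "((\<lambda>t. exp (c * (N - d) * t) * U t) has_real_derivative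
        \<eta> * (exp (c * (N - d) * t) * U t) - f t) (at t)"
      by (elim DERIV_cong) (simp add: \<eta>_def algebra_simps)
    have "exp (c * (N - d) * t) * U t \<le> exp (c * (N - d) * t) * (2 / N * k t powr c)"
      using T0[OF T(2)[OF t]] N_pos by (intro mult_left_mono) (auto simp: field_simps)
    also have "\<dots> = 2 / N * K t powr c" using Kk[OF T(1)[OF t]] by simp
    also have "\<dots> \<le> 2 / N * K T powr c"
      using K_anti[of T t] T(1)[of T] t c_gt Kpos[OF T(1)[OF t]] N_pos by (intro mult_left_mono powr_mono2) auto
    finally show "\<bar>exp (c * (N - d) * t) * U t\<bar> \<le> 2 / N * K T powr c"
      using U_pos[OF T(1)[OF t]] by simp
  next
    have "(f \<longlongrightarrow> \<nu> powr c * 1) at_top"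
      unfolding f_def by (intro tendsto_intros \<nu> one_plus_ratio_tendsto[OF dN]) (use \<open>0 < \<nu>\<close> in auto)
    then show "(f \<longlongrightarrow> \<nu> powr c) at_top" by simp
  qed (rule \<eta>)
  then show ?thesis using that[of \<nu>] \<open>0 < \<nu>\<close> by (simp add: \<eta>_def)
qed

text \<open>For \<open>d = N\<close> the quantity \<open>\<sigma> = U k^(-c)\<close> satisfies
  \<open>\<sigma>' = N \<sigma> - (1 + U / k)^c + c (\<beta> - \<theta>) (U / k) \<sigma>\<close>.
  If \<open>N \<sigma> \<le> 1 - e\<close>, the first two terms give at most \<open>- e\<close> and
  the last one is at most \<open>e / 2\<close> at late times, so \<open>\<sigma>\<close> would
  become negative.\<close>

lemma sigma_lower:
  assumes "d = N" "0 < e" "e < 1"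
  shows "\<forall>\<^sub>F t in at_top. (1 - e) * k t powr c \<le> N * U t"
proof -
  have dN: "d \<le> N" using assms by simp
  have "\<forall>\<^sub>F t in at_top. U t / k t < e * N / (2 * c * \<beta>)"
    by (rule order_tendstoD[OF ratio_tendsto_0[OF dN]]) (use assms N_pos c_gt beta_pos in auto)
  then obtain T where T: "\<And>t. T \<le> t \<Longrightarrow> U t / k t < e * N / (2 * c * \<beta>)"
    unfolding eventually_at_top_linorder by blast
  have "(1 - e) * k t1 powr c \<le> N * U t1" if "max t0 T \<le> t1" for t1
  proof (rule ccontr)
    assume neg: "\<not> (1 - e) * k t1 powr c \<le> N * U t1"
    have t1: "t0 \<le> t1" using that by simp
    show False
    proof (rule escape_unbounded[where Z = "\<lambda>t. - (U t * k t powr (- c))" and ?t1.0 = t1 and e = "- ((1 - e) / N)"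
          and c = "e / 2" and B = 0 and Z' = "\<lambda>t. - ((dU t) * k t powr (- c)
            + (- c * k t powr (- c - 1) * (dk t)) * U t)"])
      have "U t1 * k t1 powr (- c) \<le> (1 - e) / N"
        using neg k_pos[OF t1] N_pos by (simp add: powr_minus field_simps)
      then show "- ((1 - e) / N) \<le> - (U t1 * k t1 powr (- c))" by simp
      fix t assume "t1 \<le> t"
      then have t: "t0 \<le> t" "T \<le> t" using that by auto
      have pos: "0 < U t" "0 < k t" using U_pos k_pos t by auto
      have Dk: "((\<lambda>t. k t powr (- c)) has_real_derivative - c * k t powr (- c - 1) * (dk t)) (at t)"
        using DERIV_fun_powr[OF k_deriv[OF t(1)] pos(2), of "- c"] by simp
      show "((\<lambda>t. - (U t * k t powr (- c))) has_real_derivative - ((dU t) * k t powr (- c)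
            + (- c * k t powr (- c - 1) * (dk t)) * U t)) (at t)"
        by (intro DERIV_minus DERIV_mult' DERIV_cong[OF DERIV_mult[OF U_deriv[OF t(1)] Dk]]) simp
      show "- (U t * k t powr (- c)) < 0" using pos by simp
      assume "- ((1 - e) / N) \<le> - (U t * k t powr (- c))"
      then have s: "N * (U t * k t powr (- c)) \<le> 1 - e" using N_pos by (simp add: field_simps)
      define \<sigma> where "\<sigma> = U t * k t powr (- c)"
      have \<sigma>: "0 < \<sigma>" "N * \<sigma> \<le> 1 - e" "\<sigma> \<le> 1 / N" using pos s N_pos assms(2) by (auto simp: \<sigma>_def field_simps)
      have kk: "k t powr (- c) * k t powr c = 1" using pos by (simp add: powr_minus)
      have "1 \<le> (1 + U t / k t) powr c" using pos c_gt by (intro ge_one_powr_ge_zero) auto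
      then have A: "1 \<le> (U t + k t) powr c * k t powr (- c)"
        unfolding one_plus_ratio[OF t(1)] mult.commute[of "k t powr c"] mult.assoc kk by simp
      have "c * k t powr (- c - 1) * ((\<beta> - \<theta> t) * U t) * U t = c * (\<beta> - \<theta> t) * (U t / k t) * \<sigma>"
        using pos by (simp add: \<sigma>_def powr_diff)
      also have "\<dots> \<le> c * \<beta> * (e * N / (2 * c * \<beta>)) * (1 / N)"
        using T[OF t(2)] \<sigma> pos c_gt beta_pos N_pos assms(2) theta_nonneg[OF t(1)] theta_less[OF t(1)]
        by (intro mult_mono) auto
      also have "\<dots> = e / 2" using c_gt beta_pos N_pos by simp
      finally have Bd: "c * k t powr (- c - 1) * ((\<beta> - \<theta> t) * U t) * U t \<le> e / 2" .
      have "(dU t) * k t powr (- c) = N * \<sigma> - (U t + k t) powr c * k t powr (- c)"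
        using assms(1) by (simp add: \<sigma>_def algebra_simps)
      moreover have "(- c * k t powr (- c - 1) * (dk t)) * U t
          = c * k t powr (- c - 1) * ((\<beta> - \<theta> t) * U t) * U t"
        using assms(1) by simp
      ultimately show "e / 2 \<le> - ((dU t) * k t powr (- c)
            + (- c * k t powr (- c - 1) * (dk t)) * U t)"
        using A Bd \<sigma>(2) by linarith
    qed (use assms in auto)
  qed
  then show ?thesis unfolding eventually_at_top_linorder by blast
qed

lemma sigma_limit:
  assumes "d = N" shows "((\<lambda>t. U t * k t powr (- c)) \<longlongrightarrow> 1 / N) at_top"
proof (rule tendstoI)
  fix e :: real assume e: "0 < e"
  define e' where "e' = min (N * e / 2) (1 / 2)"
  have e': "0 < e'" "e' < 1" "e' / N < e" using e N_pos by (auto simp: e'_def field_simps min_def)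
  have "\<forall>\<^sub>F t in at_top. N * U t \<le> (1 + e') * k t powr c"
    using sigma_upper e' assms by simp
  moreover have "\<forall>\<^sub>F t in at_top. (1 - e') * k t powr c \<le> N * U t"
    using sigma_lower e' assms by simp
  moreover have "\<forall>\<^sub>F t in at_top. t0 \<le> t" by (rule eventually_ge_at_top)
  ultimately show "\<forall>\<^sub>F t in at_top. dist (U t * k t powr (- c)) (1 / N) < e"
  proof eventually_elim
    case (elim t)
    have "U t * k t powr (- c) \<le> 1 / N + e' / N" "1 / N - e' / N \<le> U t * k t powr (- c)"
      using elim k_pos[of t] N_pos by (auto simp: powr_minus field_simps)
    then show ?case using e'(3) by (simp add: dist_real_def abs_less_iff)
  qed
qed

text \<open>Now \<open>k' = - (\<beta> - \<theta>) U\<close> and \<open>U\<close> is about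
  \<open>k^c / N\<close>, so the derivative of \<open>Y = k^(-(c-1))\<close> tends to
  \<open>(c - 1) \<beta> / N\<close>. Thus \<open>Y\<close> grows linearly in \<open>t\<close>, and
  \<open>U\<close> is recovered from \<open>k^c = Y^(-c/(c-1))\<close>.\<close>

lemma limit_if_equal:
  assumes "d = N"
  shows "((\<lambda>t. t powr (c / (c - 1)) * U t) \<longlongrightarrow> 1 / N * ((c - 1) * \<beta> / N) powr (- (c / (c - 1)))) at_top"
proof -
  define Y where "Y t = k t powr (- (c - 1))" for t
  have Y_deriv: "(Y has_real_derivative (c - 1) * (\<beta> - \<theta> t) * (U t * k t powr (- c))) (at t)" if "t0 \<le> t" for t
  proof -
    have "(Y has_real_derivative - (c - 1) * k t powr (- (c - 1) - 1) * (dk t)) (at t)"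
      unfolding Y_def using DERIV_fun_powr[OF k_deriv[OF that] k_pos[OF that], of "- (c - 1)"] by simp
    then show ?thesis by (rule DERIV_cong) (use assms in \<open>simp add: algebra_simps\<close>)
  qed
  have Y_lim: "((\<lambda>t. Y t / t) \<longlongrightarrow> (c - 1) * \<beta> / N) at_top"
  proof (rule lhospital_at_top_at_top[where g' = "\<lambda>_. 1" and f' = "\<lambda>t. (c - 1) * (\<beta> - \<theta> t) * (U t * k t powr (- c))"])
    show "\<forall>\<^sub>F t in at_top. (Y has_real_derivative (c - 1) * (\<beta> - \<theta> t) * (U t * k t powr (- c))) (at t)"
      by (rule eventually_at_top_linorderI[of t0]) (rule Y_deriv)
    have "((\<lambda>t. (c - 1) * (\<beta> - \<theta> t) * (U t * k t powr (- c)) / 1) \<longlongrightarrow> (c - 1) * (\<beta> - 0) * (1 / N) / 1) at_top"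
      by (intro tendsto_intros theta_0 sigma_limit[OF assms]) auto
    then show "((\<lambda>t. (c - 1) * (\<beta> - \<theta> t) * (U t * k t powr (- c)) / 1) \<longlongrightarrow> (c - 1) * \<beta> / N) at_top" by simp
  qed (auto simp: filterlim_ident)
  have "((\<lambda>t. (U t * k t powr (- c)) * (Y t / t) powr (- (c / (c - 1)))) \<longlongrightarrow>
      1 / N * ((c - 1) * \<beta> / N) powr (- (c / (c - 1)))) at_top"
    by (intro tendsto_mult tendsto_powr Y_lim tendsto_const sigma_limit[OF assms]) (use c_gt beta_pos N_pos in auto)
  moreover have "\<forall>\<^sub>F t in at_top. (U t * k t powr (- c)) * (Y t / t) powr (- (c / (c - 1))) = t powr (c / (c - 1)) * U t"
    using eventually_ge_at_top[of t0] eventually_gt_at_top[of 0]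
  proof eventually_elim
    case (elim t)
    have "- (c - 1) * - (c / (c - 1)) = c" using c_gt by (simp add: field_simps)
    then have "Y t powr (- (c / (c - 1))) = k t powr c"
      by (simp only: Y_def powr_powr)
    then show ?case using elim k_pos[of t]
      by (simp add: powr_divide powr_minus Y_def field_simps)
  qed
  ultimately show ?thesis by (rule Lim_transform_eventually)
qed

end

section \<open>The shooting argument\<close>

lemma radial_sol_of_solves_ivp:
  assumes "1 < p" "0 < \<alpha>" "\<alpha> < real n + 1" "1 < q" "0 < a" and sol: "solves_ivp (Suc n) p \<alpha> q a w"
  shows "\<exists>F. radial_sol n (p - 1) \<alpha> q 1 a w F"
  using sol unfolding solves_ivp_def
proof (elim exE conjE)
  fix w' F'
  assume *: "\<forall>r\<ge>0. (w has_real_derivative w' r) (at r within {0..})"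
    "\<forall>r\<ge>0. ((\<lambda>s. spow (p - 1) (w' s)) has_real_derivative F' r) (at r within {0..})"
    "\<forall>r>0. F' r + (real (Suc n) - 1) / r * spow (p - 1) (w' r) + r * w' r + \<alpha> * w r + spow q (w r) = 0"
    and init: "w 0 = a" "w' 0 = 0"
  note w' = *(1)[rule_format] and F' = *(2)[rule_format] and ode = *(3)[rule_format]
  define F where "F s = spow (p - 1) (w' s)" for s
  have w'F: "spow (1 / (p - 1)) (F s) = w' s" for s
    using assms(1) by (simp add: F_def spow_spow_inverse)
  have within: "at r within {0..} = at r" if "0 < r" for r :: real
    by (rule at_within_open_subset[of r "{0<..}"]) (use that in auto)
  have "radial_sol n (p - 1) \<alpha> q 1 a w F"
  proof
    show "continuous_on {0..} w" using w' by (intro DERIV_continuous_on) auto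
    show "continuous_on {0..} F" unfolding F_def using F' by (intro DERIV_continuous_on) auto
    fix r :: real assume r: "0 < r"
    show "(w has_real_derivative spow (1 / (p - 1)) (F r)) (at r)"
      using w'[of r] r by (simp add: w'F within)
    have "(F has_real_derivative F' r) (at r)" using F'[of r] r by (simp add: F_def[abs_def] within)
    moreover have "F' r = - (real n / r) * F r - 1 * (r * w' r + \<alpha> * w r) - spow q (w r)"
      using ode[OF r] by (simp add: F_def)
    ultimately show "(F has_real_derivative - (real n / r) * F r
        - 1 * (r * spow (1 / (p - 1)) (F r) + \<alpha> * w r) - spow q (w r)) (at r)"
      unfolding w'F by simp
  qed (use assms init in \<open>auto simp: F_def\<close>)
  then show ?thesis by (intro exI[of _ F])
qed

section \<open>The two open sets of initial values\<close>

locale radial_family =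
  fixes n :: nat and m \<alpha> q :: real and w F :: "real \<Rightarrow> real \<Rightarrow> real"
  assumes sol: "\<And>a. 0 < a \<Longrightarrow> radial_sol n m \<alpha> q 1 a (w a) (F a)"
begin

lemma tendsto_solution:
  assumes a: "0 < a" and r: "0 < r"
  shows "((\<lambda>b. w b r) \<longlongrightarrow> w a r) (at a)" "((\<lambda>b. F b r) \<longlongrightarrow> F a r) (at a)"
proof -
  obtain C where C: "0 < C"
    "\<And>b s. \<bar>b - a\<bar> < a / 2 \<Longrightarrow> 0 \<le> s \<Longrightarrow> s \<le> r \<Longrightarrow> \<bar>w b s - w a s\<bar> \<le> C * \<bar>b - a\<bar>"
    "\<And>b s. \<bar>b - a\<bar> < a / 2 \<Longrightarrow> 0 < s \<Longrightarrow> s \<le> r \<Longrightarrow> \<bar>F b s - F a s\<bar> \<le> C * \<bar>b - a\<bar>"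
    by (rule continuous_dependence[OF sol a r]) auto
  have near: "\<forall>\<^sub>F b in at a. \<bar>b - a\<bar> < a / 2"
    unfolding eventually_at using a by (auto simp: dist_real_def intro!: exI[of _ "a / 2"])
  have "((\<lambda>b. C * \<bar>b - a\<bar>) \<longlongrightarrow> C * \<bar>a - a\<bar>) (at a)" by (intro tendsto_intros)
  then have lim: "((\<lambda>b. C * \<bar>b - a\<bar>) \<longlongrightarrow> 0) (at a)" by simp
  have "((\<lambda>b. w b r - w a r) \<longlongrightarrow> 0) (at a)" "((\<lambda>b. F b r - F a r) \<longlongrightarrow> 0) (at a)"
    using near C(2)[of _ r] C(3)[of _ r] r
    by (auto intro!: Lim_null_comparison[OF _ lim] elim!: eventually_mono)
  then show "((\<lambda>b. w b r) \<longlongrightarrow> w a r) (at a)" "((\<lambda>b. F b r) \<longlongrightarrow> F a r) (at a)"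
    by (auto simp: LIM_zero_iff)
qed

lemma positive_nearby:
  assumes a: "0 < a" and r: "0 < r" and pos: "\<And>s. 0 \<le> s \<Longrightarrow> s \<le> r \<Longrightarrow> 0 < w a s"
  shows "\<forall>\<^sub>F b in at a. \<forall>s. 0 \<le> s \<longrightarrow> s \<le> r \<longrightarrow> 0 < w b s"
proof -
  interpret radial_sol n m \<alpha> q 1 a "w a" "F a" by (rule sol[OF a])
  have "\<exists>x\<in>{0..r}. \<forall>y\<in>{0..r}. w a x \<le> w a y"
    by (rule continuous_attains_inf) (use r in \<open>auto intro: continuous_on_w\<close>)
  then obtain x where x: "0 \<le> x" "x \<le> r" "\<And>y. 0 \<le> y \<Longrightarrow> y \<le> r \<Longrightarrow> w a x \<le> w a y" by auto
  obtain C where C: "0 < C"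
    "\<And>b s. \<bar>b - a\<bar> < a / 2 \<Longrightarrow> 0 \<le> s \<Longrightarrow> s \<le> r \<Longrightarrow> \<bar>w b s - w a s\<bar> \<le> C * \<bar>b - a\<bar>"
    by (rule continuous_dependence[OF sol a r]) auto
  define e where "e = min (a / 2) (w a x / C)"
  have "0 < e" using a C(1) pos[OF x(1,2)] by (simp add: e_def)
  moreover have "0 < w b s" if "\<bar>b - a\<bar> < e" "0 \<le> s" "s \<le> r" for b s
  proof -
    have b: "\<bar>b - a\<bar> < a / 2" "\<bar>b - a\<bar> < w a x / C" using that by (auto simp: e_def)
    have "C * \<bar>b - a\<bar> < w a x" using b(2) C(1) by (simp add: pos_less_divide_eq mult.commute)
    then show ?thesis using C(2)[OF b(1) that(2,3)] x(3)[OF that(2,3)] by (simp add: abs_le_iff)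
  qed
  ultimately show ?thesis unfolding eventually_at dist_real_def by (intro exI[of _ e]) auto
qed

text \<open>\<open>r * w + F\<close> is \<open>J\<close> without the positive factor
  \<open>r^n\<close>. All conditions are strict and concern a compact interval only, which makes the
  set open.\<close>

definition good :: "real set" where
  "good = {a. 0 < a \<and> (\<exists>r>0. (\<forall>s. 0 \<le> s \<longrightarrow> s \<le> r \<longrightarrow> 0 < w a s) \<and> 0 < r * w a r + F a r \<and>
     w a r powr (q - 1) < real n + 1 - \<alpha>)}"

definition bad :: "real set" where
  "bad = {a. 0 < a \<and> (\<exists>r>0. w a r < 0)}"

lemma open_of_eventually:
  fixes S :: "real set"
  assumes "\<And>a. a \<in> S \<Longrightarrow> \<forall>\<^sub>F b in at a. b \<in> S"
  shows "open S"
  unfolding open_dist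
proof
  fix a assume a: "a \<in> S"
  obtain e where "0 < e" "\<forall>b. b \<noteq> a \<and> dist b a < e \<longrightarrow> b \<in> S"
    using assms[OF a] unfolding eventually_at by auto
  then show "\<exists>e>0. \<forall>y. dist y a < e \<longrightarrow> y \<in> S" using a by metis
qed

lemma eventually_pos: "0 < a \<Longrightarrow> \<forall>\<^sub>F b in at a. (0::real) < b"
  by (intro order_tendstoD[OF tendsto_ident_at])

lemma open_good: "open good"
proof (rule open_of_eventually)
  fix a assume "a \<in> good"
  then obtain r where a: "0 < a" and r: "0 < r" "\<And>s. 0 \<le> s \<Longrightarrow> s \<le> r \<Longrightarrow> 0 < w a s"
    "0 < r * w a r + F a r" "w a r powr (q - 1) < real n + 1 - \<alpha>"
    unfolding good_def by blast
  note lim = tendsto_solution[OF a r(1)]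
  have 3: "\<forall>\<^sub>F b in at a. \<forall>s. 0 \<le> s \<longrightarrow> s \<le> r \<longrightarrow> 0 < w b s"
    by (rule positive_nearby[OF a r(1)]) (rule r(2))
  have 1: "\<forall>\<^sub>F b in at a. 0 < r * w b r + F b r"
    by (rule order_tendstoD(1)[OF tendsto_add[OF tendsto_mult[OF tendsto_const lim(1)] lim(2)] r(3)])
  have "((\<lambda>b. w b r powr (q - 1)) \<longlongrightarrow> w a r powr (q - 1)) (at a)"
    using r(2)[of r] r(1) by (intro tendsto_powr lim tendsto_const) auto
  then have 2: "\<forall>\<^sub>F b in at a. w b r powr (q - 1) < real n + 1 - \<alpha>"
    by (rule order_tendstoD(2)[OF _ r(4)])
  show "\<forall>\<^sub>F b in at a. b \<in> good"
    using eventually_pos[OF a] 3 1 2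
    by eventually_elim (use r(1) in \<open>auto simp: good_def\<close>)
qed

lemma open_bad: "open bad"
proof (rule open_of_eventually)
  fix a assume "a \<in> bad"
  then obtain r where a: "0 < a" and r: "0 < r" "w a r < 0" unfolding bad_def by blast
  have "\<forall>\<^sub>F b in at a. w b r < 0"
    by (rule order_tendstoD(2)[OF tendsto_solution(1)[OF a r(1)] r(2)])
  with eventually_pos[OF a] show "\<forall>\<^sub>F b in at a. b \<in> bad"
    by eventually_elim (use r(1) in \<open>auto simp: bad_def\<close>)
qed

lemma good_bad_disjoint: "good \<inter> bad = {}"
proof -
  have False if ag: "a \<in> good" and ab: "a \<in> bad" for a
  proof -
    obtain r where a: "0 < a" and r: "0 < r" "\<forall>s. 0 \<le> s \<longrightarrow> s \<le> r \<longrightarrow> 0 < w a s"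
      "0 < r * w a r + F a r" "w a r powr (q - 1) < real n + 1 - \<alpha>"
      using ag unfolding good_def by blast
    interpret radial_sol n m \<alpha> q 1 a "w a" "F a" by (rule sol[OF a])
    have "0 < J r" using r(1,3) by (simp add: J_def)
    then have "0 < w a s" if "0 \<le> s" for s
      using positive_forever[OF r(1) r(2)[rule_format]] r(4) that by simp
    then show False using ab unfolding bad_def by (force dest: less_imp_le)
  qed
  then show ?thesis by auto
qed

text \<open>For \<open>a^(q-1) = (n + 1 - \<alpha>) / 2\<close>, \<open>H\<close> is positive at the
  values of \<open>w\<close> near radius 0, so \<open>J\<close> increases from
  \<open>J 0 = 0\<close>.\<close>

lemma good_nonempty: "good \<inter> {0<..} \<noteq> {}"
proof -
  interpret S1: radial_sol n m \<alpha> q 1 1 "w 1" "F 1" by (rule sol) simp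
  define a where "a = ((real n + 1 - \<alpha>) / 2) powr (1 / (q - 1))"
  have a: "0 < a" "a powr (q - 1) < real n + 1 - \<alpha>"
    using S1.alpha_less S1.q_gt by (auto simp: a_def powr_powr)
  interpret radial_sol n m \<alpha> q 1 a "w a" "F a" by (rule sol[OF a(1)])
  obtain d where d: "0 < d" "\<And>s. 0 \<le> s \<Longrightarrow> dist s 0 < d \<Longrightarrow> dist (w a s) (w a 0) < a"
    using cont_w a(1) unfolding continuous_on_iff by (metis atLeast_iff order_refl)
  define r where "r = d / 2"
  have r: "0 < r" using d by (simp add: r_def)
  have pos: "0 < w a s" if "0 \<le> s" "s \<le> r" for s
    using d(2)[of s] that d(1) by (simp add: dist_real_def w_0 r_def abs_less_iff)
  have small: "w a s powr (q - 1) < real n + 1 - \<alpha>" if "0 \<le> s" "s \<le> r" for s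
  proof -
    have "w a s \<le> w a 0" by (rule w_antimono) (use that pos in \<open>auto intro: less_imp_le\<close>)
    then have "w a s powr (q - 1) \<le> a powr (q - 1)"
      using pos[OF that] q_gt w_0 by (intro powr_mono2) auto
    then show ?thesis using a(2) by simp
  qed
  have "J 0 < J r"
  proof (rule DERIV_pos_imp_increasing_open[where f = J, OF r])
    fix x assume x: "0 < x" "x < r"
    have "0 < H (w a x)" using H_pos pos[of x] small[of x] x by simp
    then show "\<exists>y. (J has_real_derivative y) (at x) \<and> 0 < y"
      using J_deriv[OF x(1)] x(1) by (intro exI[of _ "x ^ n * H (w a x)"]) simp
  qed (auto intro: continuous_on_J)
  then have "0 < r * w a r + F a r" using r by (simp add: J_0 J_def[of r] zero_less_mult_iff)
  then have "a \<in> good" unfolding good_def using a(1) r pos small[of r] by auto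
  then show ?thesis using a(1) by auto
qed

lemma exists_threshold:
  assumes sub: "m < real n \<Longrightarrow> q * (real n - m) < real n * m + 2 * m + 1"
  obtains a where "0 < a" "\<And>r. 0 \<le> r \<Longrightarrow> 0 \<le> w a r"
    "\<And>r. 0 < r \<Longrightarrow> (\<And>s. 0 \<le> s \<Longrightarrow> s \<le> r \<Longrightarrow> 0 < w a s) \<Longrightarrow>
        w a r powr (q - 1) < real n + 1 - \<alpha> \<Longrightarrow> r * w a r + F a r \<le> 0"
proof -
  obtain a1 r1 where a1: "0 < a1" "0 \<le> r1" "w a1 r1 < 0"
    using changes_sign_large[OF sol sub] by blast
  interpret S1: radial_sol n m \<alpha> q 1 a1 "w a1" "F a1" by (rule sol[OF a1(1)])
  have "r1 \<noteq> 0" using a1 S1.w_0 by auto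
  then have "bad \<inter> {0<..} \<noteq> {}" using a1 unfolding bad_def by (metis (mono_tags, lifting) IntI empty_iff greaterThan_iff less_eq_real_def mem_Collect_eq)
  moreover have "connected {0::real<..}" by (rule convex_connected) simp
  ultimately have "\<not> {0<..} \<subseteq> good \<union> bad"
    using connectedD[OF _ open_good open_bad, of "{0<..}"] good_bad_disjoint good_nonempty by auto
  then obtain a where a: "0 < a" "a \<notin> good" "a \<notin> bad" by auto
  interpret radial_sol n m \<alpha> q 1 a "w a" "F a" by (rule sol[OF a(1)])
  show ?thesis
  proof (rule that[OF a(1)])
    show "0 \<le> w a r" if "0 \<le> r" for r
    proof (cases "r = 0")
      case False
      then have "0 < r" using that by simp
      show ?thesis
      proof (rule ccontr)
        assume "\<not> 0 \<le> w a r"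
        then have "a \<in> bad" using \<open>0 < r\<close> a(1) unfolding bad_def by auto
        then show False using a(3) by simp
      qed
    qed (use w_0 a(1) in simp)
    show "r * w a r + F a r \<le> 0"
      if "0 < r" "\<And>s. 0 \<le> s \<Longrightarrow> s \<le> r \<Longrightarrow> 0 < w a s" "w a r powr (q - 1) < real n + 1 - \<alpha>" for r
    proof (rule ccontr)
      assume "\<not> r * w a r + F a r \<le> 0"
      then have "a \<in> good" unfolding good_def using a(1) that by (auto simp: not_le intro!: exI[of _ r])
      then show False using a(2) by simp
    qed
  qed
qed

end

section \<open>From the threshold solution to its asymptotics\<close>

lemma decay_system_of_radial_sol:
  assumes "radial_sol n m \<alpha> q 1 a w F" "m < 1" "1 \<le> T"
    and pos: "\<And>r. 0 \<le> r \<Longrightarrow> 0 < w r"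
    and J: "\<And>r. T \<le> r \<Longrightarrow> r ^ n * (r * w r + F r) < 0"
    and small: "\<And>r. T \<le> r \<Longrightarrow> w r powr (q - 1) < real n + 1 - \<alpha>"
    and d: "d = (1 + m) / (1 - m)"
  shows "decay_system d (real n + 1) (real n + 1 - \<alpha>) (1 / m) (ln T)
    (\<lambda>t. exp (d * t) * w (exp t)) (\<lambda>t. - (exp ((d - (real n + 1)) * t) * (exp t ^ n * (exp t * w (exp t) + F (exp t)))))
    (\<lambda>t. w (exp t) powr (q - 1))"
proof -
  interpret radial_sol n m \<alpha> q 1 a w F by (rule assms(1))
  define U where "U t = exp (d * t) * w (exp t)" for t
  define k where "k t = - (exp ((d - (real n + 1)) * t) * J (exp t))" for t
  have J_eq: "exp t ^ n * (exp t * w (exp t) + F (exp t)) = J (exp t)" for t by (simp add: J_def)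
  have T: "T \<le> exp t" if "ln T \<le> t" for t
    using that assms(3) by (metis exp_le_cancel_iff exp_ln less_le_trans zero_less_one)
  have kpos: "0 < k t" if "ln T \<le> t" for t
    using J[OF T[OF that]] unfolding k_def J_eq by (simp add: mult_pos_neg)
  have Upos: "0 < U t" for t using pos by (simp add: U_def)
  \<comment> \<open>\<open>\<delta>\<close> is the only exponent with this property, which cancels
    all powers of \<open>r\<close> in the equation for \<open>U\<close>.\<close>
  have cd: "c * (1 - d) + d + 1 = 0"
  proof -
    have "1 - d = - (2 * m) / (1 - m)" "d + 1 = 2 / (1 - m)" using assms(2) by (auto simp: d field_simps)
    then show ?thesis using m_pos by (simp add: c_def add.assoc)
  qed
  \<comment> \<open>The two coordinates split the rescaled flux \<open>- r^(d-1) F\<close> into its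
    drift part \<open>r w\<close> and the part carried by \<open>- J\<close>.\<close>
  have F_eq: "- F (exp t) = exp ((1 - d) * t) * (U t + k t)" for t
  proof -
    have "exp ((1 - d) * t) * U t = exp t * w (exp t)" unfolding U_def mult.assoc[symmetric] exp_add[symmetric]
      by (simp add: algebra_simps)
    moreover have "exp ((1 - d) * t) * k t = - (exp (- (real n * t)) * J (exp t))"
      unfolding k_def mult_minus_right mult.assoc[symmetric] exp_add[symmetric] by (simp add: algebra_simps)
    moreover have "exp (- (real n * t)) * J (exp t) = exp t * w (exp t) + F (exp t)"
      by (simp add: J_def exp_minus exp_of_nat_mult)
    ultimately show ?thesis by (simp add: distrib_left)
  qed
  have expd: "(exp has_real_derivative exp t) (at t)" for t :: real by (rule DERIV_exp)
  have U_der: "(U has_real_derivative d * U t - (U t + k t) powr c) (at t)" if t: "ln T \<le> t" for t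
  proof -
    have "((\<lambda>t. w (exp t)) has_real_derivative spow c (F (exp t)) * exp t) (at t)"
      by (rule DERIV_chain2[OF w_deriv_c expd]) simp
    then have "(U has_real_derivative d * exp (d * t) * w (exp t) + spow c (F (exp t)) * exp t * exp (d * t)) (at t)"
      unfolding U_def by (auto intro!: derivative_eq_intros)
    moreover have "spow c (F (exp t)) * exp t * exp (d * t) = - ((U t + k t) powr c)"
    proof -
      have "0 < exp ((1 - d) * t) * (U t + k t)" using Upos kpos[OF t] by (simp add: add_pos_pos)
      then have "spow c (F (exp t)) = - ((exp ((1 - d) * t) * (U t + k t)) powr c)"
        unfolding F_eq[symmetric] by (simp add: spow_neg_eq)
      also have "(exp ((1 - d) * t) * (U t + k t)) powr c = exp (c * (1 - d) * t) * (U t + k t) powr c"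
        using Upos[of t] kpos[OF t] by (simp add: powr_mult powr_def[of "exp _"] mult.assoc)
      finally have "spow c (F (exp t)) * exp t * exp (d * t) =
          - (exp (c * (1 - d) * t) * exp t * exp (d * t) * (U t + k t) powr c)"
        by (simp only: mult_minus_left mult_ac)
      moreover have "exp (c * (1 - d) * t) * exp t * exp (d * t) = exp ((c * (1 - d) + d + 1) * t)"
        unfolding exp_add[symmetric] by (simp add: distrib_right)
      ultimately show ?thesis by (simp add: cd)
    qed
    ultimately show ?thesis by (elim DERIV_cong) (simp add: U_def)
  qed
  have k_der: "(k has_real_derivative (d - (real n + 1)) * k t - (real n + 1 - \<alpha> - w (exp t) powr (q - 1)) * U t) (at t)" for t
  proof -
    have "((\<lambda>t. J (exp t)) has_real_derivative exp t ^ n * H (w (exp t)) * exp t) (at t)"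
      by (rule DERIV_chain2[OF J_deriv expd]) simp
    then have "(k has_real_derivative - ((d - (real n + 1)) * exp ((d - (real n + 1)) * t) * J (exp t)
        + exp t ^ n * H (w (exp t)) * exp t * exp ((d - (real n + 1)) * t))) (at t)"
      unfolding k_def by (auto intro!: derivative_eq_intros)
    moreover have "exp t ^ n * exp t * exp ((d - (real n + 1)) * t) = exp (d * t)"
      unfolding exp_of_nat_mult[symmetric] exp_add[symmetric] by (simp add: algebra_simps)
    then have "exp t ^ n * H (w (exp t)) * exp t * exp ((d - (real n + 1)) * t) = exp (d * t) * H (w (exp t))"
      by (metis mult.assoc mult.commute)
    moreover have "H (w (exp t)) = (real n + 1 - \<alpha> - w (exp t) powr (q - 1)) * w (exp t)"
      using pos[of "exp t"] by (simp add: H_def spow_def algebra_simps)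
    ultimately show ?thesis by (elim DERIV_cong) (simp add: k_def U_def)
  qed
  have \<theta>: "((\<lambda>t. w (exp t) powr (q - 1)) \<longlongrightarrow> 0) at_top"
    by (rule filterlim_compose[OF w_powr_tendsto_0[OF pos] exp_at_top])
  show ?thesis
    unfolding J_eq U_def[symmetric] k_def[symmetric]
  proof
    show "0 < d" "1 < 1 / m" using assms(2) m_pos by (auto simp: d)
    show "(U has_real_derivative d * U t - (U t + k t) powr (1 / m)) (at t)" if "ln T \<le> t" for t
      using U_der[OF that] by (simp add: c_def)
    show "w (exp t) powr (q - 1) < real n + 1 - \<alpha>" if "ln T \<le> t" for t using small[OF T[OF that]] .
  qed (use Upos kpos k_der \<theta> alpha_less in auto)
qed

lemma tendsto_ln_transfer:
  fixes U :: "real \<Rightarrow> real"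
  assumes "(U \<longlongrightarrow> l) at_top" "\<And>r. 0 < r \<Longrightarrow> U (ln r) = f r"
  shows "(f \<longlongrightarrow> l) at_top"
proof (rule Lim_transform_eventually)
  show "((\<lambda>r. U (ln r)) \<longlongrightarrow> l) at_top" by (rule filterlim_compose[OF assms(1) ln_at_top])
  show "\<forall>\<^sub>F r in at_top. U (ln r) = f r"
    using eventually_gt_at_top[of 0] by eventually_elim (rule assms(2))
qed

lemma sublinear_exponent:
  assumes "1 < p" "ereal q < qstar (Suc n) p" "p - 1 < real n"
  shows "q * (real n - (p - 1)) < real n * (p - 1) + 2 * (p - 1) + 1"
proof -
  have "p < real (Suc n)" using assms(3) by simp
  then have "q < (real (Suc n) * (p - 1) + p) / (real (Suc n) - p)"
    using assms(2) by (simp add: qstar_def)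
  then have "q * (real (Suc n) - p) < real (Suc n) * (p - 1) + p"
    using \<open>p < real (Suc n)\<close> by (simp add: pos_less_divide_eq)
  then show ?thesis by (simp add: algebra_simps)
qed

context radial_sol
begin

lemma fast_decay:
  assumes m: "m < 1" and \<epsilon>: "\<epsilon> = 1" and alpha: "\<alpha> < delta (m + 1)"
    and nonneg: "\<And>r. 0 \<le> r \<Longrightarrow> 0 \<le> w r"
    and thr: "\<And>r. 0 < r \<Longrightarrow> (\<And>s. 0 \<le> s \<Longrightarrow> s \<le> r \<Longrightarrow> 0 < w s) \<Longrightarrow>
        w r powr (q - 1) < real n + 1 - \<alpha> \<Longrightarrow> r * w r + F r \<le> 0"
  shows "\<And>r. 0 \<le> r \<Longrightarrow> 0 < w r"
    and "((\<lambda>r. r powr \<alpha> * w r) \<longlongrightarrow> 0) at_top"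
    and "p1 (Suc n) < m + 1 \<Longrightarrow> ((\<lambda>r. r powr delta (m + 1) * w r) \<longlongrightarrow>
      (delta (m + 1) powr m * ((delta (m + 1) - (real n + 1)) / (delta (m + 1) - \<alpha>))) powr (1 / (1 - m))) at_top"
    and "m + 1 < p1 (Suc n) \<Longrightarrow> \<exists>K>0. ((\<lambda>r. r powr eta (Suc n) (m + 1) * w r) \<longlongrightarrow> K) at_top"
    and "m + 1 = p1 (Suc n) \<Longrightarrow> ((\<lambda>r. r ^ Suc n * ln r powr ((real n + 2) / 2) * w r) \<longlongrightarrow>
      1 / (real n + 1) * ((real n + 1) * real n / (2 * (real n + 1 - \<alpha>))) powr ((real n + 2) / 2)) at_top"
proof -
  show pos: "0 < w r" if "0 \<le> r" for r
    by (rule no_zero_if_m_less_1[OF m nonneg that])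
  have "J r \<le> 0" if "0 < r" "w r powr (q - 1) < \<epsilon> * (real n + 1 - \<alpha>)" for r
    unfolding J_def using thr[OF that(1) pos] that by (simp add: \<epsilon> mult_le_0_iff)
  then obtain T where T: "1 \<le> T" "\<And>r. T \<le> r \<Longrightarrow> J r < 0" "\<And>r. T \<le> r \<Longrightarrow> w r powr (q - 1) < \<epsilon> * (real n + 1 - \<alpha>)"
    using J_neg_eventually[OF pos] by metis
  define d where "d = (1 + m) / (1 - m)"
  have d_delta: "delta (m + 1) = d" by (simp add: delta_def d_def add.commute)
  define U where "U t = exp (d * t) * w (exp t)" for t
  have U_ln: "U (ln r) = r powr d * w r" if "0 < r" for r
    using that by (simp add: U_def powr_def)
  interpret D: decay_system d "real n + 1" "real n + 1 - \<alpha>" "1 / m" "ln T" U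
    "\<lambda>t. - (exp ((d - (real n + 1)) * t) * (exp t ^ n * (exp t * w (exp t) + F (exp t))))"
    "\<lambda>t. w (exp t) powr (q - 1)"
    unfolding U_def[abs_def]
    by (rule decay_system_of_radial_sol[OF _ m T(1) pos])
      (use T(2)[unfolded J_def] T(3) radial_sol_axioms in \<open>auto simp: \<epsilon> d_def\<close>)
  have mne: "1 - m \<noteq> 0" "m \<noteq> 0" using m m_pos by auto
  \<comment> \<open>For \<open>p < 2\<close>, comparing \<open>p\<close> with
    \<open>2 N / (N + 1)\<close> is comparing \<open>\<delta> = p / (2 - p)\<close> with
    \<open>N\<close>, that is, fixing the sign of the linear term in \<open>k'\<close>.\<close>
  have p1_iff: "p1 (Suc n) < m + 1 \<longleftrightarrow> real n + 1 < d" "m + 1 < p1 (Suc n) \<longleftrightarrow> d < real n + 1"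
    "m + 1 = p1 (Suc n) \<longleftrightarrow> d = real n + 1"
    using m by (auto simp: p1_def d_def field_simps)
  \<comment> \<open>Boundedness of \<open>U\<close> is the decay
    \<open>w = O(r^(-\<delta>))\<close>; with \<open>\<alpha> < \<delta>\<close> it settles the
    limit of \<open>r^\<alpha> w\<close>.\<close>
  obtain B where B: "0 < B" "\<And>t. ln T \<le> t \<Longrightarrow> U t \<le> B" using D.U_bounded by blast
  show "((\<lambda>r. r powr \<alpha> * w r) \<longlongrightarrow> 0) at_top"
  proof (rule Lim_null_comparison)
    have "((\<lambda>r. B * r powr (- (d - \<alpha>))) \<longlongrightarrow> B * 0) at_top"
      by (intro tendsto_mult tendsto_const tendsto_neg_powr filterlim_ident) (use alpha d_delta in simp)
    then show "((\<lambda>r. B * r powr (- (d - \<alpha>))) \<longlongrightarrow> 0) at_top" by simp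
    show "\<forall>\<^sub>F r in at_top. norm (r powr \<alpha> * w r) \<le> B * r powr (- (d - \<alpha>))"
      using eventually_ge_at_top[of T]
    proof eventually_elim
      case (elim r)
      then have r: "0 < r" using T(1) by simp
      have "r powr d * w r \<le> B" using B(2)[of "ln r"] elim T(1) U_ln[OF r] by simp
      then have "r powr (\<alpha> - d) * (r powr d * w r) \<le> r powr (\<alpha> - d) * B" by (intro mult_left_mono) auto
      moreover have "r powr (\<alpha> - d) * (r powr d * w r) = r powr \<alpha> * w r"
        using r by (simp add: powr_diff)
      ultimately have "r powr \<alpha> * w r \<le> r powr (\<alpha> - d) * B" by (simp only:)
      then show ?case using pos[of r] r by (simp add: mult.commute)
    qed
  qed
  show "((\<lambda>r. r powr delta (m + 1) * w r) \<longlongrightarrow>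
      (delta (m + 1) powr m * ((delta (m + 1) - (real n + 1)) / (delta (m + 1) - \<alpha>))) powr (1 / (1 - m))) at_top"
    if "p1 (Suc n) < m + 1"
  proof -
    have "((d - (real n + 1)) * d powr (1 / (1 / m)) / (d - (real n + 1) + (real n + 1 - \<alpha>))) powr (1 / (1 - 1 / (1 / m)))
      = (d powr m * ((d - (real n + 1)) / (d - \<alpha>))) powr (1 / (1 - m))" by (simp add: mult.commute)
    then show ?thesis
      using tendsto_ln_transfer[OF D.limit_if_greater U_ln] that p1_iff(1) unfolding d_delta by simp
  qed
  show "\<exists>K>0. ((\<lambda>r. r powr eta (Suc n) (m + 1) * w r) \<longlongrightarrow> K) at_top" if "m + 1 < p1 (Suc n)"
  proof -
    have dN: "d < real n + 1" using that p1_iff(2) by simp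
    obtain \<nu> where \<nu>: "0 < \<nu>" "((\<lambda>t. exp (1 / m * (real n + 1 - d) * t) * U t) \<longlongrightarrow>
        \<nu> powr (1 / m) / (d + 1 / m * (real n + 1 - d))) at_top"
      using D.exists_rate_if_less[OF dN] by blast
    \<comment> \<open>Here \<open>\<eta> = (N - p) / (p - 1)\<close> emerges: the factor in
      \<open>U = r^\<delta> w\<close> adds \<open>\<delta>\<close> to the rate
      \<open>(N - \<delta>) / (p - 1)\<close>.\<close>
    have "1 / m * (real n + 1 - d) + d = eta (Suc n) (m + 1)"
    proof -
      have "(1 - m) * d = 1 + m" using mne by (simp add: d_def)
      then have "m * (1 / m * (real n + 1 - d) + d) = real n - m" using mne by (simp add: algebra_simps)
      then show ?thesis using mne by (simp add: eta_def eq_divide_eq mult.commute)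
    qed
    then have eq: "exp (1 / m * (real n + 1 - d) * ln r) * U (ln r) = r powr eta (Suc n) (m + 1) * w r" if "0 < r" for r
      using that unfolding U_def mult.assoc[symmetric] exp_add[symmetric]
      by (simp add: powr_def distrib_right[symmetric] del: times_divide_eq_left)
    have "0 < \<nu> powr (1 / m) / (d + 1 / m * (real n + 1 - d))"
      using \<nu>(1) D.d_pos dN m_pos by (intro divide_pos_pos add_pos_pos) auto
    then show ?thesis using tendsto_ln_transfer[OF \<nu>(2) eq] by blast
  qed
  show "((\<lambda>r. r ^ Suc n * ln r powr ((real n + 2) / 2) * w r) \<longlongrightarrow>
      1 / (real n + 1) * ((real n + 1) * real n / (2 * (real n + 1 - \<alpha>))) powr ((real n + 2) / 2)) at_top"
    if "m + 1 = p1 (Suc n)"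
  proof -
    have dN: "d = real n + 1" using that p1_iff(3) by simp
    \<comment> \<open>\<open>\<delta> = N\<close> determines \<open>m\<close> from \<open>n\<close>;
      positivity of \<open>m\<close> then forces \<open>n > 0\<close>, and
      \<open>c / (c - 1)\<close> becomes \<open>(N + 1) / 2\<close>.\<close>
    then have mn: "m * (real n + 2) = real n" using mne by (simp add: d_def field_simps)
    have n0: "0 < real n" using mn m_pos by (metis add_nonneg_pos mult_pos_pos of_nat_0_le_iff zero_less_numeral)
    have m_eq: "m = real n / (real n + 2)" using mn by (simp add: field_simps)
    have e1: "1 / m / (1 / m - 1) = (real n + 2) / 2" "1 / m - 1 = 2 / real n"
      using n0 by (auto simp: m_eq field_simps)
    have "((1 / m - 1) * (real n + 1 - \<alpha>) / (real n + 1)) powr (- ((real n + 2) / 2))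
      = ((real n + 1) * real n / (2 * (real n + 1 - \<alpha>))) powr ((real n + 2) / 2)"
    proof -
      have "(2 / real n) * (real n + 1 - \<alpha>) / (real n + 1) = inverse ((real n + 1) * real n / (2 * (real n + 1 - \<alpha>)))"
        using n0 alpha_less by (simp add: field_simps)
      then show ?thesis unfolding e1(2) powr_minus using n0 alpha_less by (simp add: powr_divide powr_mult field_simps)
    qed
    moreover have "ln r powr ((real n + 2) / 2) * U (ln r) = r ^ Suc n * ln r powr ((real n + 2) / 2) * w r" if "0 < r" for r
    proof -
      have "r powr d = r ^ Suc n" using that powr_realpow[of r "Suc n"] by (simp add: dN add.commute)
      then show ?thesis using U_ln[OF that] by simp
    qed
    ultimately show ?thesis
      using tendsto_ln_transfer[OF D.limit_if_equal[OF dN]] unfolding e1(1) by simp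
  qed
qed

end

theorem theorem3p9:
  fixes N :: nat and p \<alpha> q :: real and w :: "real \<Rightarrow> real \<Rightarrow> real"
  assumes "N \<ge> 1" and "p > 1"
    and "p > 2 \<or> (p < 2 \<and> \<alpha> < delta p)"
    and "0 < \<alpha>" and "\<alpha> < real N"
    and "1 < q" and "ereal q < qstar N p"
    and "\<And>a. solves_ivp N p \<alpha> q a (w a)"
  shows "\<exists>a>0.
    (\<forall>r\<ge>0. w a r \<ge> 0) \<and>
    ((\<lambda>r. r powr \<alpha> * w a r) \<longlongrightarrow> 0) at_top \<and>
    (p > 2 \<longrightarrow> compact (closure (support_on {0..} (w a)))) \<and>
    (p < 2 \<longrightarrow>
      (\<forall>r\<ge>0. w a r > 0) \<and>
      (p1 N < p \<longrightarrow>
        ((\<lambda>r. r powr delta p * w a r) \<longlongrightarrow>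
          (delta p powr (p - 1) * ((delta p - real N) / (delta p - \<alpha>))) powr (1 / (2 - p))) at_top) \<and>
      (p < p1 N \<longrightarrow>
        (\<exists>c>0. ((\<lambda>r. r powr eta N p * w a r) \<longlongrightarrow> c) at_top)) \<and>
      (p = p1 N \<longrightarrow>
        ((\<lambda>r. r ^ N * ln r powr ((real N + 1) / 2) * w a r) \<longlongrightarrow>
          1 / real N * (real N * (real N - 1) / (2 * (real N - \<alpha>))) powr ((real N + 1) / 2)) at_top))"
proof -
  obtain n where N: "N = Suc n" using assms(1) by (cases N) auto
  have "\<exists>F. radial_sol n (p - 1) \<alpha> q 1 a (w a) F" if "0 < a" for a
    by (rule radial_sol_of_solves_ivp) (use assms that in \<open>auto simp: N\<close>)
  then obtain F where sol: "\<And>a. 0 < a \<Longrightarrow> radial_sol n (p - 1) \<alpha> q 1 a (w a) (F a)" by metis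
  interpret fam: radial_family n "p - 1" \<alpha> q w F by (rule radial_family.intro) (rule sol)
  obtain a where a: "0 < a" and nonneg: "\<And>r. 0 \<le> r \<Longrightarrow> 0 \<le> w a r"
    and thr: "\<And>r. 0 < r \<Longrightarrow> (\<And>s. 0 \<le> s \<Longrightarrow> s \<le> r \<Longrightarrow> 0 < w a s) \<Longrightarrow>
        w a r powr (q - 1) < real n + 1 - \<alpha> \<Longrightarrow> r * w a r + F a r \<le> 0"
    using fam.exists_threshold[OF sublinear_exponent[OF assms(2) assms(7)[unfolded N]]] by blast
  interpret radial_sol n "p - 1" \<alpha> q 1 a "w a" "F a" by (rule sol[OF a])
  show ?thesis
  proof (cases "2 < p")
    case True
    have "J r \<le> 0" if "0 < r" "\<And>s. 0 \<le> s \<Longrightarrow> s \<le> r \<Longrightarrow> 0 < w a s" "w a r powr (q - 1) < 1 * (real n + 1 - \<alpha>)" for r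
      using thr[OF that(1,2)] that(1,3) by (simp add: J_def mult_le_0_iff)
    then obtain R where R: "0 \<le> R" "\<And>r. R \<le> r \<Longrightarrow> w a r = 0"
      using compact_support_if_m_greater_1[OF _ nonneg] True by (metis add_less_cancel_right diff_add_cancel one_add_one)
    have "((\<lambda>r. r powr \<alpha> * w a r) \<longlongrightarrow> 0) at_top"
      by (rule tendsto_eventually) (auto intro!: eventually_at_top_linorderI[of R] R)
    moreover have "support_on {0..} (w a) \<subseteq> {0..R}"
    proof
      fix r assume "r \<in> support_on {0..} (w a)"
      then have "0 \<le> r" "w a r \<noteq> 0" by (auto simp: support_on_def)
      then show "r \<in> {0..R}" using R(2)[of r] by (cases "r \<le> R") auto
    qed
    then have "compact (closure (support_on {0..} (w a)))"
      by (meson bounded_closed_interval bounded_subset compact_closure)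
    ultimately show ?thesis using a nonneg True by (intro exI[of _ a]) auto
  next
    case False
    then have p: "p < 2" "p - 1 < 1" "\<alpha> < delta (p - 1 + 1)" using assms(3) by auto
    note concl = fast_decay[OF p(2) refl p(3) nonneg thr]
    have [simp]: "p - 1 + 1 = p" "1 - (p - 1) = 2 - p" by simp_all
    have NN: "real N = real n + 1" "(real N + 1) / 2 = (real n + 2) / 2" "real N - 1 = real n" by (auto simp: N)
    show ?thesis
      using a nonneg p(1) concl[simplified] False unfolding NN unfolding N
      by (intro exI[of _ a]) (auto simp: add.commute[of 2 "real n"])
  qed
qed

end
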